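(* Let $\Omega=\mathbb{T}$, $T>0$, suppose $V_x=0$, and let $p\in[1,+\infty]$. Let $m_0,m_T\in L^p(\mathbb{T})$ be non-negative with $\int_{\mathbb{T}}m_0\,dx=\int_{\mathbb{T}}m_T\,dx=1$. For each $N\in\mathbb{N}$, let $\mathbf{x}^{0}=(x_{0,1},\dots,x_{0,N})$ and $\mathbf{x}^{T}=(x_{T,1},\dots,x_{T,N})$ in $\mathcal{K}^N$ be atomizations of $m_0$ and $m_T$, i.e. $$\int_{x_{0,i-1}}^{x_{0,i}}m_0(x)\,dx=\frac1N,\qquad \int_{x_{T,i-1}}^{x_{T,i}}m_T(x)\,dx=\frac1N,\qquad i=1,\dots,N,$$ with $x_{0,0}=x_{0,N}-1$, $x_{T,0}=x_{T,N}-1$. Let $\mathbf{x}=(x_1,\dots,x_N)$ (depending on $N$) be a solution of the $N$-particle variational problem described in the context with data $\mathbf{x}(0)=\mathbf{x}^0$, $\mathbf{x}(T)=\mathbf{x}^T$, with $x_{i-1}(t)<x_i(t)$ for all $1\le i\le N$ and $t\in[0,T]$, and define the discrete density on $\mathbb{T}$ $$m^N(x,t)=\sum_{i=1}^N R_i(t)\,\mathbf{1}_{[x_{i-1}(t),x_i(t))}(x),\qquad R_i(t)=\frac{1/N}{x_i(t)-x_{i-1}(t)}.$$ Then $$\sup_{t\in[0,T],\,N\in\mathbb{N}}\|m^N(\cdot,t)\|_{L^p(\mathbb{T})}<+\infty .$$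
   Context: Standing data. $g\in C^1([0,\infty))$ is real-valued and non-decreasing, with $r\mapsto r g'(r)$ locally integrable near $0$. $G:(0,\infty)\to\mathbb{R}$ is a $C^1$ function (determined up to a constant) with $G'(r)=\frac{1}{r^2}\int_0^r s g'(s)\,ds$; $G$ is assumed convex. $L:\mathbb{R}\to\mathbb{R}$ is of class $C^2$, bounded below and uniformly convex: there is $\theta>0$ with $L(\lambda u+(1-\lambda)v)\le \lambda L(u)+(1-\lambda)L(v)-\theta\lambda(1-\lambda)(u-v)^2$ for all $u,v\in\mathbb{R}$, $\lambda\in[0,1]$. $V\in C^1(\mathbb{T}\times[0,T];\mathbb{R})$ is the potential, where $\mathbb{T}=\mathbb{R}/\mathbb{Z}$. Functions on $\mathbb{T}$ are identified with $1$-periodic functions on $\mathbb{R}$, and intervals in $\mathbb{R}$ of length at most $1$ are identified with their images in $\mathbb{T}$. Configuration space (periodic case). Particle positions on $\mathbb{T}$ are represented by ordered lifts in $\mathbb{R}$: $\mathcal{K}^N=\{(x_1,\dots,x_N)\in\mathbb{R}^N: x_1\le\dots\le x_N\le x_1+1\}$, with the convention $x_0=x_N-1$. The $N$-particle variational problem. Given $\mathbf{x}^0,\mathbf{x}^T\in\mathcal{K}^N$, minimize $$\widetilde{\mathcal J}(\mathbf{x},\dot{\mathbf{x}})=\frac1N\sum_{i=1}^N\int_0^T\Big[L(\dot x_i(s))+G\Big(\frac{1/N}{x_i(s)-x_{i-1}(s)}\Big)-V(x_i(s),s)\Big]ds$$ among absolutely continuous $\mathbf{x}:[0,T]\to\mathcal{K}^N$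 with $\mathbf{x}(0)=\mathbf{x}^0$, $\mathbf{x}(T)=\mathbf{x}^T$. When $x_i(s)=x_{i-1}(s)$, the $G$-term is interpreted as $\lim_{r\to\infty}G(r)\in(-\infty,+\infty]$. A minimizer is called a solution. *)

theory Defs
  imports "HOL-Probability.Essential_Supremum"
begin

section \<open>Function spaces\<close>

definition C1_halfline :: "(real \<Rightarrow> real) \<Rightarrow> bool" where
  "C1_halfline g \<longleftrightarrow>
     (\<exists>g'. (\<forall>r\<in>{0..}. (g has_real_derivative g' r) (at r within {0..})) \<and> continuous_on {0..} g')"

definition one_periodic :: "(real \<Rightarrow> 'a) \<Rightarrow> bool" where
  "one_periodic f \<longleftrightarrow> (\<forall>u. f (u + 1) = f u)"

text \<open>\<open>C\<^sup>1\<close> functions on the product of the circle with \<open>[0,T]\<close>, the circle variable being lifted to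
  the real line.\<close>

definition C1_circle_strip :: "real \<Rightarrow> (real \<Rightarrow> real \<Rightarrow> real) \<Rightarrow> bool" where
  "C1_circle_strip T V \<longleftrightarrow>
     (\<forall>t\<in>{0..T}. one_periodic (\<lambda>u. V u t)) \<and>
     (\<exists>Vx Vt.
        (\<forall>z\<in>UNIV \<times> {0..T}. ((\<lambda>(u, t). V u t) has_derivative (\<lambda>(h, k). Vx z * h + Vt z * k))
                              (at z within UNIV \<times> {0..T})) \<and>
        continuous_on (UNIV \<times> {0..T}) Vx \<and> continuous_on (UNIV \<times> {0..T}) Vt)"

definition uniformly_convex :: "(real \<Rightarrow> real) \<Rightarrow> bool" where
  "uniformly_convex L \<longleftrightarrow>
     (\<exists>\<theta>>0. \<forall>u v. \<forall>l\<in>{0..1}.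
        L (l * u + (1 - l) * v) \<le> l * L u + (1 - l) * L v - \<theta> * l * (1 - l) * (u - v)\<^sup>2)"

definition abs_continuous_on :: "real \<Rightarrow> real \<Rightarrow> (real \<Rightarrow> real) \<Rightarrow> bool" where
  "abs_continuous_on a b f \<longleftrightarrow>
     (\<forall>\<epsilon>>0. \<exists>\<delta>>0. \<forall>(n::nat) c d.
        (\<forall>k<n. a \<le> c k \<and> c k \<le> d k \<and> d k \<le> b) \<longrightarrow>
        (\<forall>j<n. \<forall>k<n. j \<noteq> k \<longrightarrow> {c j<..<d j} \<inter> {c k<..<d k} = {}) \<longrightarrow>
        (\<Sum>k<n. d k - c k) < \<delta> \<longrightarrow>
        (\<Sum>k<n. \<bar>f (d k) - f (c k)\<bar>) < \<epsilon>)"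

definition Lp_norm :: "'a measure \<Rightarrow> ennreal \<Rightarrow> ('a \<Rightarrow> real) \<Rightarrow> ennreal" where
  "Lp_norm M p f =
     (if p = \<infinity> then esssup M (\<lambda>u. ennreal \<bar>f u\<bar>)
      else (let I = (\<integral>\<^sup>+ u. ennreal (\<bar>f u\<bar> powr enn2real p) \<partial>M)
            in if I = \<infinity> then \<infinity> else ennreal (enn2real I powr (1 / enn2real p))))"

text \<open>The circle as the fundamental domain \<open>[0,1)\<close>; functions on it are restrictions of 1-periodic
  functions on the real line.\<close>

definition circle_measure :: "real measure" where
  "circle_measure = lebesgue_on {0..<1}"

definition Lp_circle :: "ennreal \<Rightarrow> (real \<Rightarrow> real) set" where
  "Lp_circle p = {f. f \<in> borel_measurable lebesgue \<and> one_periodic f \<and> Lp_norm circle_measure p f < \<infinity>}"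

text \<open>Integral of an extended-real function, as integral of the positive part minus integral of
  the negative part. It is only meaningful when one of the two is finite; the integrands used
  below are bounded below on a finite measure space.\<close>

definition ereal_integral :: "'a measure \<Rightarrow> ('a \<Rightarrow> ereal) \<Rightarrow> ereal" where
  "ereal_integral M f =
     enn2ereal (\<integral>\<^sup>+ u. e2ennreal (f u) \<partial>M) - enn2ereal (\<integral>\<^sup>+ u. e2ennreal (- f u) \<partial>M)"


section \<open>Particle configurations\<close>

text \<open>A configuration of \<open>N\<close> particles is a function on \<open>nat\<close> of which only the values at
  \<open>1, \<dots>, N\<close> matter; \<open>pos\<close> adds the convention \<open>x\<^sub>0 = x\<^sub>N - 1\<close>.\<close>

definition pos :: "nat \<Rightarrow> (nat \<Rightarrow> real) \<Rightarrow> nat \<Rightarrow> real" where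
  "pos N y i = (if i = 0 then y N - 1 else y i)"

definition configs :: "nat \<Rightarrow> (nat \<Rightarrow> real) set" where
  "configs N = {y. mono_on {1..N} y \<and> y N \<le> y 1 + 1}"

definition gap :: "nat \<Rightarrow> (nat \<Rightarrow> real) \<Rightarrow> nat \<Rightarrow> real" where
  "gap N y i = pos N y i - pos N y (i - 1)"

definition atomization :: "nat \<Rightarrow> (real \<Rightarrow> real) \<Rightarrow> (nat \<Rightarrow> real) \<Rightarrow> bool" where
  "atomization N m y \<longleftrightarrow>
     y \<in> configs N \<and>
     (\<forall>i\<in>{1..N}. (LINT u:{pos N y (i - 1)..pos N y i}|lebesgue. m u) = 1 / real N)"

definition discrete_density :: "nat \<Rightarrow> (nat \<Rightarrow> real) \<Rightarrow> real \<Rightarrow> real" where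
  "discrete_density N y u =
     (\<Sum>i=1..N. (1 / real N) / gap N y i *
        of_bool (\<exists>k::int. u + of_int k \<in> {pos N y (i - 1)..<pos N y i}))"


section \<open>The N-particle variational problem\<close>

definition G_term :: "(real \<Rightarrow> real) \<Rightarrow> nat \<Rightarrow> (nat \<Rightarrow> real) \<Rightarrow> nat \<Rightarrow> ereal" where
  "G_term G N y i =
     (if gap N y i = 0 then Lim at_top (\<lambda>r. ereal (G r))
      else ereal (G ((1 / real N) / gap N y i)))"

definition action ::
  "(real \<Rightarrow> real) \<Rightarrow> (real \<Rightarrow> real) \<Rightarrow> (real \<Rightarrow> real \<Rightarrow> real) \<Rightarrow> real \<Rightarrow> nat \<Rightarrow> (real \<Rightarrow> nat \<Rightarrow> real) \<Rightarrow> ereal"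
where
  "action L G V T N x =
     ereal (1 / real N) *
       (\<Sum>i=1..N. ereal_integral (lebesgue_on {0..T})
          (\<lambda>s. ereal (L (deriv (\<lambda>t. x t i) s)) + G_term G N (x s) i - ereal (V (x s i) s)))"

definition admissible ::
  "real \<Rightarrow> nat \<Rightarrow> (nat \<Rightarrow> real) \<Rightarrow> (nat \<Rightarrow> real) \<Rightarrow> (real \<Rightarrow> nat \<Rightarrow> real) \<Rightarrow> bool"
where
  "admissible T N y0 yT x \<longleftrightarrow>
     (\<forall>i\<in>{1..N}. abs_continuous_on 0 T (\<lambda>t. x t i)) \<and>
     (\<forall>t\<in>{0..T}. x t \<in> configs N) \<and>
     (\<forall>i\<in>{1..N}. x 0 i = y0 i \<and> x T i = yT i)"

definition particle_solution ::
  "(real \<Rightarrow> real) \<Rightarrow> (real \<Rightarrow> real) \<Rightarrow> (real \<Rightarrow> real \<Rightarrow> real) \<Rightarrow> real \<Rightarrow> nat \<Rightarrow>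
   (nat \<Rightarrow> real) \<Rightarrow> (nat \<Rightarrow> real) \<Rightarrow> (real \<Rightarrow> nat \<Rightarrow> real) \<Rightarrow> bool"
where
  "particle_solution L G V T N y0 yT x \<longleftrightarrow>
     admissible T N y0 yT x \<and>
     (\<forall>y. admissible T N y0 yT y \<longrightarrow> action L G V T N x \<le> action L G V T N y)"

end

(*
  Perturbing a single particle j of the minimizer in a direction h with derivative psi gives the
  Euler-Lagrange equation d/dt L'(x_j') = f(gap_j) - f(gap_(j+1)), where f is the derivative of
  r |-> G(1/(N r)).  No growth condition on L is needed: psi is cut off with a weight that tames
  L' near the (a priori unbounded) velocity, and convexity of L bounds the increments.  Since L'' > 0,
  the particles then move along C^2 curves.  As f and the derivative of r |-> r^(1-p) are both
  non-decreasing, the accelerations only help: t |-> sum_i gap_i(t)^(1-p) is convex, hence bounded by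
  its end values, which Jensen's inequality bounds by the L^p norms of m_0 and m_T.  The case
  p = infinity follows by letting the exponent tend to infinity.  Velocities make sense because an
  absolutely continuous function is the integral of its almost everywhere derivative, which is
  obtained here from the Radon-Nikodym theorem and Lebesgue differentiation.
*)
theory Submission
  imports Defs
begin

section \<open>Absolutely continuous functions\<close>

text \<open>Quantities that degenerate as \<open>N\<close> grows, such as the least gap, occur only
  in the regularity part, where \<open>N\<close> is fixed. What reaches the final estimate is
  \<open>(1/N)^q\<close> times the sum of \<open>gap_i^(1-q)\<close>, which is the q-th power of the
  L^q norm of the discrete density. Convexity in time and Jensen's inequality both act on this very
  quantity and lose no constant, so the bound does not depend on \<open>N\<close>. The same
  sharpness settles the sup norm: if the end densities are at most \<open>C\<close>, the quantity
  never exceeds \<open>C^q\<close>, and the exponent may be chosen after \<open>N\<close>, the time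
  and the particle. The minimizer is a priori merely absolutely continuous, and \<open>L'\<close> of
  its velocity is not known to be integrable; so neither the usual weak Euler-Lagrange equation nor
  a second time derivative is available at the outset. The equation is therefore obtained in
  integrated form, momentum = constant + impulse, and smoothness is read off by inverting
  \<open>L'\<close>. As \<open>V\<close> depends on time only, it adds the same amount to every
  action and exerts no force.\<close>

definition interval_family ::
  "'i set \<Rightarrow> real \<Rightarrow> real \<Rightarrow> ('i \<Rightarrow> real) \<Rightarrow> ('i \<Rightarrow> real) \<Rightarrow> bool" where
  "interval_family I a b c d \<longleftrightarrow>
     finite I \<and> (\<forall>i\<in>I. a \<le> c i \<and> c i \<le> d i \<and> d i \<le> b) \<and> disjoint_family_on (\<lambda>i. {c i<..<d i}) I"

lemma interval_family_length_le:
  assumes "interval_family I a b c d" "a \<le> b"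
  shows "(\<Sum>i\<in>I. d i - c i) \<le> b - a"
proof -
  have "(\<Sum>i\<in>I. d i - c i) = (\<Sum>i\<in>I. measure lborel {c i<..<d i})"
    using assms by (intro sum.cong) (auto simp: interval_family_def)
  also have "\<dots> = measure lborel (\<Union>i\<in>I. {c i<..<d i})"
    using assms by (intro measure_finite_Union [symmetric]) (auto simp: interval_family_def)
  also have "\<dots> \<le> measure lborel {a..b}"
  proof (rule measure_mono_fmeasurable)
    show "(\<Union>i\<in>I. {c i<..<d i}) \<subseteq> {a..b}"
      using assms by (force simp: interval_family_def)
    show "{a..b} \<in> fmeasurable lborel"
      by (simp add: fmeasurable_def emeasure_lborel_Icc_eq)
    show "(\<Union>i\<in>I. {c i<..<d i}) \<in> sets lborel"
      using assms by (auto simp: interval_family_def)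
  qed
  also have "\<dots> = b - a" using assms by simp
  finally show ?thesis .
qed

lemma interval_family_widen:
  "interval_family I a b c d \<Longrightarrow> a' \<le> a \<Longrightarrow> b \<le> b' \<Longrightarrow> interval_family I a' b' c d"
  unfolding interval_family_def by fastforce

lemma interval_family_reindex:
  assumes "interval_family I a b c d" "bij_betw h J I"
  shows "interval_family J a b (c \<circ> h) (d \<circ> h)"
proof -
  have "finite J" "\<And>j. j \<in> J \<Longrightarrow> h j \<in> I"
    using assms by (auto simp: interval_family_def bij_betw_finite bij_betw_apply)
  moreover have "{c (h j)<..<d (h j)} \<inter> {c (h k)<..<d (h k)} = {}"
    if "j \<in> J" "k \<in> J" "j \<noteq> k" for j k
  proof -
    have "h j \<noteq> h k" using that assms(2) by (meson bij_betw_def inj_on_eq_iff)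
    then show ?thesis using assms that \<open>\<And>j. j \<in> J \<Longrightarrow> h j \<in> I\<close>
      unfolding interval_family_def disjoint_family_on_def by blast
  qed
  ultimately show ?thesis using assms(1)
    by (auto simp: interval_family_def disjoint_family_on_def) 
qed

lemma disjoint_family_on_subfamily:
  assumes "disjoint_family_on A I" "\<And>i. B i \<subseteq> A i"
  shows "disjoint_family_on B I"
  using assms unfolding disjoint_family_on_def by blast

text \<open>Transport along an enumeration frees the index type: later families are indexed by
  pairs, by sets of intervals and by a one-point type.\<close>

lemma abs_continuous_on_family:
  assumes "abs_continuous_on a b f" "\<epsilon> > 0"
  obtains \<delta> where "\<delta> > 0"
    "\<And>(I :: 'i set) c d. interval_family I a b c d \<Longrightarrow> (\<Sum>i\<in>I. d i - c i) < \<delta> \<Longrightarrow>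
       (\<Sum>i\<in>I. \<bar>f (d i) - f (c i)\<bar>) < \<epsilon>"
proof -
  obtain \<delta> where \<delta>: "\<delta> > 0" "\<forall>(n::nat) c d.
        (\<forall>k<n. a \<le> c k \<and> c k \<le> d k \<and> d k \<le> b) \<longrightarrow>
        (\<forall>j<n. \<forall>k<n. j \<noteq> k \<longrightarrow> {c j<..<d j} \<inter> {c k<..<d k} = {}) \<longrightarrow>
        (\<Sum>k<n. d k - c k) < \<delta> \<longrightarrow>
        (\<Sum>k<n. \<bar>f (d k) - f (c k)\<bar>) < \<epsilon>"
    using assms(1)[unfolded abs_continuous_on_def, THEN spec, THEN mp, OF assms(2)] by blast
  show ?thesis
  proof (rule that[OF \<delta>(1)])
    fix I :: "'i set" and c d
    assume I: "interval_family I a b c d" and lt: "(\<Sum>i\<in>I. d i - c i) < \<delta>"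
    then obtain h where h: "bij_betw h {..<card I} I"
      by (metis ex_bij_betw_nat_finite interval_family_def lessThan_atLeast0)
    have F: "interval_family {..<card I} a b (c \<circ> h) (d \<circ> h)"
      using interval_family_reindex[OF I h] .
    have "(\<Sum>k<card I. d (h k) - c (h k)) < \<delta>"
      using lt sum.reindex_bij_betw[OF h, of "\<lambda>i. d i - c i"] by simp
    moreover have "\<forall>j<card I. \<forall>k<card I. j \<noteq> k \<longrightarrow>
        {(c \<circ> h) j<..<(d \<circ> h) j} \<inter> {(c \<circ> h) k<..<(d \<circ> h) k} = {}"
      using F unfolding interval_family_def disjoint_family_on_def by blast
    moreover have "\<forall>k<card I. a \<le> (c \<circ> h) k \<and> (c \<circ> h) k \<le> (d \<circ> h) k \<and> (d \<circ> h) k \<le> b"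
      using F unfolding interval_family_def by blast
    ultimately have "(\<Sum>k<card I. \<bar>f (d (h k)) - f (c (h k))\<bar>) < \<epsilon>"
      using \<delta>(2)[rule_format, of "card I" "c \<circ> h" "d \<circ> h"] by simp
    then show "(\<Sum>i\<in>I. \<bar>f (d i) - f (c i)\<bar>) < \<epsilon>"
      using sum.reindex_bij_betw[OF h, of "\<lambda>i. \<bar>f (d i) - f (c i)\<bar>"] by simp
  qed
qed

lemma abs_continuous_onI:
  assumes "\<And>\<epsilon>. \<epsilon> > 0 \<Longrightarrow> \<exists>\<delta>>0. \<forall>(n::nat) c d. interval_family {..<n} a b c d \<longrightarrow>
     (\<Sum>k<n. d k - c k) < \<delta> \<longrightarrow> (\<Sum>k<n. \<bar>f (d k) - f (c k)\<bar>) < \<epsilon>"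
  shows "abs_continuous_on a b f"
  unfolding abs_continuous_on_def
proof (intro allI impI)
  fix \<epsilon> :: real assume "\<epsilon> > 0"
  then obtain \<delta> where \<delta>: "\<delta> > 0" "\<forall>(n::nat) c d. interval_family {..<n} a b c d \<longrightarrow>
     (\<Sum>k<n. d k - c k) < \<delta> \<longrightarrow> (\<Sum>k<n. \<bar>f (d k) - f (c k)\<bar>) < \<epsilon>"
    using assms by blast
  show "\<exists>\<delta>>0. \<forall>(n::nat) c d. (\<forall>k<n. a \<le> c k \<and> c k \<le> d k \<and> d k \<le> b) \<longrightarrow>
      (\<forall>j<n. \<forall>k<n. j \<noteq> k \<longrightarrow> {c j<..<d j} \<inter> {c k<..<d k} = {}) \<longrightarrow>
      (\<Sum>k<n. d k - c k) < \<delta> \<longrightarrow> (\<Sum>k<n. \<bar>f (d k) - f (c k)\<bar>) < \<epsilon>"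
    by (rule exI[of _ \<delta>], intro conjI allI impI \<delta>(1) \<delta>(2)[rule_format])
       (unfold interval_family_def disjoint_family_on_def, blast+)
qed

lemma abs_continuous_on_diff:
  assumes "abs_continuous_on a b f" "abs_continuous_on a b g"
  shows "abs_continuous_on a b (\<lambda>t. f t - g t)"
proof (rule abs_continuous_onI)
  fix \<epsilon> :: real assume "\<epsilon> > 0"
  then have "\<epsilon> / 2 > 0" by simp
  obtain \<delta>1 where \<delta>1: "\<delta>1 > 0" "\<And>(I :: nat set) c d. interval_family I a b c d \<Longrightarrow>
     (\<Sum>i\<in>I. d i - c i) < \<delta>1 \<Longrightarrow> (\<Sum>i\<in>I. \<bar>f (d i) - f (c i)\<bar>) < \<epsilon> / 2"
    using abs_continuous_on_family[OF assms(1) \<open>\<epsilon> / 2 > 0\<close>] by blast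
  obtain \<delta>2 where \<delta>2: "\<delta>2 > 0" "\<And>(I :: nat set) c d. interval_family I a b c d \<Longrightarrow>
     (\<Sum>i\<in>I. d i - c i) < \<delta>2 \<Longrightarrow> (\<Sum>i\<in>I. \<bar>g (d i) - g (c i)\<bar>) < \<epsilon> / 2"
    using abs_continuous_on_family[OF assms(2) \<open>\<epsilon> / 2 > 0\<close>] by blast
  have "(\<Sum>k<n. \<bar>f (d k) - g (d k) - (f (c k) - g (c k))\<bar>) < \<epsilon>"
    if "interval_family {..<n} a b c d" "(\<Sum>k<n. d k - c k) < min \<delta>1 \<delta>2" for n :: nat and c d
  proof -
    have "(\<Sum>k<n. \<bar>f (d k) - g (d k) - (f (c k) - g (c k))\<bar>) \<le>
       (\<Sum>k<n. \<bar>f (d k) - f (c k)\<bar>) + (\<Sum>k<n. \<bar>g (d k) - g (c k)\<bar>)"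
      unfolding sum.distrib[symmetric] by (intro sum_mono) auto
    then show ?thesis using \<delta>1(2)[OF that(1)] \<delta>2(2)[OF that(1)] that(2) by linarith
  qed
  then show "\<exists>\<delta>>0. \<forall>(n::nat) c d. interval_family {..<n} a b c d \<longrightarrow> (\<Sum>k<n. d k - c k) < \<delta> \<longrightarrow>
     (\<Sum>k<n. \<bar>f (d k) - g (d k) - (f (c k) - g (c k))\<bar>) < \<epsilon>"
    using \<delta>1(1) \<delta>2(1) by (intro exI[of _ "min \<delta>1 \<delta>2"]) auto
qed

lemma lipschitz_imp_abs_continuous_on:
  assumes "B-lipschitz_on {a..b} f"
  shows "abs_continuous_on a b f"
proof (rule abs_continuous_onI)
  fix \<epsilon> :: real assume "\<epsilon> > 0"
  have B: "B \<ge> 0" using assms lipschitz_on_nonneg by blast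
  have "(\<Sum>k<n. \<bar>f (d k) - f (c k)\<bar>) < \<epsilon>"
    if I: "interval_family {..<n} a b c d" and l: "(\<Sum>k<n. d k - c k) < \<epsilon> / (B + 1)"
    for n :: nat and c d
  proof -
    have "(\<Sum>k<n. \<bar>f (d k) - f (c k)\<bar>) \<le> (\<Sum>k<n. B * (d k - c k))"
    proof (rule sum_mono)
      fix k assume "k \<in> {..<n}"
      then have "a \<le> c k" "c k \<le> d k" "d k \<le> b" using I by (auto simp: interval_family_def)
      then show "\<bar>f (d k) - f (c k)\<bar> \<le> B * (d k - c k)"
        using lipschitz_onD[OF assms, of "d k" "c k"] by (simp add: dist_real_def)
    qed
    also have "\<dots> = B * (\<Sum>k<n. d k - c k)" by (simp add: sum_distrib_left)
    also have "\<dots> \<le> B * (\<epsilon> / (B + 1))" using B l by (intro mult_left_mono) auto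
    also have "\<dots> < \<epsilon>" using B \<open>\<epsilon> > 0\<close> by (simp add: field_simps)
    finally show ?thesis .
  qed
  then show "\<exists>\<delta>>0. \<forall>(n::nat) c d. interval_family {..<n} a b c d \<longrightarrow> (\<Sum>k<n. d k - c k) < \<delta> \<longrightarrow>
     (\<Sum>k<n. \<bar>f (d k) - f (c k)\<bar>) < \<epsilon>"
    using B \<open>\<epsilon> > 0\<close> by (intro exI[of _ "\<epsilon> / (B + 1)"]) auto
qed

lemma abs_continuous_on_imp_continuous_on:
  assumes "abs_continuous_on a b f"
  shows "continuous_on {a..b} f"
  unfolding continuous_on_iff
proof (intro ballI allI impI)
  fix s \<epsilon> :: real assume s: "s \<in> {a..b}" and "\<epsilon> > 0"
  obtain \<delta> where \<delta>: "\<delta> > 0" "\<And>(I :: unit set) c d. interval_family I a b c d \<Longrightarrow>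
     (\<Sum>i\<in>I. d i - c i) < \<delta> \<Longrightarrow> (\<Sum>i\<in>I. \<bar>f (d i) - f (c i)\<bar>) < \<epsilon>"
    using abs_continuous_on_family[OF assms \<open>\<epsilon> > 0\<close>] by blast
  have *: "\<bar>f v - f u\<bar> < \<epsilon>" if "u \<in> {a..b}" "v \<in> {a..b}" "u \<le> v" "v - u < \<delta>" for u v
    using \<delta>(2)[of "{()}" "\<lambda>_. u" "\<lambda>_. v"] that by (auto simp: interval_family_def disjoint_family_on_def) 
  have "dist (f t) (f s) < \<epsilon>" if "t \<in> {a..b}" "dist t s < \<delta>" for t
    using *[of s t] *[of t s] that s by (auto simp: dist_real_def abs_if split: if_splits)
  then show "\<exists>\<delta>>0. \<forall>t\<in>{a..b}. dist t s < \<delta> \<longrightarrow> dist (f t) (f s) < \<epsilon>"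
    using \<delta>(1) by blast
qed

section \<open>Sums of increments and the positive variation\<close>

definition family_sums :: "(real \<Rightarrow> real) \<Rightarrow> real \<Rightarrow> real \<Rightarrow> real set" where
  "family_sums f a b = {\<Sum>k<n. f (d k) - f (c k) | (n::nat) c d. interval_family {..<n} a b c d}"

lemma family_sumsI:
  assumes "interval_family I a b c d"
  shows "(\<Sum>i\<in>I. f (d i) - f (c i)) \<in> family_sums f a b"
proof -
  obtain h where h: "bij_betw h {..<card I} I"
    using assms by (metis ex_bij_betw_nat_finite interval_family_def lessThan_atLeast0)
  have "(\<Sum>i\<in>I. f (d i) - f (c i)) = (\<Sum>k<card I. f ((d \<circ> h) k) - f ((c \<circ> h) k))"
    using sum.reindex_bij_betw[OF h, of "\<lambda>i. f (d i) - f (c i)"] by simp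
  then show ?thesis
    unfolding family_sums_def using interval_family_reindex[OF assms h] by blast
qed

lemma zero_in_family_sums: "0 \<in> family_sums f a b"
  using family_sumsI[of "{} :: nat set" a b id id f] by (simp add: interval_family_def disjoint_family_on_def) 

text \<open>Each interval is cut at \<open>s\<close> by truncating its ends with \<open>min\<close>
  and \<open>max\<close>. An interval lying on one side of \<open>s\<close> leaves a degenerate one
  on the other side, which contributes nothing.\<close>

lemma family_sums_split:
  assumes "w \<in> family_sums f a b" "a \<le> s" "s \<le> b"
  obtains u v where "u \<in> family_sums f a s" "v \<in> family_sums f s b" "w = u + v"
proof -
  obtain n :: nat and c d where w: "w = (\<Sum>k<n. f (d k) - f (c k))" "interval_family {..<n} a b c d"
    using assms(1) unfolding family_sums_def by blast
  have sub: "{min (c k) s<..<min (d k) s} \<subseteq> {c k<..<d k}" "{max (c k) s<..<max (d k) s} \<subseteq> {c k<..<d k}" for k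
    by auto
  have dis: "disjoint_family_on (\<lambda>k. {c k<..<d k}) {..<n}" and
    bd: "\<And>k. k < n \<Longrightarrow> a \<le> c k \<and> c k \<le> d k \<and> d k \<le> b"
    using w(2) unfolding interval_family_def by auto
  have 1: "interval_family {..<n} a s (\<lambda>k. min (c k) s) (\<lambda>k. min (d k) s)"
    unfolding interval_family_def using bd assms(2) disjoint_family_on_subfamily[OF dis sub(1)]
    by (auto simp: min_def dest: order_trans)
  have 2: "interval_family {..<n} s b (\<lambda>k. max (c k) s) (\<lambda>k. max (d k) s)"
    unfolding interval_family_def using bd assms(3) disjoint_family_on_subfamily[OF dis sub(2)]
    by (auto simp: max_def dest: order_trans)
  have "w = (\<Sum>k<n. f (min (d k) s) - f (min (c k) s)) + (\<Sum>k<n. f (max (d k) s) - f (max (c k) s))"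
    unfolding w(1) sum.distrib[symmetric] by (intro sum.cong) (auto simp: min_def max_def)
  then show ?thesis using that family_sumsI[OF 1] family_sumsI[OF 2] by blast
qed

text \<open>Intervals inside disjoint intervals stay disjoint, so the inner families form a single
  one, indexed by pairs. Since its total length has not grown, absolute continuity of
  \<open>f\<close> applies to families chosen separately inside each outer interval.\<close>

lemma family_sums_concat:
  fixes K :: "'i set"
  assumes K: "interval_family K a b c d"
    and w: "\<And>k. k \<in> K \<Longrightarrow> w k \<in> family_sums f (c k) (d k)"
  obtains J :: "('i \<times> nat) set" and c' d' where "interval_family J a b c' d'"
    "(\<Sum>j\<in>J. f (d' j) - f (c' j)) = (\<Sum>k\<in>K. w k)"
    "(\<Sum>j\<in>J. d' j - c' j) \<le> (\<Sum>k\<in>K. d k - c k)"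
proof -
  have "\<forall>k\<in>K. \<exists>(n::nat) p q. w k = (\<Sum>i<n. f (q i) - f (p i)) \<and> interval_family {..<n} (c k) (d k) p q"
    using w unfolding family_sums_def by blast
  then obtain n p q where npq: "\<And>k. k \<in> K \<Longrightarrow> w k = (\<Sum>i<(n k::nat). f (q k i) - f (p k i))"
    "\<And>k. k \<in> K \<Longrightarrow> interval_family {..<n k} (c k) (d k) (p k) (q k)"
    by metis
  let ?J = "SIGMA k:K. {..<n k}"
  have fK: "finite K" and Kb: "\<And>k. k \<in> K \<Longrightarrow> a \<le> c k \<and> c k \<le> d k \<and> d k \<le> b"
    and Kd: "disjoint_family_on (\<lambda>k. {c k<..<d k}) K"
    using K by (auto simp: interval_family_def)
  have pq: "c k \<le> p k i \<and> p k i \<le> q k i \<and> q k i \<le> d k" if "k \<in> K" "i < n k" for k i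
    using npq(2)[OF that(1)] that(2) by (auto simp: interval_family_def)
  have "interval_family ?J a b (\<lambda>(k,i). p k i) (\<lambda>(k,i). q k i)"
    unfolding interval_family_def
  proof (intro conjI ballI)
    show "finite ?J" using fK by auto
    show "disjoint_family_on (\<lambda>x. {case x of (k, i) \<Rightarrow> p k i<..<case x of (k, i) \<Rightarrow> q k i}) ?J"
      unfolding disjoint_family_on_def
    proof (intro ballI impI)
      fix x y assume xy: "x \<in> ?J" "y \<in> ?J" "x \<noteq> y"
      obtain k i where x: "x = (k, i)" "k \<in> K" "i < n k" using xy by auto
      obtain l j where y: "y = (l, j)" "l \<in> K" "j < n l" using xy by auto
      have sub: "{p k i<..<q k i} \<subseteq> {c k<..<d k}" "{p l j<..<q l j} \<subseteq> {c l<..<d l}"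
        using pq x y by fastforce+
      show "{case x of (k, i) \<Rightarrow> p k i<..<case x of (k, i) \<Rightarrow> q k i} \<inter>
            {case y of (k, i) \<Rightarrow> p k i<..<case y of (k, i) \<Rightarrow> q k i} = {}"
      proof (cases "k = l")
        case True
        then have "i \<noteq> j" using x y xy by auto
        then have "{p k i<..<q k i} \<inter> {p k j<..<q k j} = {}"
          using npq(2)[OF x(2)] x(3) y(3) True
          unfolding interval_family_def disjoint_family_on_def by blast
        then show ?thesis using x y True by simp
      next
        case False
        then have "{c k<..<d k} \<inter> {c l<..<d l} = {}"
          using Kd x y unfolding disjoint_family_on_def by blast
        then have "{p k i<..<q k i} \<inter> {p l j<..<q l j} = {}" using sub by blast
        then show ?thesis using x y by simp
      qed
    qed
  qed (use pq Kb in \<open>fastforce\<close>)+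
  moreover have "(\<Sum>x\<in>?J. f ((\<lambda>(k,i). q k i) x) - f ((\<lambda>(k,i). p k i) x)) = (\<Sum>k\<in>K. w k)"
  proof -
    have "(\<Sum>k\<in>K. w k) = (\<Sum>k\<in>K. \<Sum>i<n k. f (q k i) - f (p k i))"
      using npq(1) by simp
    also have "\<dots> = (\<Sum>x\<in>?J. f ((\<lambda>(k,i). q k i) x) - f ((\<lambda>(k,i). p k i) x))"
      using fK by (subst sum.Sigma) (auto simp: split_def)
    finally show ?thesis by simp
  qed
  moreover have "(\<Sum>x\<in>?J. (\<lambda>(k,i). q k i) x - (\<lambda>(k,i). p k i) x) \<le> (\<Sum>k\<in>K. d k - c k)"
  proof -
    have "(\<Sum>x\<in>?J. (\<lambda>(k,i). q k i) x - (\<lambda>(k,i). p k i) x) = (\<Sum>k\<in>K. \<Sum>i<n k. q k i - p k i)"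
      using fK by (subst sum.Sigma) (auto simp: split_def)
    also have "\<dots> \<le> (\<Sum>k\<in>K. d k - c k)"
      by (intro sum_mono interval_family_length_le npq(2)) (use Kb in auto)
    finally show ?thesis .
  qed
  ultimately show ?thesis by (rule that[of ?J "\<lambda>(k,i). p k i" "\<lambda>(k,i). q k i"])
qed

lemma family_sums_add:
  assumes "u \<in> family_sums f a s" "v \<in> family_sums f s b" "a \<le> s" "s \<le> b"
  shows "u + v \<in> family_sums f a b"
proof -
  have "interval_family {..<2::nat} a b (\<lambda>k. if k = 0 then a else s) (\<lambda>k. if k = 0 then s else b)"
    using assms(3,4) by (auto simp: interval_family_def disjoint_family_on_def)
  moreover have "(if k = 0 then u else v) \<in> family_sums f (if k = 0 then a else s) (if k = 0 then s else b)"
    for k :: nat using assms(1,2) by simp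
  ultimately obtain J :: "(nat \<times> nat) set" and c d where "interval_family J a b c d"
    "(\<Sum>j\<in>J. f (d j) - f (c j)) = (\<Sum>k<2::nat. if k = 0 then u else v)"
    by (rule family_sums_concat)
  then show ?thesis using family_sumsI[of J a b c d f] by (simp add: numeral_2_eq_2)
qed

text \<open>The increments are signed, but a family may leave out intervals on which
  \<open>f\<close> decreases; the supremum is therefore the positive variation, and subtracting
  \<open>f\<close> from it leaves a non-decreasing function.\<close>

definition pos_variation :: "(real \<Rightarrow> real) \<Rightarrow> real \<Rightarrow> real \<Rightarrow> real" where
  "pos_variation f a t = Sup (family_sums f a t)"

text \<open>On an interval shorter than the \<delta> that absolute continuity provides for the
  tolerance 1, every sum is at most 1. Finitely many steps of length \<delta>/2 reach
  \<open>t\<close>, each raising the bound by one.\<close>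

lemma bdd_above_family_sums:
  assumes f: "abs_continuous_on a b f" and "t \<in> {a..b}"
  shows "bdd_above (family_sums f a t)"
proof -
  obtain \<delta> where \<delta>: "\<delta> > 0" "\<And>(I :: nat set) c d. interval_family I a b c d \<Longrightarrow>
     (\<Sum>i\<in>I. d i - c i) < \<delta> \<Longrightarrow> (\<Sum>i\<in>I. \<bar>f (d i) - f (c i)\<bar>) < 1"
    using abs_continuous_on_family[OF f zero_less_one] by blast
  have short: "w \<le> 1" if "w \<in> family_sums f s t" "a \<le> s" "s \<le> t" "t \<le> b" "t - s < \<delta>" for w s t
  proof -
    obtain n :: nat and c d where w: "w = (\<Sum>k<n. f (d k) - f (c k))" and I: "interval_family {..<n} s t c d"
      using \<open>w \<in> _\<close> unfolding family_sums_def by blast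
    have "interval_family {..<n} a b c d"
      using interval_family_widen[OF I] that by simp
    moreover have "(\<Sum>k<n. d k - c k) < \<delta>"
      using interval_family_length_le[OF I] that by linarith
    ultimately have "(\<Sum>k<n. \<bar>f (d k) - f (c k)\<bar>) < 1" using \<delta>(2) by blast
    moreover have "w \<le> (\<Sum>k<n. \<bar>f (d k) - f (c k)\<bar>)"
      unfolding w by (intro sum_mono) auto
    ultimately show ?thesis by linarith
  qed
  have "\<forall>t\<in>{a..b}. t \<le> a + real n * (\<delta> / 2) \<longrightarrow> (\<forall>w\<in>family_sums f a t. w \<le> real n + 1)" for n
  proof (induction n)
    case 0
    then show ?case using short[of _ a] \<delta>(1) by fastforce
  next
    case (Suc n)
    show ?case
    proof (intro ballI impI)
      fix t w assume t: "t \<in> {a..b}" "t \<le> a + real (Suc n) * (\<delta> / 2)" "w \<in> family_sums f a t"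
      define s where "s = max a (t - \<delta> / 2)"
      have s: "a \<le> s" "s \<le> t" "t - s < \<delta>" "s \<le> a + real n * (\<delta> / 2)"
        using t \<delta>(1) by (auto simp: s_def algebra_simps add_divide_distrib)
      obtain u v where uv: "u \<in> family_sums f a s" "v \<in> family_sums f s t" "w = u + v"
        using family_sums_split[OF t(3) s(1,2)] by blast
      have "v \<le> 1" using short[OF uv(2)] s t by auto
      moreover have "u \<le> real n + 1" using Suc uv(1) s t by auto
      ultimately show "w \<le> real (Suc n) + 1" using uv(3) by simp
    qed
  qed
  moreover obtain n :: nat where "t \<le> a + real n * (\<delta> / 2)"
  proof -
    obtain n :: nat where "(t - a) / (\<delta> / 2) \<le> real n" using real_arch_simple by blast
    then show ?thesis using \<delta>(1) that[of n] by (simp add: field_simps)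
  qed
  ultimately show ?thesis using assms(2) unfolding bdd_above_def by blast
qed

lemma pos_variation_ge_add:
  assumes f: "abs_continuous_on a b f" and "a \<le> s" "s \<le> t" "t \<le> b" "w \<in> family_sums f s t"
  shows "pos_variation f a s + w \<le> pos_variation f a t"
proof -
  have "pos_variation f a s \<le> pos_variation f a t - w"
    unfolding pos_variation_def
  proof (rule cSup_least)
    show "family_sums f a s \<noteq> {}" using zero_in_family_sums by blast
    fix u assume "u \<in> family_sums f a s"
    then have "u + w \<in> family_sums f a t" using family_sums_add assms by blast
    then show "u \<le> Sup (family_sums f a t) - w"
      using cSup_upper[OF _ bdd_above_family_sums[OF f]] assms by fastforce
  qed
  then show ?thesis by simp
qed

lemma pos_variation_mono:
  assumes "abs_continuous_on a b f" "a \<le> s" "s \<le> t" "t \<le> b"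
  shows "pos_variation f a s \<le> pos_variation f a t"
  using pos_variation_ge_add[OF assms zero_in_family_sums] by simp

lemma pos_variation_ge_increment:
  assumes "abs_continuous_on a b f" "a \<le> s" "s \<le> t" "t \<le> b"
  shows "pos_variation f a s + (f t - f s) \<le> pos_variation f a t"
proof (rule pos_variation_ge_add[OF assms])
  show "f t - f s \<in> family_sums f s t"
    using family_sumsI[of "{()}" s t "\<lambda>_. s" "\<lambda>_. t" f] assms
    by (simp add: interval_family_def disjoint_family_on_def)
qed

text \<open>A nearly optimal family on \<open>{a..t}\<close> is cut at \<open>s\<close>. The part
  before \<open>s\<close> cannot exceed the variation up to \<open>s\<close>, so the part after
  \<open>s\<close> nearly attains the increment.\<close>

lemma pos_variation_increment_approx:
  assumes f: "abs_continuous_on a b f" and "a \<le> s" "s \<le> t" "t \<le> b" "\<eta> > 0"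
  shows "\<exists>w\<in>family_sums f s t. pos_variation f a t - pos_variation f a s - \<eta> < w"
proof -
  have "pos_variation f a t - \<eta> < Sup (family_sums f a t)"
    using \<open>\<eta> > 0\<close> by (simp add: pos_variation_def)
  then obtain w where w: "w \<in> family_sums f a t" "pos_variation f a t - \<eta> < w"
    using less_cSup_iff[of "family_sums f a t"] zero_in_family_sums bdd_above_family_sums[OF f, of t] assms
    by (metis atLeastAtMost_iff empty_iff order_trans)
  obtain u v where uv: "u \<in> family_sums f a s" "v \<in> family_sums f s t" "w = u + v"
    using family_sums_split[OF w(1)] assms by blast
  have "u \<le> pos_variation f a s"
    unfolding pos_variation_def using cSup_upper[OF uv(1) bdd_above_family_sums[OF f]] assms by simp
  then show ?thesis using uv w by (intro bexI[of _ v]) auto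
qed

lemma abs_continuous_on_pos_variation:
  assumes f: "abs_continuous_on a b f"
  shows "abs_continuous_on a b (pos_variation f a)"
proof (rule abs_continuous_onI)
  fix \<epsilon> :: real assume "\<epsilon> > 0"
  then have "\<epsilon> / 2 > 0" by simp
  obtain \<delta> where \<delta>: "\<delta> > 0" "\<And>(I :: (nat \<times> nat) set) c d. interval_family I a b c d \<Longrightarrow>
     (\<Sum>i\<in>I. d i - c i) < \<delta> \<Longrightarrow> (\<Sum>i\<in>I. \<bar>f (d i) - f (c i)\<bar>) < \<epsilon> / 2"
    using abs_continuous_on_family[OF f \<open>\<epsilon> / 2 > 0\<close>] by blast
  let ?P = "pos_variation f a"
  have "(\<Sum>k<n. \<bar>?P (d k) - ?P (c k)\<bar>) < \<epsilon>"
    if I: "interval_family {..<n} a b c d" and l: "(\<Sum>k<n. d k - c k) < \<delta>" for n :: nat and c d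
  proof -
    have Ib: "a \<le> c k \<and> c k \<le> d k \<and> d k \<le> b" if "k < n" for k
      using I that by (auto simp: interval_family_def)
    \<comment> \<open>Each of the \<open>n\<close> increments is approximated up to \<eta>, so the
      errors add up to at most \<epsilon>/2; \<open>n + 1\<close> keeps the quotient meaningful for
      the empty family.\<close>
    define \<eta> where "\<eta> = \<epsilon> / (2 * (real n + 1))"
    have \<eta>: "\<eta> > 0" using \<open>\<epsilon> > 0\<close> by (simp add: \<eta>_def)
    have "\<exists>w. k < n \<longrightarrow> w \<in> family_sums f (c k) (d k) \<and> ?P (d k) - ?P (c k) - \<eta> < w" for k
      using pos_variation_increment_approx[OF f _ _ _ \<eta>, of "c k" "d k"] Ib by blast
    then obtain w where w: "\<And>k. k < n \<Longrightarrow> w k \<in> family_sums f (c k) (d k)"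
      "\<And>k. k < n \<Longrightarrow> ?P (d k) - ?P (c k) - \<eta> < w k" by metis
    obtain J :: "(nat \<times> nat) set" and c' d' where J: "interval_family J a b c' d'"
      "(\<Sum>j\<in>J. f (d' j) - f (c' j)) = (\<Sum>k<n. w k)"
      "(\<Sum>j\<in>J. d' j - c' j) \<le> (\<Sum>k<n. d k - c k)"
      using family_sums_concat[OF I, of w f] w(1) by auto
    have "(\<Sum>k<n. \<bar>?P (d k) - ?P (c k)\<bar>) \<le> (\<Sum>k<n. w k + \<eta>)"
    proof (rule sum_mono)
      fix k assume "k \<in> {..<n}"
      then show "\<bar>?P (d k) - ?P (c k)\<bar> \<le> w k + \<eta>"
        using w(2)[of k] pos_variation_mono[OF f, of "c k" "d k"] Ib[of k] by simp
    qed
    also have "\<dots> = (\<Sum>j\<in>J. f (d' j) - f (c' j)) + real n * \<eta>"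
      by (simp add: sum.distrib J(2))
    also have "\<dots> \<le> (\<Sum>j\<in>J. \<bar>f (d' j) - f (c' j)\<bar>) + real n * \<eta>"
      by (intro add_mono sum_mono) auto
    also have "\<dots> < \<epsilon> / 2 + real n * \<eta>"
      using \<delta>(2)[OF J(1)] J(3) l by simp
    also have "\<dots> \<le> \<epsilon>"
      using \<open>\<epsilon> > 0\<close> by (simp add: \<eta>_def field_simps)
    finally show ?thesis .
  qed
  then show "\<exists>\<delta>>0. \<forall>(n::nat) c d. interval_family {..<n} a b c d \<longrightarrow> (\<Sum>k<n. d k - c k) < \<delta> \<longrightarrow>
     (\<Sum>k<n. \<bar>?P (d k) - ?P (c k)\<bar>) < \<epsilon>"
    using \<delta>(1) by blast
qed

section \<open>Densities of absolutely continuous non-decreasing functions\<close>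

lemma mono_abs_continuous_density:
  fixes F :: "real \<Rightarrow> real"
  assumes F: "abs_continuous_on a b F" and mono: "\<And>s t. a \<le> s \<Longrightarrow> s \<le> t \<Longrightarrow> t \<le> b \<Longrightarrow> F s \<le> F t"
    and "a \<le> b"
  obtains u where "integrable lborel u" "\<And>t. t \<in> {a..b} \<Longrightarrow> F t = F a + (LINT s:{a..t}|lborel. u s)"
proof -
  \<comment> \<open>Constant continuation beyond \<open>a\<close> and \<open>b\<close> makes
    \<open>F\<close> non-decreasing and continuous on the whole line. Its Lebesgue-Stieltjes measure
    gives no mass to the complement of \<open>{a..b}\<close>, and the density sought is the
    Radon-Nikodym derivative of that measure.\<close>
  define H where "H t = F (max a (min b t))" for t
  have cl: "max a (min b t) \<in> {a..b}" for t using \<open>a \<le> b\<close> by auto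
  have H_eq: "H t = F t" if "t \<in> {a..b}" for t
    using that by (auto simp: H_def)
  have H_mono: "H s \<le> H t" if "s \<le> t" for s t
    unfolding H_def using that \<open>a \<le> b\<close> by (intro mono) auto
  have H_cont: "continuous_on UNIV H"
    unfolding H_def
    by (rule continuous_on_compose2[OF abs_continuous_on_imp_continuous_on[OF F]])
       (use cl in \<open>auto intro!: continuous_intros\<close>)
  define \<mu> where "\<mu> = interval_measure H"
  have sets_\<mu> [measurable_cong, simp]: "sets \<mu> = sets borel" by (simp add: \<mu>_def)
  have \<mu>_Icc: "emeasure \<mu> {s..t} = ennreal (H t - H s)" if "s \<le> t" for s t
    unfolding \<mu>_def using emeasure_interval_measure_Icc[OF that H_mono H_cont] by simp
  have \<mu>_out: "emeasure \<mu> (- {a..b}) = 0"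
  proof -
    have "H (a - real n) = H a" "H (b + real n) = H b" for n
      using \<open>a \<le> b\<close> by (simp_all add: H_def min_def max_def)
    then have "{a - real n..a} \<in> null_sets \<mu>" "{b..b + real n} \<in> null_sets \<mu>" for n
      by (auto simp: null_sets_def \<mu>_Icc)
    then have "(\<Union>n. {a - real n..a}) \<union> (\<Union>n. {b..b + real n}) \<in> null_sets \<mu>"
      by (intro null_sets.Un null_sets_UN) auto
    moreover have "- {a..b} \<subseteq> (\<Union>n. {a - real n..a}) \<union> (\<Union>n. {b..b + real n})"
    proof
      fix t assume t: "t \<in> - {a..b}"
      obtain n :: nat where "\<bar>t - a\<bar> + \<bar>t - b\<bar> \<le> real n" using real_arch_simple by blast
      then show "t \<in> (\<Union>n. {a - real n..a}) \<union> (\<Union>n. {b..b + real n})"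
        using t by (cases "t < a") (auto intro!: exI[of _ n])
    qed
    ultimately have "- {a..b} \<in> null_sets \<mu>"
      using null_sets_subset[of _ \<mu> "- {a..b}"] by simp
    then show ?thesis by (rule null_setsD1)
  qed
  have ac: "absolutely_continuous lborel \<mu>"
    unfolding absolutely_continuous_def
  proof
    fix A :: "real set" assume A: "A \<in> null_sets lborel"
    then have A_borel: "A \<in> sets borel" by auto
    \<comment> \<open>A Lebesgue null set is covered by countably many non-overlapping closed
      intervals of total length below \<delta>, and absolute continuity of \<open>F\<close> bounds
      the \<open>\<mu>\<close>-mass of any finitely many of them.\<close>
    have "emeasure \<mu> (A \<inter> {a..b}) \<le> ennreal \<epsilon>" if "\<epsilon> > 0" for \<epsilon>
    proof -
      obtain \<delta> where \<delta>: "\<delta> > 0" "\<And>(I :: real set set) c d. interval_family I a b c d \<Longrightarrow>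
         (\<Sum>i\<in>I. d i - c i) < \<delta> \<Longrightarrow> (\<Sum>i\<in>I. \<bar>F (d i) - F (c i)\<bar>) < \<epsilon>"
        using abs_continuous_on_family[OF F \<open>\<epsilon> > 0\<close>] by blast
      have Anull: "A \<inter> {a..b} \<in> null_sets lebesgue"
        using A null_sets_completionI[of "A \<inter> {a..b}" lborel] by (simp add: null_set_Int2)
      then have A0: "A \<inter> {a..b} \<in> lmeasurable" "measure lebesgue (A \<inter> {a..b}) = 0"
        by (auto simp: fmeasurable_def measure_eq_0_null_sets)
      have Asub: "A \<inter> {a..b} \<subseteq> cbox a b" and \<delta>2: "\<delta> / 2 > 0" using \<delta>(1) by auto
      obtain \<D> where \<D>: "countable \<D>"
        "\<And>K. K \<in> \<D> \<Longrightarrow> K \<subseteq> cbox a b \<and> K \<noteq> {} \<and> (\<exists>c d. K = cbox c d)"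
        "pairwise (\<lambda>A B. interior A \<inter> interior B = {}) \<D>"
        "A \<inter> {a..b} \<subseteq> \<Union>\<D>" "\<Union>\<D> \<in> lmeasurable"
        "measure lebesgue (\<Union>\<D>) \<le> measure lebesgue (A \<inter> {a..b}) + \<delta> / 2"
        by (rule measurable_outer_intervals_bounded[OF A0(1) Asub \<delta>2]) (rule that; (assumption | blast))
      have "\<exists>c d. a \<le> c \<and> c \<le> d \<and> d \<le> b \<and> K = {c..d}" if "K \<in> \<D>" for K
        using \<D>(2)[OF that] by auto
      then obtain c d where cd: "\<And>K. K \<in> \<D> \<Longrightarrow> a \<le> c K \<and> c K \<le> d K \<and> d K \<le> b \<and> K = {c K..d K}"
        by metis
      have fin: "emeasure \<mu> (\<Union>\<E>) \<le> ennreal \<epsilon>" if \<E>: "finite \<E>" "\<E> \<subseteq> \<D>" for \<E>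
      proof -
        have fam: "interval_family \<E> a b c d"
          unfolding interval_family_def
        proof (intro conjI ballI)
          show "disjoint_family_on (\<lambda>K. {c K<..<d K}) \<E>"
            unfolding disjoint_family_on_def
          proof (intro ballI impI)
            fix K L assume KL: "K \<in> \<E>" "L \<in> \<E>" "K \<noteq> L"
            then have "interior K \<inter> interior L = {}"
              using \<D>(3) \<E>(2) by (auto simp: pairwise_def)
            moreover have "K = {c K..d K}" "L = {c L..d L}" using cd KL \<E>(2) by blast+
            then have "interior K = {c K<..<d K}" "interior L = {c L<..<d L}"
              by (metis interior_atLeastAtMost_real)+
            ultimately show "{c K<..<d K} \<inter> {c L<..<d L} = {}" by simp
          qed
        qed (use \<E> cd in auto)
        have "(\<Sum>K\<in>\<E>. d K - c K) = measure lebesgue (\<Union>K\<in>\<E>. {c K<..<d K})"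
        proof -
          have "(\<Sum>K\<in>\<E>. d K - c K) = (\<Sum>K\<in>\<E>. measure lebesgue {c K<..<d K})"
            using cd \<E>(2) by (intro sum.cong) auto
          also have "\<dots> = measure lebesgue (\<Union>K\<in>\<E>. {c K<..<d K})"
            using fam by (intro measure_finite_Union [symmetric]) (auto simp: interval_family_def)
          finally show ?thesis .
        qed
        also have "\<dots> \<le> measure lebesgue (\<Union>\<D>)"
        proof (rule measure_mono_fmeasurable[OF _ _ \<D>(5)])
          show "(\<Union>K\<in>\<E>. {c K<..<d K}) \<subseteq> \<Union>\<D>"
          proof
            fix t assume "t \<in> (\<Union>K\<in>\<E>. {c K<..<d K})"
            then obtain K where K: "K \<in> \<E>" "t \<in> {c K<..<d K}" by blast
            then have "t \<in> {c K..d K}" by auto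
            then have "t \<in> K" using cd[of K] K \<E>(2) by blast
            then show "t \<in> \<Union>\<D>" using K \<E>(2) by blast
          qed
        qed (use \<E> in \<open>auto intro!: sets.finite_UN\<close>)
        also have "\<dots> < \<delta>" using \<D>(6) A0(2) \<delta>(1) by linarith
        finally have less: "(\<Sum>K\<in>\<E>. \<bar>F (d K) - F (c K)\<bar>) < \<epsilon>" using \<delta>(2)[OF fam] by blast
        have "emeasure \<mu> (\<Union>\<E>) \<le> (\<Sum>K\<in>\<E>. emeasure \<mu> K)"
        proof -
          have "K \<in> sets borel" if "K \<in> \<E>" for K
            using cd[of K] \<E>(2) that by (metis atLeastAtMost_borel subsetD)
          then show ?thesis
            using emeasure_subadditive_finite[of \<E> "\<lambda>K. K" \<mu>] \<E>(1) by auto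
        qed
        also have "\<dots> = (\<Sum>K\<in>\<E>. ennreal (\<bar>F (d K) - F (c K)\<bar>))"
        proof (rule sum.cong)
          fix K assume "K \<in> \<E>"
          then have K: "a \<le> c K" "c K \<le> d K" "d K \<le> b" "K = {c K..d K}" using cd \<E>(2) by blast+
          have "emeasure \<mu> K = ennreal (H (d K) - H (c K))"
            using \<mu>_Icc[OF K(2)] K(4) by simp
          then show "emeasure \<mu> K = ennreal (\<bar>F (d K) - F (c K)\<bar>)"
            using K H_eq mono[OF K(1,2,3)] by simp
        qed simp
        also have "\<dots> \<le> ennreal \<epsilon>"
          using less by (simp add: ennreal_leI)
        finally show ?thesis .
      qed
      show ?thesis
      proof (cases "\<D> = {}")
        case True
        then show ?thesis using \<D>(4) by simp
      next
        case False
        \<comment> \<open>Absolute continuity speaks of finite families only, so the countable cover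
          is exhausted by finite stages and the bound passes to the supremum.\<close>
        define \<E> where "\<E> n = from_nat_into \<D> ` {..<n}" for n :: nat
        have \<E>: "finite (\<E> n)" "\<E> n \<subseteq> \<D>" for n
          using from_nat_into[OF False] by (auto simp: \<E>_def)
        have un: "(\<Union>n. \<Union>(\<E> n)) = \<Union>\<D>"
        proof -
          have "(\<Union>n. \<E> n) = from_nat_into \<D> ` (\<Union>n::nat. {..<n})"
            unfolding \<E>_def by blast
          moreover have "(\<Union>n::nat. {..<n}) = UNIV" by auto
          ultimately have "(\<Union>n. \<E> n) = \<D>"
            using range_from_nat_into[OF False \<D>(1)] by simp
          then show ?thesis by blast
        qed
        have meas: "\<Union>(\<E> n) \<in> sets \<mu>" for n
        proof -
          have "K \<in> sets borel" if "K \<in> \<E> n" for K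
            using cd[of K] \<E>(2)[of n] that by (metis atLeastAtMost_borel subsetD)
          then show ?thesis using \<E>(1) by (auto intro: sets.finite_Union)
        qed
        have "emeasure \<mu> (A \<inter> {a..b}) \<le> emeasure \<mu> (\<Union>\<D>)"
        proof (rule emeasure_mono[OF \<D>(4)])
          show "\<Union>\<D> \<in> sets \<mu>" unfolding un[symmetric] using meas by blast
        qed
        also have "\<dots> = (SUP n. emeasure \<mu> (\<Union>(\<E> n)))"
          unfolding un[symmetric]
        proof (rule SUP_emeasure_incseq[symmetric])
          show "range (\<lambda>n. \<Union>(\<E> n)) \<subseteq> sets \<mu>" using meas by blast
          show "incseq (\<lambda>n. \<Union>(\<E> n))"
            unfolding incseq_def \<E>_def by (intro allI impI Union_mono image_mono) auto
        qed
        also have "\<dots> \<le> ennreal \<epsilon>" by (intro SUP_least fin \<E>)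
        finally show ?thesis .
      qed
    qed
    then have 1: "emeasure \<mu> (A \<inter> {a..b}) = 0"
      using ennreal_le_epsilon[of 0 "emeasure \<mu> (A \<inter> {a..b})"] by simp
    have "emeasure \<mu> A \<le> emeasure \<mu> (A \<inter> {a..b}) + emeasure \<mu> (- {a..b})"
    proof -
      have "emeasure \<mu> A \<le> emeasure \<mu> ((A \<inter> {a..b}) \<union> - {a..b})"
        using A_borel by (intro emeasure_mono) auto
      also have "\<dots> \<le> emeasure \<mu> (A \<inter> {a..b}) + emeasure \<mu> (- {a..b})"
        using A_borel by (intro emeasure_subadditive) auto
      finally show ?thesis .
    qed
    then show "A \<in> null_sets \<mu>" using 1 \<mu>_out A_borel by (auto simp: null_sets_def)
  qed
  obtain h where h [measurable]: "h \<in> borel_measurable lborel" and dens: "density lborel h = \<mu>"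
    using sigma_finite_measure.Radon_Nikodym[OF sigma_finite_lborel ac] by auto
  have nn: "(\<integral>\<^sup>+s\<in>{a..t}. h s \<partial>lborel) = ennreal (F t - F a)" if "t \<in> {a..b}" for t
  proof -
    have "(\<integral>\<^sup>+s\<in>{a..t}. h s \<partial>lborel) = emeasure \<mu> {a..t}"
      unfolding dens[symmetric] by (simp add: emeasure_density)
    then show ?thesis using \<mu>_Icc[of a t] that H_eq \<open>a \<le> b\<close> by simp
  qed
  \<comment> \<open>The Radon-Nikodym density has extended values. Its integral over
    \<open>{a..b}\<close> is the finite number \<open>F b - F a\<close>, so making it real there
    changes it at most on a null set.\<close>
  define u where "u s = indicator {a..b} s * enn2real (h s)" for s
  have [measurable]: "u \<in> borel_measurable lborel" unfolding u_def by simp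
  have hfin: "AE s in lborel. h s * indicator {a..b} s \<noteq> \<infinity>"
    using nn[of b] \<open>a \<le> b\<close> by (intro nn_integral_PInf_AE) auto
  have ae: "AE s in lborel. ennreal (indicator {a..t} s * u s) = h s * indicator {a..t} s" if "t \<in> {a..b}" for t
    using hfin by eventually_elim (use that in \<open>auto simp: u_def indicator_def less_top\<close>)
  have hb: "has_bochner_integral lborel (\<lambda>s. indicator {a..t} s * u s) (F t - F a)" if "t \<in> {a..b}" for t
  proof (rule has_bochner_integral_nn_integral)
    show "(\<integral>\<^sup>+s. ennreal (indicator {a..t} s * u s) \<partial>lborel) = ennreal (F t - F a)"
      using nn[OF that] nn_integral_cong_AE[OF ae[OF that]] by simp
    show "0 \<le> F t - F a" using mono[of a t] that by simp
  qed (auto simp: u_def)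
  show ?thesis
  proof
    have "(\<lambda>s. indicator {a..b} s * u s) = u" by (auto simp: u_def indicator_def)
    then show "integrable lborel u"
      using hb[of b] \<open>a \<le> b\<close> by (auto simp: has_bochner_integral_iff)
    show "F t = F a + (LINT s:{a..t}|lborel. u s)" if "t \<in> {a..b}" for t
      using hb[OF that] by (simp add: has_bochner_integral_iff set_lebesgue_integral_def)
  qed
qed

section \<open>Lebesgue differentiation and the fundamental theorem of calculus\<close>

lemma AE_indefinite_integral_right_derivative:
  fixes u :: "real \<Rightarrow> real"
  assumes "\<And>a b. u integrable_on {a..b}"
  shows "AE t in lebesgue. \<forall>e>0. \<exists>d>0. \<forall>h. 0 < h \<and> h < d \<longrightarrow> \<bar>integral {t..t + h} u / h - u t\<bar> < e"
proof -
  have "\<And>a b. u integrable_on cbox a b" using assms by simp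
  then obtain N where N: "negligible N" "\<And>t e. \<lbrakk>t \<notin> N; 0 < e\<rbrakk> \<Longrightarrow> \<exists>d>0. \<forall>h. 0 < h \<and> h < d \<longrightarrow>
      norm (integral (cbox t (t + h *\<^sub>R One)) u /\<^sub>R h ^ DIM(real) - u t) < e"
    using integrable_ccontinuous_explicit[of u] by blast
  have "AE t in lebesgue. t \<notin> N" using N(1) by (simp add: AE_not_in negligible_iff_null_sets)
  then show ?thesis
  proof eventually_elim
    case (elim t)
    show ?case using N(2)[OF elim] by (simp add: divide_inverse mult.commute)
  qed
qed

text \<open>Reflection is differentiable and so carries null sets to null sets; this turns
  statements about right difference quotients into statements about left ones.\<close>

lemma AE_lebesgue_uminus:
  assumes "AE t in lebesgue. P (t::real)"
  shows "AE t in lebesgue. P (- t)"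
proof -
  obtain N where N: "N \<in> null_sets lebesgue" "{t. \<not> P t} \<subseteq> N"
    using assms by (auto simp: eventually_ae_filter)
  have "negligible (uminus ` N)"
    using N(1) by (intro negligible_differentiable_image_negligible)
      (auto simp: negligible_iff_null_sets intro!: derivative_intros)
  then have "AE t in lebesgue. t \<notin> uminus ` N" by (simp add: AE_not_in negligible_iff_null_sets)
  then show ?thesis
  proof eventually_elim
    case (elim t)
    then have "- t \<notin> N" by (metis image_eqI minus_minus)
    then show ?case using N(2) by auto
  qed
qed

lemma AE_indefinite_integral_derivative:
  fixes u f :: "real \<Rightarrow> real"
  assumes u: "\<And>a b. u integrable_on {a..b}"
    and f: "\<And>t. t \<in> {a..b} \<Longrightarrow> f t = c + integral {a..t} u"
  shows "AE t in lebesgue_on {a..b}. (f has_real_derivative u t) (at t)"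
proof -
  have u': "(\<lambda>t. u (- t)) integrable_on {a..b}" for a b
    using u[of "- b" "- a"] Henstock_Kurzweil_Integration.integrable_reflect_real[where f=u and a="- b" and b="- a"] by simp
  have "AE t in lebesgue. \<forall>e>0. \<exists>d>0. \<forall>h. 0 < h \<and> h < d \<longrightarrow>
          \<bar>integral {- t..- t + h} (\<lambda>t. u (- t)) / h - u t\<bar> < e"
    using AE_lebesgue_uminus[OF AE_indefinite_integral_right_derivative[OF u']] by simp
  moreover have "integral {- t..- t + h} (\<lambda>t. u (- t)) = integral {t - h..t} u" for t h
    using Henstock_Kurzweil_Integration.integral_reflect_real[where a="t - h" and b=t and f=u] by simp
  ultimately have left: "AE t in lebesgue. \<forall>e>0. \<exists>d>0. \<forall>h. 0 < h \<and> h < d \<longrightarrow>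
          \<bar>integral {t - h..t} u / h - u t\<bar> < e" by simp
  \<comment> \<open>The derivative is two-sided, whereas the integral formula for \<open>f\<close>
    holds on \<open>{a..b}\<close> only; at interior points both neighbours are covered.\<close>
  have neq: "AE t in lebesgue. t \<noteq> a \<and> t \<noteq> b"
    using AE_not_in[of "{a, b}" lebesgue] by (simp add: negligible_iff_null_sets[symmetric])
  have "AE t in lebesgue. t \<in> {a..b} \<longrightarrow> (f has_real_derivative u t) (at t)"
    using AE_indefinite_integral_right_derivative[OF u] left neq
  proof eventually_elim
    case (elim t)
    show ?case
    proof
      assume "t \<in> {a..b}"
      then have t: "a < t" "t < b" using elim(3) by auto
      have "(\<lambda>h. (f (t + h) - f t) / h) \<midarrow>0\<rightarrow> u t"
        unfolding LIM_eq
      proof (intro allI impI)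
        fix e :: real assume "e > 0"
        obtain d1 where d1: "d1 > 0" "\<And>h. 0 < h \<Longrightarrow> h < d1 \<Longrightarrow> \<bar>integral {t..t + h} u / h - u t\<bar> < e"
          using elim(1)[THEN spec, THEN mp, OF \<open>e > 0\<close>] by blast
        obtain d2 where d2: "d2 > 0" "\<And>h. 0 < h \<Longrightarrow> h < d2 \<Longrightarrow> \<bar>integral {t - h..t} u / h - u t\<bar> < e"
          using elim(2)[THEN spec, THEN mp, OF \<open>e > 0\<close>] by blast
        define d where "d = min (min d1 d2) (min (t - a) (b - t))"
        have "norm ((f (t + h) - f t) / h - u t) < e" if h: "h \<noteq> 0" "\<bar>h\<bar> < d" for h
        proof (cases "h > 0")
          case True
          have "integral {a..t} u + integral {t..t + h} u = integral {a..t + h} u"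
            using t True by (intro Henstock_Kurzweil_Integration.integral_combine u) auto
          then have "f (t + h) - f t = integral {t..t + h} u"
            using f[of t] f[of "t + h"] h t True by (simp add: d_def)
          then show ?thesis using d1(2)[of h] h True by (simp add: d_def)
        next
          case False
          have "integral {a..t + h} u + integral {t + h..t} u = integral {a..t} u"
            using t False h by (intro Henstock_Kurzweil_Integration.integral_combine u) (auto simp: d_def)
          then have "f (t + h) - f t = - integral {t - (- h)..t} u"
            using f[of t] f[of "t + h"] h t False by (simp add: d_def)
          then show ?thesis using d2(2)[of "- h"] h False by (simp add: d_def)
        qed
        moreover have "d > 0" using d1(1) d2(1) t by (simp add: d_def)
        ultimately show "\<exists>s>0. \<forall>h. h \<noteq> 0 \<and> norm (h - 0) < s \<longrightarrow> norm ((f (t + h) - f t) / h - u t) < e"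
          by (intro exI[of _ d]) simp
      qed
      then show "(f has_real_derivative u t) (at t)" by (simp add: DERIV_def)
    qed
  qed
  then show ?thesis by (simp add: AE_restrict_space_iff)
qed

lemma AE_integral_has_derivative:
  fixes u :: "real \<Rightarrow> real"
  assumes u: "u integrable_on {a..b}"
  shows "AE t in lebesgue_on {a..b}. ((\<lambda>t. integral {a..t} u) has_real_derivative u t) (at t)"
proof -
  \<comment> \<open>Cut off outside \<open>{a..b}\<close>, the integrand is integrable on every
    interval, and the indefinite integral is unchanged on the open interval.\<close>
  define w where "w t = (if t \<in> {a..b} then u t else 0)" for t
  have "w integrable_on UNIV"
    unfolding w_def using u integrable_restrict_UNIV by blast
  then have int: "w integrable_on {s..t}" for s t
    using integrable_on_subinterval[of w UNIV s t] by simp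
  have w: "AE t in lebesgue_on {a..b}. ((\<lambda>t. integral {a..t} w) has_real_derivative w t) (at t)"
    using AE_indefinite_integral_derivative[of w a b "\<lambda>t. integral {a..t} w" 0] int by simp
  have "AE t in lebesgue. t \<noteq> a \<and> t \<noteq> b"
    using AE_not_in[of "{a, b}" lebesgue] by (simp add: negligible_iff_null_sets[symmetric])
  then have neq: "AE t in lebesgue_on {a..b}. t \<in> {a..b} \<and> t \<noteq> a \<and> t \<noteq> b"
    by (auto simp: AE_restrict_space_iff elim: eventually_mono)
  show ?thesis
    using w neq
  proof eventually_elim
    case (elim t)
    have "((\<lambda>t. integral {a..t} u) has_real_derivative w t) (at t)"
    proof (rule has_field_derivative_transform_within_open[OF elim(1), of "{a<..<b}"])
      fix s assume "s \<in> {a<..<b}"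
      then show "integral {a..s} w = integral {a..s} u"
        by (intro integral_cong) (auto simp: w_def)
    qed (use elim(2) in auto)
    then show ?case using elim(2) by (simp add: w_def)
  qed
qed

text \<open>Jordan decomposition: \<open>f\<close> is the difference of
  \<open>pos_variation f a\<close> and \<open>pos_variation f a - f\<close>. Both are non-decreasing
  and absolutely continuous, so both have densities, and \<open>u\<close> is the difference of
  these.\<close>

theorem abs_continuous_on_FTC:
  assumes f: "abs_continuous_on a b f" and "a \<le> b"
  obtains u where "integrable lborel u" "\<And>t. t \<in> {a..b} \<Longrightarrow> f t = f a + integral {a..t} u"
    "AE t in lebesgue_on {a..b}. (f has_real_derivative u t) (at t)"
proof -
  let ?P = "pos_variation f a"
  note P = abs_continuous_on_pos_variation[OF f]
  obtain p where p: "integrable lborel p" "\<And>t. t \<in> {a..b} \<Longrightarrow> ?P t = ?P a + (LINT s:{a..t}|lborel. p s)"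
    using mono_abs_continuous_density[OF P pos_variation_mono[OF f] \<open>a \<le> b\<close>] by blast
  have Q: "abs_continuous_on a b (\<lambda>t. ?P t - f t)" using abs_continuous_on_diff[OF P f] .
  have "?P s - f s \<le> ?P t - f t" if "a \<le> s" "s \<le> t" "t \<le> b" for s t
    using pos_variation_ge_increment[OF f that] by simp
  then obtain q where q: "integrable lborel q"
    "\<And>t. t \<in> {a..b} \<Longrightarrow> ?P t - f t = ?P a - f a + (LINT s:{a..t}|lborel. q s)"
    using mono_abs_continuous_density[OF Q _ \<open>a \<le> b\<close>] by blast
  define u where "u s = p s - q s" for s
  have int: "set_integrable lborel {s..t} g" if "integrable lborel g" for g :: "real \<Rightarrow> real" and s t
    unfolding set_integrable_def using that by (intro integrable_mult_indicator) auto
  have u: "integrable lborel u" unfolding u_def using p(1) q(1) by simp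
  have fu: "f t = f a + integral {a..t} u" if "t \<in> {a..b}" for t
  proof -
    have "f t = f a + ((LINT s:{a..t}|lborel. p s) - (LINT s:{a..t}|lborel. q s))"
      using p(2)[OF that] q(2)[OF that] by simp
    also have "\<dots> = f a + (LINT s:{a..t}|lborel. u s)"
      unfolding u_def using int[OF p(1)] int[OF q(1)] by (simp add: set_integral_diff)
    also have "\<dots> = f a + integral {a..t} u"
      using set_borel_integral_eq_integral(2)[OF int[OF u]] by simp
    finally show ?thesis .
  qed
  have "u integrable_on {s..t}" for s t
    using set_borel_integral_eq_integral(1)[OF int[OF u]] .
  from AE_indefinite_integral_derivative[OF this fu]
  show ?thesis using that[OF u fu] by blast
qed

text \<open>Serves integration by parts: the product rule supplies some almost everywhere derivative
  \<open>w\<close>, and uniqueness of derivatives identifies it with the density of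
  \<open>f\<close>.\<close>

lemma abs_continuous_on_integral_derivative:
  assumes f: "abs_continuous_on a b f" "a \<le> b"
    and w: "AE t in lebesgue_on {a..b}. (f has_real_derivative w t) (at t)"
    and m: "w \<in> borel_measurable (lebesgue_on {a..b})"
  shows "(LINT t|lebesgue_on {a..b}. w t) = f b - f a"
proof -
  obtain u where u: "integrable lborel u" "\<And>t. t \<in> {a..b} \<Longrightarrow> f t = f a + integral {a..t} u"
    "AE t in lebesgue_on {a..b}. (f has_real_derivative u t) (at t)"
    using abs_continuous_on_FTC[OF f] by blast
  have "integrable lebesgue u" using u(1) by (simp add: integrable_completion borel_measurable_integrable)
  then have int: "integrable (lebesgue_on {a..b}) u"
    using integrable_mult_indicator[of "{a..b}" lebesgue u] by (simp add: integrable_restrict_space)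
  have "AE t in lebesgue_on {a..b}. w t = u t"
    using w u(3) by eventually_elim (rule DERIV_unique)
  then have "(LINT t|lebesgue_on {a..b}. w t) = (LINT t|lebesgue_on {a..b}. u t)"
    using int m by (intro integral_cong_AE) auto
  also have "\<dots> = integral {a..b} u" by (rule lebesgue_integral_eq_integral[OF int]) simp
  also have "\<dots> = f b - f a" using u(2)[of b] \<open>a \<le> b\<close> by simp
  finally show ?thesis .
qed

section \<open>The action of a collision-free path\<close>

lemma ereal_integral_cong_AE:
  assumes "AE s in M. f s = g s"
  shows "ereal_integral M f = ereal_integral M g"
proof -
  have "(\<integral>\<^sup>+ s. e2ennreal (f s) \<partial>M) = (\<integral>\<^sup>+ s. e2ennreal (g s) \<partial>M)"
    using assms by (intro nn_integral_cong_AE) auto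
  moreover have "(\<integral>\<^sup>+ s. e2ennreal (- f s) \<partial>M) = (\<integral>\<^sup>+ s. e2ennreal (- g s) \<partial>M)"
    using assms by (intro nn_integral_cong_AE) auto
  ultimately show ?thesis by (simp add: ereal_integral_def)
qed

text \<open>The lower bound on a finite measure space makes the negative part finite, so no
  difference of infinities arises and lack of integrability can only mean the value
  infinity.\<close>

lemma ereal_integral_bounded_below:
  assumes M: "finite_measure M" and f [measurable]: "f \<in> borel_measurable M"
    and c: "\<And>s. s \<in> space M \<Longrightarrow> c \<le> f s"
  shows "ereal_integral M (\<lambda>s. ereal (f s)) = (if integrable M f then ereal (integral\<^sup>L M f) else \<infinity>)"
proof -
  interpret finite_measure M by fact
  have e: "e2ennreal (ereal r) = ennreal r" for r
    by (simp add: ennreal.rep_eq e2ennreal_def max_def) (simp add: ennreal_def e2ennreal_def)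
  have "(\<integral>\<^sup>+ s. ennreal (- f s) \<partial>M) \<le> (\<integral>\<^sup>+ s. ennreal \<bar>c\<bar> \<partial>M)"
    using c by (intro nn_integral_mono ennreal_leI) fastforce
  also have "\<dots> < \<infinity>" by (simp add: ennreal_mult_less_top less_top[symmetric] ennreal_mult_eq_top_iff)
  finally have neg: "(\<integral>\<^sup>+ s. ennreal (- f s) \<partial>M) < \<infinity>" .
  then obtain n where n: "(\<integral>\<^sup>+ s. ennreal (- f s) \<partial>M) = ennreal n" "n \<ge> 0"
    by (cases "\<integral>\<^sup>+ s. ennreal (- f s) \<partial>M") auto
  have eq: "ereal_integral M (\<lambda>s. ereal (f s)) =
      enn2ereal (\<integral>\<^sup>+ s. ennreal (f s) \<partial>M) - enn2ereal (\<integral>\<^sup>+ s. ennreal (- f s) \<partial>M)"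
    by (simp add: ereal_integral_def e)
  show ?thesis
  proof (cases "\<integral>\<^sup>+ s. ennreal (f s) \<partial>M")
    case (real p)
    then have "integrable M f" using n by (simp add: real_integrable_def)
    then show ?thesis using real n eq by (simp add: real_lebesgue_integral_def)
  next
    case top
    then have "\<not> integrable M f" by (simp add: real_integrable_def)
    then show ?thesis using top n eq by simp
  qed
qed

section \<open>Cyclic indices, gaps and tangent inequalities\<close>

definition prev_index :: "nat \<Rightarrow> nat \<Rightarrow> nat" where
  "prev_index N i = (if i = 1 then N else i - 1)"

lemma bij_prev_index: "bij_betw (prev_index N) {1..N} {1..N}"
proof (rule bij_betw_byWitness[where f' = "\<lambda>i. if i = N then 1 else i + 1"])
qed (auto simp: prev_index_def)

lemma prev_index_in: "i \<in> {1..N} \<Longrightarrow> prev_index N i \<in> {1..N}"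
  by (auto simp: prev_index_def)

text \<open>The convention for index 0 becomes a cyclic predecessor. The period survives only as an
  additive constant in the first gap, which differentiation in time removes.\<close>

lemma gap_eq: "i \<in> {1..N} \<Longrightarrow> gap N y i = y i - y (prev_index N i) + of_bool (i = 1)"
  by (auto simp: gap_def pos_def prev_index_def)

lemma configs_if_gap_nonneg:
  assumes "N \<ge> 1" and gap: "\<And>i. i \<in> {1..N} \<Longrightarrow> 0 \<le> gap N y i"
  shows "y \<in> configs N"
proof -
  have step: "y i \<le> y (Suc i)" if "i \<ge> 1" "Suc i \<le> N" for i
    using gap[of "Suc i"] gap_eq[of "Suc i" N y] that by (simp add: prev_index_def)
  have "y r \<le> y s" if "1 \<le> r" "r \<le> s" "s \<le> N" for r s
    using that(2,3)
  proof (induction s rule: dec_induct)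
    case (step n)
    then show ?case using \<open>\<And>i. i \<ge> 1 \<Longrightarrow> Suc i \<le> N \<Longrightarrow> y i \<le> y (Suc i)\<close>[of n] that(1) by simp
  qed simp
  moreover have "y N \<le> y 1 + 1"
    using gap[of 1] gap_eq[of 1 N y] \<open>N \<ge> 1\<close> by (simp add: prev_index_def)
  ultimately show ?thesis unfolding configs_def by (auto intro!: mono_onI)
qed

text \<open>The slope is taken at the end point \<open>b\<close>, the perturbed point in the
  applications: there the tangent of a convex function bounds the increment from above, the
  direction required for testing minimality.\<close>

lemma tangent_le:
  fixes f f' :: "real \<Rightarrow> real"
  assumes der: "\<And>r. r \<in> {min a b..max a b} \<Longrightarrow> (f has_real_derivative f' r) (at r)"
    and mono: "\<And>r s. r \<in> {min a b..max a b} \<Longrightarrow> s \<in> {min a b..max a b} \<Longrightarrow> r \<le> s \<Longrightarrow> f' r \<le> f' s"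
  shows "f b - f a \<le> f' b * (b - a)"
proof (cases a b rule: linorder_cases)
  case less
  obtain z where z: "a < z" "z < b" "f b - f a = (b - a) * f' z"
    using MVT2[OF less, of f f'] der less by auto
  have "f' z \<le> f' b" using mono z less by auto
  then show ?thesis using z less by (simp add: mult.commute mult_left_mono)
next
  case greater
  obtain z where z: "b < z" "z < a" "f a - f b = (a - b) * f' z"
    using MVT2[OF greater, of f f'] der greater by auto
  have "f' b \<le> f' z" using mono z greater by auto
  then have "(a - b) * f' b \<le> (a - b) * f' z" using greater by (simp add: mult_left_mono)
  then show ?thesis using z(3) by (simp add: algebra_simps)
qed simp

text \<open>\<open>\<Gamma>'\<close> is the derivative of the internal energy as a function of the
  gap: non-positive because particles repel each other, non-decreasing because this energy is convex
  in the gap. \<open>\<theta>\<close> is a modulus of strong monotonicity of \<open>L'\<close>, in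
  the application twice the constant of uniform convexity. \<open>V0\<close> is the potential, a
  function of time alone.\<close>

locale particle_system =
  fixes L L' L'' G \<Gamma>' V0 :: "real \<Rightarrow> real" and V :: "real \<Rightarrow> real \<Rightarrow> real"
    and \<theta> T :: real and N :: nat
  assumes L_deriv: "\<And>u. (L has_real_derivative L' u) (at u)"
    and L'_deriv: "\<And>u. (L' has_real_derivative L'' u) (at u)"
    and L_bdd: "\<exists>c. \<forall>u. c \<le> L u"
    and \<theta>_pos: "\<theta> > 0"
    and L'_mono: "\<And>u v. u \<le> v \<Longrightarrow> \<theta> * (v - u) \<le> L' v - L' u"
    and \<Gamma>_deriv: "\<And>r. r > 0 \<Longrightarrow> ((\<lambda>r. G ((1 / real N) / r)) has_real_derivative \<Gamma>' r) (at r)"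
    and \<Gamma>'_cont: "continuous_on {0<..} \<Gamma>'"
    and \<Gamma>'_mono: "\<And>r s. 0 < r \<Longrightarrow> r \<le> s \<Longrightarrow> \<Gamma>' r \<le> \<Gamma>' s"
    and \<Gamma>'_nonpos: "\<And>r. r > 0 \<Longrightarrow> \<Gamma>' r \<le> 0"
    and V_eq: "\<And>u t. t \<in> {0..T} \<Longrightarrow> V u t = V0 t"
    and V0_cont: "continuous_on {0..T} V0"
    and T_pos: "T > 0" and N_pos: "N \<ge> 1"
begin

abbreviation "M \<equiv> lebesgue_on {0..T}"

definition \<Gamma> :: "real \<Rightarrow> real" where "\<Gamma> r = G ((1 / real N) / r)"

sublocale M: finite_measure M
  by (rule finite_measureI) (simp add: emeasure_restrict_space emeasure_lborel_Icc_eq)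

lemma \<Gamma>_has_deriv: "r > 0 \<Longrightarrow> (\<Gamma> has_real_derivative \<Gamma>' r) (at r)"
  using \<Gamma>_deriv by (simp add: \<Gamma>_def[abs_def])

lemma \<Gamma>_cont: "continuous_on {0<..} \<Gamma>"
  using \<Gamma>_has_deriv by (intro continuous_at_imp_continuous_on) (auto intro: DERIV_isCont)

lemma cont_borel_M: "continuous_on {0..T} f \<Longrightarrow> f \<in> borel_measurable M" for f :: "real \<Rightarrow> real"
  by (rule continuous_imp_measurable_on_sets_lebesgue) auto

lemma cont_integrable_M: "continuous_on {0..T} f \<Longrightarrow> integrable M f" for f :: "real \<Rightarrow> real"
  by (rule continuous_imp_integrable_real)

lemma cont_L: "continuous_on S L" and cont_L': "continuous_on S L'"
  using L_deriv L'_deriv by (auto intro!: continuous_at_imp_continuous_on DERIV_isCont)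

lemma L_borel [measurable]: "L \<in> borel_measurable borel" and L'_borel [measurable]: "L' \<in> borel_measurable borel"
  by (auto intro!: borel_measurable_continuous_onI cont_L cont_L')

lemma L'_le: "u \<le> v \<Longrightarrow> L' u \<le> L' v"
  using L'_mono[of u v] mult_nonneg_nonneg[of \<theta> "v - u"] \<theta>_pos by linarith

lemma L_tangent: "L (u + d) - L u \<le> d * L' (u + d)"
  using tangent_le[of u "u + d" L L'] L_deriv L'_le by (simp add: mult.commute)

lemma \<Gamma>_tangent: "0 < r \<Longrightarrow> 0 < r + d \<Longrightarrow> \<Gamma> (r + d) - \<Gamma> r \<le> d * \<Gamma>' (r + d)"
proof -
  assume r: "0 < r" "0 < r + d"
  have "\<Gamma> (r + d) - \<Gamma> r \<le> \<Gamma>' (r + d) * (r + d - r)"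
    by (rule tangent_le) (use r in \<open>auto intro!: \<Gamma>_has_deriv \<Gamma>'_mono\<close>)
  then show ?thesis by (simp add: mult.commute)
qed

text \<open>The velocity \<open>w\<close> is a separate argument because a path has a derivative
  only almost everywhere; what is integrated is a chosen measurable representative.\<close>

definition energy_density :: "(real \<Rightarrow> nat \<Rightarrow> real) \<Rightarrow> (nat \<Rightarrow> real \<Rightarrow> real) \<Rightarrow> nat \<Rightarrow> real \<Rightarrow> real" where
  "energy_density y w i s = L (w i s) + \<Gamma> (gap N (y s) i) - V0 s"

definition collision_free :: "(real \<Rightarrow> nat \<Rightarrow> real) \<Rightarrow> bool" where
  "collision_free y \<longleftrightarrow>
     (\<forall>i\<in>{1..N}. continuous_on {0..T} (\<lambda>t. y t i)) \<and> (\<forall>t\<in>{0..T}. \<forall>i\<in>{1..N}. 0 < gap N (y t) i)"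

lemma gap_cont:
  assumes "collision_free y" "i \<in> {1..N}"
  shows "continuous_on {0..T} (\<lambda>t. gap N (y t) i)"
  using assms prev_index_in[of i N] unfolding collision_free_def
  by (simp add: gap_eq continuous_intros)

lemma cont_gap_comp:
  assumes "collision_free y" "i \<in> {1..N}" "continuous_on {0<..} f"
  shows "continuous_on {0..T} (\<lambda>t. f (gap N (y t) i))"
  by (rule continuous_on_compose2[OF assms(3) gap_cont[OF assms(1,2)]])
     (use assms(1,2) in \<open>auto simp: collision_free_def\<close>)

lemma energy_density_measurable:
  assumes "collision_free y" "i \<in> {1..N}" and [measurable]: "w i \<in> borel_measurable M"
  shows "energy_density y w i \<in> borel_measurable M"
  unfolding energy_density_def[abs_def]
  using cont_borel_M[OF cont_gap_comp[OF assms(1,2) \<Gamma>_cont]] cont_borel_M[OF V0_cont] by measurable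

lemma energy_density_bounded_below:
  assumes "collision_free y" "i \<in> {1..N}"
  obtains c where "\<And>s. s \<in> {0..T} \<Longrightarrow> c \<le> energy_density y w i s"
proof -
  obtain c where c: "\<And>u. c \<le> L u" using L_bdd by blast
  have "continuous_on {0..T} (\<lambda>s. \<Gamma> (gap N (y s) i) - V0 s)"
    by (intro continuous_intros cont_gap_comp[OF assms \<Gamma>_cont] V0_cont)
  then have "bounded ((\<lambda>s. \<Gamma> (gap N (y s) i) - V0 s) ` {0..T})"
    by (intro compact_imp_bounded compact_continuous_image) auto
  then obtain b where b: "\<And>s. s \<in> {0..T} \<Longrightarrow> \<bar>\<Gamma> (gap N (y s) i) - V0 s\<bar> \<le> b"
    unfolding bounded_iff by (auto simp del: atLeastAtMost_iff)
  have "c - b \<le> energy_density y w i s" if "s \<in> {0..T}" for s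
    using c[of "w i s"] b[OF that] unfolding energy_density_def by linarith
  then show ?thesis using that by blast
qed

text \<open>Without collisions every \<open>G\<close>-term is finite, and \<open>deriv\<close> may
  be replaced by \<open>w\<close> almost everywhere. The value infinity remains possible, since
  \<open>L\<close> of the velocity may fail to be integrable.\<close>

lemma action_eq:
  assumes y: "collision_free y" and w: "\<And>i. i \<in> {1..N} \<Longrightarrow> w i \<in> borel_measurable M"
    and d: "\<And>i. i \<in> {1..N} \<Longrightarrow> AE s in M. ((\<lambda>t. y t i) has_real_derivative w i s) (at s)"
  shows "action L G V T N y = (if \<forall>i\<in>{1..N}. integrable M (energy_density y w i)
     then ereal (1 / real N * (\<Sum>i=1..N. integral\<^sup>L M (energy_density y w i))) else \<infinity>)"
proof -
  have I: "ereal_integral M (\<lambda>s. ereal (L (deriv (\<lambda>t. y t i) s)) + G_term G N (y s) i - ereal (V (y s i) s)) =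
      (if integrable M (energy_density y w i) then ereal (integral\<^sup>L M (energy_density y w i)) else \<infinity>)"
    if i: "i \<in> {1..N}" for i
  proof -
    have sp: "AE s in M. s \<in> {0..T}" using AE_space[of M] by simp
    have "AE s in M. ereal (L (deriv (\<lambda>t. y t i) s)) + G_term G N (y s) i - ereal (V (y s i) s) =
        ereal (energy_density y w i s)"
      using d[OF i] sp
    proof eventually_elim
      case (elim s)
      have "gap N (y s) i > 0" using y i elim(2) by (auto simp: collision_free_def)
      then show ?case using DERIV_imp_deriv[OF elim(1)] V_eq[OF elim(2)]
        by (simp add: energy_density_def G_term_def \<Gamma>_def)
    qed
    then have "ereal_integral M (\<lambda>s. ereal (L (deriv (\<lambda>t. y t i) s)) + G_term G N (y s) i - ereal (V (y s i) s)) =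
      ereal_integral M (\<lambda>s. ereal (energy_density y w i s))" by (rule ereal_integral_cong_AE)
    also obtain c where "\<And>s. s \<in> {0..T} \<Longrightarrow> c \<le> energy_density y w i s"
      using energy_density_bounded_below[OF y i] by blast
    then have "ereal_integral M (\<lambda>s. ereal (energy_density y w i s)) =
      (if integrable M (energy_density y w i) then ereal (integral\<^sup>L M (energy_density y w i)) else \<infinity>)"
      by (intro ereal_integral_bounded_below M.finite_measure_axioms energy_density_measurable[where w=w, OF y i w[OF i]]) auto
    finally show ?thesis .
  qed
  show ?thesis
  proof (cases "\<forall>i\<in>{1..N}. integrable M (energy_density y w i)")
    case True
    then show ?thesis unfolding action_def using I by simp
  next
    case False
    then have "(\<Sum>i=1..N. if integrable M (energy_density y w i)
        then ereal (integral\<^sup>L M (energy_density y w i)) else \<infinity>) = \<infinity>"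
      by (auto simp: sum_Pinfty)
    then show ?thesis unfolding action_def using I False N_pos by simp
  qed
qed

end

section \<open>Euler--Lagrange equations of minimizers\<close>

locale particle_minimizer = particle_system +
  fixes x0 xT :: "nat \<Rightarrow> real" and x :: "real \<Rightarrow> nat \<Rightarrow> real"
  assumes sol: "particle_solution L G V T N x0 xT x"
    and gap_pos: "\<And>t i. t \<in> {0..T} \<Longrightarrow> i \<in> {1..N} \<Longrightarrow> 0 < gap N (x t) i"
begin

lemma admissible_x: "admissible T N x0 xT x"
  using sol by (simp add: particle_solution_def)

lemma x_ac: "i \<in> {1..N} \<Longrightarrow> abs_continuous_on 0 T (\<lambda>t. x t i)"
  using admissible_x by (simp add: admissible_def)

lemma collision_free_x: "collision_free x"
  using abs_continuous_on_imp_continuous_on[OF x_ac] gap_pos by (simp add: collision_free_def)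

definition vel :: "nat \<Rightarrow> real \<Rightarrow> real" where
  "vel i = (SOME u. integrable lborel u \<and> (\<forall>t\<in>{0..T}. x t i = x 0 i + integral {0..t} u) \<and>
     (AE t in M. ((\<lambda>t. x t i) has_real_derivative u t) (at t)))"

lemma
  assumes "i \<in> {1..N}"
  shows vel_lborel: "integrable lborel (vel i)"
    and x_eq_integral: "t \<in> {0..T} \<Longrightarrow> x t i = x 0 i + integral {0..t} (vel i)"
    and x_deriv: "AE t in M. ((\<lambda>t. x t i) has_real_derivative vel i t) (at t)"
proof -
  have "0 \<le> T" using T_pos by simp
  from abs_continuous_on_FTC[OF x_ac[OF assms] this]
  have "\<exists>u. integrable lborel u \<and> (\<forall>t\<in>{0..T}. x t i = x 0 i + integral {0..t} u) \<and>
     (AE t in M. ((\<lambda>t. x t i) has_real_derivative u t) (at t))" by metis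
  note * = someI_ex[OF this, folded vel_def]
  show "integrable lborel (vel i)" using * by (rule conjunct1)
  show "t \<in> {0..T} \<Longrightarrow> x t i = x 0 i + integral {0..t} (vel i)"
    using *[THEN conjunct2, THEN conjunct1] by (rule bspec)
  show "AE t in M. ((\<lambda>t. x t i) has_real_derivative vel i t) (at t)"
    using *[THEN conjunct2, THEN conjunct2] .
qed

lemma vel_borel [measurable]: "i \<in> {1..N} \<Longrightarrow> vel i \<in> borel_measurable M"
  using vel_lborel[of i] by (intro measurable_restrict_space1 measurable_completion) auto

lemma action_x:
  "action L G V T N x = (if \<forall>i\<in>{1..N}. integrable M (energy_density x vel i)
     then ereal (1 / real N * (\<Sum>i=1..N. integral\<^sup>L M (energy_density x vel i))) else \<infinity>)"
  by (rule action_eq[OF collision_free_x vel_borel x_deriv])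

text \<open>A competitor of finite action forces the minimizer to have finite action too; the
  comparison then takes place between real numbers and the common factor \<open>1 / real N\<close>
  cancels.\<close>

lemma energy_le_competitor:
  assumes y: "admissible T N x0 xT y" "collision_free y"
    and w: "\<And>i. i \<in> {1..N} \<Longrightarrow> w i \<in> borel_measurable M"
    and d: "\<And>i. i \<in> {1..N} \<Longrightarrow> AE s in M. ((\<lambda>t. y t i) has_real_derivative w i s) (at s)"
    and I: "\<And>i. i \<in> {1..N} \<Longrightarrow> integrable M (energy_density y w i)"
  shows "i \<in> {1..N} \<Longrightarrow> integrable M (energy_density x vel i)"
    and "(\<Sum>i=1..N. integral\<^sup>L M (energy_density x vel i)) \<le> (\<Sum>i=1..N. integral\<^sup>L M (energy_density y w i))"
proof -
  have y_act: "action L G V T N y = ereal (1 / real N * (\<Sum>i=1..N. integral\<^sup>L M (energy_density y w i)))"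
    using action_eq[OF y(2) w d] I by simp
  have le: "action L G V T N x \<le> action L G V T N y"
    using sol y(1) by (simp add: particle_solution_def)
  have int: "\<forall>i\<in>{1..N}. integrable M (energy_density x vel i)"
  proof (rule ccontr)
    assume "\<not> ?thesis"
    then have "action L G V T N x = \<infinity>" using action_x by simp
    then show False using le y_act by simp
  qed
  then show "i \<in> {1..N} \<Longrightarrow> integrable M (energy_density x vel i)" by blast
  have "1 / real N * (\<Sum>i=1..N. integral\<^sup>L M (energy_density x vel i)) \<le>
      1 / real N * (\<Sum>i=1..N. integral\<^sup>L M (energy_density y w i))"
    using le y_act action_x int by simp
  then show "(\<Sum>i=1..N. integral\<^sup>L M (energy_density x vel i)) \<le> (\<Sum>i=1..N. integral\<^sup>L M (energy_density y w i))"
    using N_pos by (simp add: divide_le_cancel)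
qed

text \<open>Linear interpolation between the two configurations has finite action.\<close>

lemma energy_integrable:
  assumes "i \<in> {1..N}"
  shows "integrable M (energy_density x vel i)"
proof -
  define y where "y t i = (1 - t / T) * x0 i + t / T * xT i" for t i
  define w where "w i t = (xT i - x0 i) / T" for i and t :: real
  have ends: "x 0 i = x0 i" "x T i = xT i" if "i \<in> {1..N}" for i
    using admissible_x that by (auto simp: admissible_def)
  \<comment> \<open>Gaps are affine in the configuration, and the weights add up to 1, which keeps
    the constant in the first gap; so interpolating between collision-free ends creates no
    collision.\<close>
  have gap_y: "gap N (y t) i > 0" if t: "t \<in> {0..T}" and i: "i \<in> {1..N}" for t i
  proof -
    have "gap N (y t) i = (1 - t / T) * gap N (x 0) i + t / T * gap N (x T) i"
      using ends[OF i] ends[OF prev_index_in[OF i]] by (simp add: gap_eq[OF i] y_def algebra_simps)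
    moreover have "gap N (x 0) i > 0" "gap N (x T) i > 0" using gap_pos i T_pos by auto
    moreover have "0 \<le> t / T" "t / T \<le> 1" using t T_pos by auto
    ultimately show ?thesis
      using convex_bound_lt[of "- gap N (x 0) i" 0 "- gap N (x T) i" "1 - t / T" "t / T"] by simp
  qed
  have der: "((\<lambda>t. y t i) has_real_derivative w i t) (at t)" for i t
    unfolding y_def w_def using T_pos
    by (auto intro!: derivative_eq_intros simp: field_simps)
  have cont_y: "continuous_on {0..T} (\<lambda>t. y t i)" for i
    unfolding y_def by (intro continuous_intros) (use T_pos in auto)
  have cf: "collision_free y"
    unfolding collision_free_def using gap_y cont_y by auto
  have adm: "admissible T N x0 xT y"
    unfolding admissible_def
  proof (intro conjI ballI)
    fix i assume "i \<in> {1..N}"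
    have "\<bar>(xT i - x0 i) / T\<bar>-lipschitz_on {0..T} (\<lambda>t. y t i)"
    proof (rule lipschitz_onI)
      fix s t
      have "y s i - y t i = (xT i - x0 i) / T * (s - t)"
        using T_pos by (simp add: y_def field_simps)
      then show "dist (y s i) (y t i) \<le> \<bar>(xT i - x0 i) / T\<bar> * dist s t"
        by (simp add: dist_real_def abs_mult)
    qed simp
    then show "abs_continuous_on 0 T (\<lambda>t. y t i)" by (rule lipschitz_imp_abs_continuous_on)
  next
    fix t assume "t \<in> {0..T}"
    then show "y t \<in> configs N"
      using gap_y by (intro configs_if_gap_nonneg N_pos less_imp_le)
  next
    fix i show "y 0 i = x0 i" "y T i = xT i" using T_pos by (auto simp: y_def)
  qed
  have "integrable M (energy_density y w i)" if i: "i \<in> {1..N}" for i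
    unfolding energy_density_def[abs_def] w_def
    by (intro cont_integrable_M continuous_intros cont_gap_comp[OF cf i \<Gamma>_cont] V0_cont)
  moreover have "w i \<in> borel_measurable M" for i unfolding w_def by simp
  ultimately show ?thesis
    using energy_le_competitor(1)[OF adm cf _ _ _ assms] der by blast
qed

text \<open>\<open>incidence j i\<close> is the partial derivative of the \<open>i\<close>-th gap with respect to the \<open>j\<close>-th position; it
  vanishes identically for a single particle.\<close>

definition incidence :: "nat \<Rightarrow> nat \<Rightarrow> real" where
  "incidence j i = of_bool (i = j) - of_bool (prev_index N i = j)"

lemma gap_perturb:
  assumes "i \<in> {1..N}"
  shows "gap N (\<lambda>k. y k + (if k = j then d else 0)) i = gap N y i + d * incidence j i"
  using assms by (auto simp: gap_eq incidence_def)

section \<open>First variation with respect to a single particle\<close>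

lemma gap_lower_bound:
  obtains \<delta> where "\<delta> > 0" "\<And>t i. t \<in> {0..T} \<Longrightarrow> i \<in> {1..N} \<Longrightarrow> \<delta> \<le> gap N (x t) i"
proof -
  have "\<exists>\<delta>>0. \<forall>t\<in>{0..T}. \<delta> \<le> gap N (x t) i" if i: "i \<in> {1..N}" for i
  proof -
    obtain s where "s \<in> {0..T}" "\<forall>t\<in>{0..T}. gap N (x s) i \<le> gap N (x t) i"
      using continuous_attains_inf[OF compact_Icc _ gap_cont[OF collision_free_x i]] T_pos by auto
    then show ?thesis using gap_pos[OF _ i] by blast
  qed
  then obtain \<delta> where \<delta>: "\<And>i. i \<in> {1..N} \<Longrightarrow> \<delta> i > (0::real)"
    "\<And>i t. i \<in> {1..N} \<Longrightarrow> t \<in> {0..T} \<Longrightarrow> \<delta> i \<le> gap N (x t) i" by metis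
  show ?thesis
  proof
    show "Min (\<delta> ` {1..N}) > 0" using \<delta>(1) N_pos by (subst Min_gr_iff) auto
    fix t i assume "t \<in> {0..T}" "i \<in> {1..N}"
    then show "Min (\<delta> ` {1..N}) \<le> gap N (x t) i"
      using \<delta>(2)[of i t] Min_le[of "\<delta> ` {1..N}" "\<delta> i"] by (meson finite_atLeastAtMost finite_imageI imageI order_trans)
  qed
qed

text \<open>The partial derivative of the internal energy with respect to the \<open>j\<close>-th
  position. By \<open>sum_incidence\<close> it is a difference of two values of
  \<open>\<Gamma>'\<close>.\<close>

definition force :: "nat \<Rightarrow> real \<Rightarrow> real" where
  "force j t = (\<Sum>i=1..N. incidence j i * \<Gamma>' (gap N (x t) i))"

lemma force_cont: "continuous_on {0..T} (force j)"
  unfolding force_def[abs_def]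
  by (intro continuous_intros cont_gap_comp[OF collision_free_x _ \<Gamma>'_cont])

text \<open>As \<open>L'\<close> is monotone, its values at the two ends of a symmetric interval
  dominate \<open>|L'|\<close> inside it. The interval contains the unit neighbourhood of
  \<open>v\<close>, in which perturbed velocities are kept.\<close>

definition L'_bound :: "real \<Rightarrow> real" where
  "L'_bound v = \<bar>L' (\<bar>v\<bar> + 1)\<bar> + \<bar>L' (- \<bar>v\<bar> - 1)\<bar>"

lemma L'_bound_borel [measurable]: "L'_bound \<in> borel_measurable borel"
  unfolding L'_bound_def[abs_def] by measurable

lemma L'_le_bound: "\<bar>d\<bar> \<le> 1 \<Longrightarrow> \<bar>L' (v + d)\<bar> \<le> L'_bound v"
  using L'_le[of "v + d" "\<bar>v\<bar> + 1"] L'_le[of "- \<bar>v\<bar> - 1" "v + d"] unfolding L'_bound_def by linarith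

lemma abs_incidence_le: "\<bar>incidence j i\<bar> \<le> 1"
  by (simp add: incidence_def)

text \<open>The growth bound on \<open>\<psi>\<close> replaces any growth condition on \<open>L\<close>: convexity then controls the increments
  of the Lagrangian by bounded quantities.\<close>

lemma first_variation_ineq:
  assumes j: "j \<in> {1..N}" and h0: "h 0 = 0" and hT: "h T = 0"
    and lip: "B-lipschitz_on {0..T} h"
    and hd: "AE t in M. (h has_real_derivative \<psi> t) (at t)"
    and \<psi> [measurable]: "\<psi> \<in> borel_measurable M"
    and bound: "\<And>t. t \<in> {0..T} \<Longrightarrow> (1 + L'_bound (vel j t)) * \<bar>\<psi> t\<bar> \<le> B"
  shows "0 \<le> (LINT t|M. \<psi> t * L' (vel j t) + h t * force j t)"
proof -
  have B: "B \<ge> 0" using lip lipschitz_on_nonneg by blast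
  have hb: "\<bar>h t\<bar> \<le> B * T" if "t \<in> {0..T}" for t
  proof -
    have "\<bar>h t\<bar> \<le> B * t" using lipschitz_onD[OF lip, of t 0] that h0 by (simp add: dist_real_def)
    also have "\<dots> \<le> B * T" using that B by (simp add: mult_left_mono)
    finally show ?thesis .
  qed
  have h_cont: "continuous_on {0..T} h" using lip lipschitz_on_continuous_on by blast
  have Lb0: "0 \<le> L'_bound v" for v unfolding L'_bound_def by simp
  have \<psi>b: "\<bar>\<psi> t\<bar> \<le> B" "L'_bound (vel j t) * \<bar>\<psi> t\<bar> \<le> B" if "t \<in> {0..T}" for t
    using bound[OF that] mult_nonneg_nonneg[OF Lb0 abs_ge_zero, of "vel j t" "\<psi> t"]
    by (simp_all add: algebra_simps)
  obtain \<delta> where \<delta>: "\<delta> > 0" "\<And>t i. t \<in> {0..T} \<Longrightarrow> i \<in> {1..N} \<Longrightarrow> \<delta> \<le> gap N (x t) i"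
    using gap_lower_bound by blast
  \<comment> \<open>The first entry keeps the change of velocity within 1, the range of
    \<open>L'_bound\<close>; the second keeps every gap above \<delta>/2, since \<open>|h|\<close>
    is at most \<open>B * T\<close>.\<close>
  define \<epsilon>1 where "\<epsilon>1 = min (1 / (B + 1)) (\<delta> / (2 * (B * T + 1)))"
  have BT: "0 \<le> B * T" using B T_pos by simp
  have \<epsilon>1: "\<epsilon>1 > 0" unfolding \<epsilon>1_def using B BT \<delta>(1) by simp
  have \<epsilon>1B: "\<epsilon>1 * B \<le> 1"
  proof -
    have "\<epsilon>1 * B \<le> 1 / (B + 1) * B" unfolding \<epsilon>1_def using B by (intro mult_right_mono) auto
    also have "\<dots> \<le> 1" using B by simp
    finally show ?thesis .
  qed
  have \<epsilon>1\<delta>: "\<epsilon>1 * (B * T) \<le> \<delta> / 2"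
  proof -
    have "\<epsilon>1 * (B * T) \<le> \<delta> / (2 * (B * T + 1)) * (B * T)"
      unfolding \<epsilon>1_def using BT by (intro mult_right_mono) auto
    also have "\<dots> \<le> \<delta> / 2" using BT \<delta>(1) by (simp add: field_simps)
    finally show ?thesis .
  qed
  define r where "r \<epsilon> i s = gap N (x s) i + \<epsilon> * h s * incidence j i" for \<epsilon> i s
  \<comment> \<open>By the tangent inequalities at the perturbed point,
    \<open>\<epsilon> * K \<epsilon> i s\<close> bounds the increment of the \<open>i\<close>-th
    energy density from above. At \<epsilon> = 0 the sum over \<open>i\<close> is the integrand of
    the first variation.\<close>
  define K where "K \<epsilon> i s = (if i = j then \<psi> s * L' (vel j s + \<epsilon> * \<psi> s) else 0) +
      h s * incidence j i * \<Gamma>' (r \<epsilon> i s)" for \<epsilon> i s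
  define C where "C = B + B * T * \<bar>\<Gamma>' (\<delta> / 2)\<bar>"
  have r_ge: "\<delta> / 2 \<le> r \<epsilon> i s" if "0 \<le> \<epsilon>" "\<epsilon> \<le> \<epsilon>1" "i \<in> {1..N}" "s \<in> {0..T}" for \<epsilon> i s
  proof -
    have "\<bar>\<epsilon> * h s * incidence j i\<bar> = \<epsilon> * (\<bar>h s\<bar> * \<bar>incidence j i\<bar>)"
      using that(1) by (simp add: abs_mult)
    also have "\<dots> \<le> \<epsilon>1 * (B * T * 1)"
      using that hb[OF that(4)] abs_incidence_le[of j i] BT by (intro mult_mono) auto
    also have "\<dots> \<le> \<delta> / 2" using \<epsilon>1\<delta> by simp
    finally show ?thesis using \<delta>(2)[OF that(4,3)] unfolding r_def by linarith
  qed
  have r_cont: "continuous_on {0..T} (r \<epsilon> i)" if "i \<in> {1..N}" for \<epsilon> i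
    unfolding r_def[abs_def] by (intro continuous_intros gap_cont[OF collision_free_x that] h_cont)
  have h_meas [measurable]: "h \<in> borel_measurable M" by (rule cont_borel_M[OF h_cont])
  have vel_meas [measurable]: "vel j \<in> borel_measurable M" using j by (rule vel_borel)
  have K_meas: "K \<epsilon> i \<in> borel_measurable M" if "0 \<le> \<epsilon>" "\<epsilon> \<le> \<epsilon>1" "i \<in> {1..N}" for \<epsilon> i
  proof -
    have "continuous_on {0..T} (\<lambda>s. \<Gamma>' (r \<epsilon> i s))"
      by (rule continuous_on_compose2[OF \<Gamma>'_cont r_cont[OF that(3)]])
         (use r_ge[OF that] \<delta>(1) in force)
    then have [measurable]: "(\<lambda>s. \<Gamma>' (r \<epsilon> i s)) \<in> borel_measurable M" by (rule cont_borel_M)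
    show ?thesis unfolding K_def[abs_def] by measurable
  qed
  have L'_small: "\<bar>\<psi> s * L' (vel j s + \<epsilon> * \<psi> s)\<bar> \<le> B" if "0 \<le> \<epsilon>" "\<epsilon> \<le> \<epsilon>1" "s \<in> {0..T}" for \<epsilon> s
  proof -
    have "\<bar>\<epsilon> * \<psi> s\<bar> \<le> \<epsilon>1 * B"
      unfolding abs_mult using that \<psi>b(1)[OF that(3)] by (intro mult_mono) auto
    then have "\<bar>L' (vel j s + \<epsilon> * \<psi> s)\<bar> \<le> L'_bound (vel j s)"
      using \<epsilon>1B by (intro L'_le_bound) linarith
    then have "\<bar>\<psi> s\<bar> * \<bar>L' (vel j s + \<epsilon> * \<psi> s)\<bar> \<le> \<bar>\<psi> s\<bar> * L'_bound (vel j s)"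
      by (rule mult_left_mono) simp
    then show ?thesis using \<psi>b(2)[OF that(3)] by (simp add: abs_mult mult.commute)
  qed
  have K_bound: "\<bar>K \<epsilon> i s\<bar> \<le> C" if "0 \<le> \<epsilon>" "\<epsilon> \<le> \<epsilon>1" "i \<in> {1..N}" "s \<in> {0..T}" for \<epsilon> i s
  proof -
    \<comment> \<open>\<open>\<Gamma>'\<close> is non-positive and non-decreasing, so its absolute
      value is largest at the smallest gap that can occur, \<delta>/2.\<close>
    have "\<bar>\<Gamma>' (r \<epsilon> i s)\<bar> \<le> \<bar>\<Gamma>' (\<delta> / 2)\<bar>"
      using \<Gamma>'_mono[OF _ r_ge[OF that]] \<Gamma>'_nonpos[of "r \<epsilon> i s"] r_ge[OF that] \<delta>(1) by auto
    then have "\<bar>h s * incidence j i * \<Gamma>' (r \<epsilon> i s)\<bar> \<le> B * T * 1 * \<bar>\<Gamma>' (\<delta> / 2)\<bar>"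
      unfolding abs_mult using hb[OF that(4)] abs_incidence_le[of j i] BT by (intro mult_mono) auto
    moreover have "\<bar>if i = j then \<psi> s * L' (vel j s + \<epsilon> * \<psi> s) else 0\<bar> \<le> B"
      using L'_small[OF that(1,2,4)] B by simp
    ultimately show ?thesis unfolding K_def C_def by linarith
  qed
  have K_int: "integrable M (K \<epsilon> i)" if "0 \<le> \<epsilon>" "\<epsilon> \<le> \<epsilon>1" "i \<in> {1..N}" for \<epsilon> i
    by (rule M.integrable_const_bound[where B=C])
       (use K_bound[OF that] K_meas[OF that] in \<open>auto intro!: AE_I2\<close>)
  have K_nonneg: "0 \<le> (\<Sum>i=1..N. integral\<^sup>L M (K \<epsilon> i))" if \<epsilon>: "0 < \<epsilon>" "\<epsilon> \<le> \<epsilon>1" for \<epsilon>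
  proof -
    define y where "y t k = x t k + (if k = j then \<epsilon> * h t else 0)" for t k
    define w where "w k t = vel k t + (if k = j then \<epsilon> * \<psi> t else 0)" for k t
    have \<epsilon>0: "0 \<le> \<epsilon>" using \<epsilon> by simp
    have gap_y: "gap N (y s) i = r \<epsilon> i s" if "i \<in> {1..N}" for i s
      unfolding y_def[abs_def] r_def using gap_perturb[OF that, of "x s" j "\<epsilon> * h s"] by simp
    have gap_y_pos: "gap N (y s) i > 0" if "i \<in> {1..N}" "s \<in> {0..T}" for i s
      using r_ge[OF \<epsilon>0 \<epsilon>(2) that] \<delta>(1) gap_y[OF that(1), of s] by linarith
    have x_cont: "continuous_on {0..T} (\<lambda>t. x t k)" if "k \<in> {1..N}" for k
      using collision_free_x that by (simp add: collision_free_def)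
    have cf: "collision_free y"
      unfolding collision_free_def y_def[abs_def]
    proof (intro conjI ballI)
      show "continuous_on {0..T} (\<lambda>t. x t k + (if k = j then \<epsilon> * h t else 0))" if "k \<in> {1..N}" for k
        using x_cont[OF that] h_cont by (cases "k = j") (auto intro!: continuous_intros)
      show "0 < gap N (\<lambda>k. x t k + (if k = j then \<epsilon> * h t else 0)) i"
        if "t \<in> {0..T}" "i \<in> {1..N}" for t i
        using gap_y_pos[OF that(2,1)] unfolding y_def[abs_def] .
    qed
    \<comment> \<open>The sign is chosen so that \<open>x_j + \<epsilon> * h\<close> is a difference
      of absolutely continuous functions.\<close>
    have h_ac: "abs_continuous_on 0 T (\<lambda>t. - (\<epsilon> * h t))"
    proof (rule lipschitz_imp_abs_continuous_on)
      show "(\<epsilon> * B)-lipschitz_on {0..T} (\<lambda>t. - (\<epsilon> * h t))"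
      proof (rule lipschitz_onI)
        fix s t assume "s \<in> {0..T}" "t \<in> {0..T}"
        then have "\<bar>h s - h t\<bar> \<le> B * \<bar>s - t\<bar>"
          using lipschitz_onD[OF lip, of s t] by (simp add: dist_real_def)
        then have "\<epsilon> * \<bar>h s - h t\<bar> \<le> \<epsilon> * (B * \<bar>s - t\<bar>)"
          using \<epsilon>0 by (rule mult_left_mono)
        moreover have "dist (- (\<epsilon> * h s)) (- (\<epsilon> * h t)) = \<epsilon> * \<bar>h s - h t\<bar>"
        proof -
          have "- (\<epsilon> * h s) - - (\<epsilon> * h t) = \<epsilon> * (h t - h s)" by (simp add: algebra_simps)
          then show ?thesis using \<epsilon>0 by (simp add: dist_real_def abs_mult abs_minus_commute)
        qed
        ultimately show "dist (- (\<epsilon> * h s)) (- (\<epsilon> * h t)) \<le> \<epsilon> * B * dist s t"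
          by (simp add: dist_real_def)
      qed (use \<epsilon>0 B in simp)
    qed
    have adm: "admissible T N x0 xT y"
      unfolding admissible_def
    proof (intro conjI ballI)
      fix k assume k: "k \<in> {1..N}"
      show "abs_continuous_on 0 T (\<lambda>t. y t k)"
        using abs_continuous_on_diff[OF x_ac[OF k] h_ac] x_ac[OF k]
        by (cases "k = j") (simp_all add: y_def)
      show "y 0 k = x0 k" "y T k = xT k"
        using admissible_x k h0 hT by (auto simp: admissible_def y_def)
    next
      fix t assume "t \<in> {0..T}"
      then show "y t \<in> configs N"
        using gap_y_pos by (intro configs_if_gap_nonneg N_pos less_imp_le)
    qed
    have w_meas: "w k \<in> borel_measurable M" if "k \<in> {1..N}" for k
      using vel_borel[OF that] unfolding w_def[abs_def] by (cases "k = j") auto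
    have w_der: "AE s in M. ((\<lambda>t. y t k) has_real_derivative w k s) (at s)" if "k \<in> {1..N}" for k
      using x_deriv[OF that] hd
    proof eventually_elim
      case (elim s)
      show ?case
        using DERIV_add[OF elim(1) DERIV_cmult[OF elim(2), of \<epsilon>]] elim(1)
        by (cases "k = j") (simp_all add: y_def w_def)
    qed
    have diff_le: "energy_density y w i s \<le> energy_density x vel i s + \<epsilon> * K \<epsilon> i s"
      if "i \<in> {1..N}" "s \<in> {0..T}" for i s
    proof -
      have "\<Gamma> (r \<epsilon> i s) - \<Gamma> (gap N (x s) i) \<le> \<epsilon> * h s * incidence j i * \<Gamma>' (r \<epsilon> i s)"
        using \<Gamma>_tangent[of "gap N (x s) i" "\<epsilon> * h s * incidence j i"] gap_pos[OF that(2,1)]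
          gap_y_pos[OF that] gap_y[OF that(1), of s] by (simp add: r_def)
      moreover have "L (w i s) - L (vel i s) \<le> \<epsilon> * (if i = j then \<psi> s * L' (vel j s + \<epsilon> * \<psi> s) else 0)"
        using L_tangent[of "vel j s" "\<epsilon> * \<psi> s"] by (simp add: w_def mult.assoc)
      ultimately show ?thesis
        unfolding energy_density_def gap_y[OF that(1)] K_def by (simp add: algebra_simps)
    qed
    have int_y: "integrable M (energy_density y w i)" if i: "i \<in> {1..N}" for i
    proof -
      obtain c where c: "\<And>s. s \<in> {0..T} \<Longrightarrow> c \<le> energy_density y w i s"
        using energy_density_bounded_below[OF cf i] by blast
      \<comment> \<open>The density of the competitor lies between a constant and an integrable
        function, the latter by the tangent inequalities, so it is integrable as well.\<close>
      show ?thesis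
      proof (rule Bochner_Integration.integrable_bound)
        show "integrable M (\<lambda>s. \<bar>c\<bar> + \<bar>energy_density x vel i s + \<epsilon> * K \<epsilon> i s\<bar>)"
          using energy_integrable[OF i] K_int[OF \<epsilon>0 \<epsilon>(2) i] by auto
        show "energy_density y w i \<in> borel_measurable M"
          by (rule energy_density_measurable[where w=w, OF cf i w_meas[OF i]])
        show "AE s in M. norm (energy_density y w i s) \<le>
            norm (\<bar>c\<bar> + \<bar>energy_density x vel i s + \<epsilon> * K \<epsilon> i s\<bar>)"
        proof (rule AE_I2)
          fix s assume "s \<in> space M"
          then have s: "s \<in> {0..T}" by simp
          show "norm (energy_density y w i s) \<le>
            norm (\<bar>c\<bar> + \<bar>energy_density x vel i s + \<epsilon> * K \<epsilon> i s\<bar>)"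
            using c[OF s] diff_le[OF i s] unfolding real_norm_def by linarith
        qed
      qed
    qed
    have "(\<Sum>i=1..N. integral\<^sup>L M (energy_density x vel i)) \<le> (\<Sum>i=1..N. integral\<^sup>L M (energy_density y w i))"
      by (rule energy_le_competitor(2)[OF adm cf w_meas w_der int_y])
    also have "\<dots> \<le> (\<Sum>i=1..N. LINT s|M. energy_density x vel i s + \<epsilon> * K \<epsilon> i s)"
    proof (rule sum_mono)
      fix i assume i: "i \<in> {1..N}"
      show "integral\<^sup>L M (energy_density y w i) \<le> (LINT s|M. energy_density x vel i s + \<epsilon> * K \<epsilon> i s)"
        using diff_le[OF i] energy_integrable[OF i] K_int[OF \<epsilon>0 \<epsilon>(2) i] int_y[OF i]
        by (intro integral_mono) auto
    qed
    also have "\<dots> = (\<Sum>i=1..N. integral\<^sup>L M (energy_density x vel i) + \<epsilon> * integral\<^sup>L M (K \<epsilon> i))"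
      using energy_integrable K_int[OF \<epsilon>0 \<epsilon>(2)] by (intro sum.cong) auto
    also have "\<dots> = (\<Sum>i=1..N. integral\<^sup>L M (energy_density x vel i)) + \<epsilon> * (\<Sum>i=1..N. integral\<^sup>L M (K \<epsilon> i))"
      by (simp add: sum.distrib sum_distrib_left)
    finally show ?thesis using \<epsilon>(1) by (simp add: zero_le_mult_iff)
  qed
  define e where "e n = \<epsilon>1 / real (Suc n)" for n
  have e: "0 < e n" "e n \<le> \<epsilon>1" for n using \<epsilon>1 by (simp_all add: e_def field_simps)
  have e_lim: "e \<longlonglongrightarrow> 0"
    unfolding e_def[abs_def] using LIMSEQ_Suc[OF lim_const_over_n[of \<epsilon>1]] .
  \<comment> \<open>\<open>K\<close> is bounded by \<open>C\<close> uniformly in \<epsilon>, so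
    dominated convergence carries non-negativity of the integrals from the positive values
    \<open>e n\<close> to 0.\<close>
  have "(\<lambda>n. \<Sum>i=1..N. integral\<^sup>L M (K (e n) i)) \<longlonglongrightarrow> (\<Sum>i=1..N. integral\<^sup>L M (K 0 i))"
  proof (rule tendsto_sum)
    fix i assume i: "i \<in> {1..N}"
    show "(\<lambda>n. integral\<^sup>L M (K (e n) i)) \<longlonglongrightarrow> integral\<^sup>L M (K 0 i)"
    proof (rule integral_dominated_convergence[where w="\<lambda>_. C"])
      show "K 0 i \<in> borel_measurable M" using K_meas[of 0 i] i \<epsilon>1 by simp
      show "K (e n) i \<in> borel_measurable M" for n using K_meas[of "e n" i] i e[of n] by simp
      show "AE s in M. norm (K (e n) i s) \<le> C" for n
        using K_bound[of "e n" i] i e[of n] by (intro AE_I2) simp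
      show "AE s in M. (\<lambda>n. K (e n) i s) \<longlonglongrightarrow> K 0 i s"
      proof (rule AE_I2)
        fix s assume "s \<in> space M"
        then have s: "s \<in> {0..T}" by simp
        have "(\<lambda>n. r (e n) i s) \<longlonglongrightarrow> r 0 i s"
          unfolding r_def by (intro tendsto_intros e_lim)
        moreover have "isCont \<Gamma>' (r 0 i s)"
          using \<Gamma>'_cont r_ge[of 0 i s] i s \<epsilon>1 \<delta>(1) by (simp add: continuous_on_eq_continuous_at)
        ultimately have 1: "(\<lambda>n. \<Gamma>' (r (e n) i s)) \<longlonglongrightarrow> \<Gamma>' (r 0 i s)"
          by (rule isCont_tendsto_compose[rotated])
        have "(\<lambda>n. vel j s + e n * \<psi> s) \<longlonglongrightarrow> vel j s + 0 * \<psi> s"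
          by (intro tendsto_intros e_lim)
        then have 2: "(\<lambda>n. L' (vel j s + e n * \<psi> s)) \<longlonglongrightarrow> L' (vel j s + 0 * \<psi> s)"
          by (rule isCont_tendsto_compose[OF DERIV_isCont[OF L'_deriv]])
        show "(\<lambda>n. K (e n) i s) \<longlonglongrightarrow> K 0 i s"
          unfolding K_def using 1 2 by (cases "i = j") (auto intro!: tendsto_intros)
      qed
    qed simp
  qed
  then have "0 \<le> (\<Sum>i=1..N. integral\<^sup>L M (K 0 i))"
    by (rule LIMSEQ_le_const) (use K_nonneg e in auto)
  also have "\<dots> = (LINT s|M. (\<Sum>i=1..N. K 0 i s))"
    using K_int[of 0] \<epsilon>1 by (simp add: Bochner_Integration.integral_sum)
  also have "\<dots> = (LINT t|M. \<psi> t * L' (vel j t) + h t * force j t)"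
  proof (rule Bochner_Integration.integral_cong)
    fix s
    have "(\<Sum>i=1..N. h s * incidence j i * \<Gamma>' (gap N (x s) i)) = h s * force j s"
      unfolding force_def by (simp add: sum_distrib_left mult.assoc)
    then show "(\<Sum>i=1..N. K 0 i s) = \<psi> s * L' (vel j s) + h s * force j s"
      unfolding K_def r_def using j by (simp add: sum.distrib sum.delta)
  qed simp
  finally show ?thesis .
qed

section \<open>Integrated Euler-Lagrange equation by the du Bois-Reymond argument\<close>

lemma lipschitz_integral:
  fixes u :: "real \<Rightarrow> real"
  assumes int: "integrable M u" and b: "\<And>t. t \<in> {0..T} \<Longrightarrow> \<bar>u t\<bar> \<le> B"
  shows "B-lipschitz_on {0..T} (\<lambda>t. integral {0..t} u)"
proof -
  have u: "u integrable_on {0..T}"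
    using int by (auto simp: set_integrable_def integrable_restrict_space intro!: set_lebesgue_integral_eq_integral(1))
  have B: "B \<ge> 0" using b[of 0] T_pos by fastforce
  have *: "\<bar>integral {0..t} u - integral {0..s} u\<bar> \<le> B * (t - s)" if "0 \<le> s" "s \<le> t" "t \<le> T" for s t
  proof -
    have sub: "u integrable_on {s..t}" "u integrable_on {0..t}"
      using that by (auto intro: integrable_on_subinterval[OF u])
    have "integral {0..s} u + integral {s..t} u = integral {0..t} u"
      using that sub by (intro Henstock_Kurzweil_Integration.integral_combine) auto
    moreover have "\<bar>integral {s..t} u\<bar> \<le> B * (t - s)"
      using has_integral_bound_real[OF B finite.emptyI integrable_integral[OF sub(1)]] that b by simp
    ultimately show ?thesis by linarith
  qed
  show ?thesis
  proof (rule lipschitz_onI)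
    fix s t assume "s \<in> {0..T}" "t \<in> {0..T}"
    then show "dist (integral {0..s} u) (integral {0..t} u) \<le> B * dist s t"
      using *[of s t] *[of t s] by (cases "s \<le> t") (auto simp: dist_real_def)
  qed (rule B)
qed

text \<open>Integrating the force moves the time derivative away from \<open>L'\<close> of the
  velocity, which is so far only a measurable function.\<close>

definition impulse :: "nat \<Rightarrow> real \<Rightarrow> real" where
  "impulse j t = integral {0..t} (force j)"

lemma force_bounded:
  obtains B where "\<And>t. t \<in> {0..T} \<Longrightarrow> \<bar>force j t\<bar> \<le> B"
proof -
  have "bounded (force j ` {0..T})"
    by (intro compact_imp_bounded compact_continuous_image force_cont) auto
  then show ?thesis using that unfolding bounded_iff by (auto simp del: atLeastAtMost_iff)
qed

lemma impulse_deriv: "t \<in> {0..T} \<Longrightarrow> (impulse j has_real_derivative force j t) (at t within {0..T})"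
  unfolding impulse_def[abs_def] by (rule integral_has_real_derivative[OF force_cont])

lemma impulse_cont: "continuous_on {0..T} (impulse j)"
  using impulse_deriv by (rule DERIV_continuous_on)

lemma AE_interior: "AE t in M. 0 < t \<and> t < T"
proof -
  have "AE t in lebesgue. t \<noteq> 0 \<and> t \<noteq> T"
    using AE_not_in[of "{0, T}" lebesgue] by (simp add: negligible_iff_null_sets[symmetric])
  then show ?thesis by (auto simp: AE_restrict_space_iff elim: eventually_mono)
qed

text \<open>The primitive \<open>h\<close> of \<open>\<psi>\<close> vanishes at both ends because
  \<open>\<psi>\<close> has mean zero, so it is an admissible direction. Testing with both signs
  gives equality, and integration by parts replaces the force by its impulse.\<close>

lemma weak_euler_lagrange:
  assumes j: "j \<in> {1..N}" and \<psi> [measurable]: "\<psi> \<in> borel_measurable M"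
    and b: "\<And>t. t \<in> {0..T} \<Longrightarrow> (1 + L'_bound (vel j t)) * \<bar>\<psi> t\<bar> \<le> B"
    and zero: "(LINT t|M. \<psi> t) = 0"
  shows "(LINT t|M. (L' (vel j t) - impulse j t) * \<psi> t) = 0"
proof -
  have Lb0: "0 \<le> L'_bound v" for v unfolding L'_bound_def by simp
  have \<psi>b: "\<bar>\<psi> t\<bar> \<le> B" "L'_bound (vel j t) * \<bar>\<psi> t\<bar> \<le> B" if "t \<in> {0..T}" for t
    using b[OF that] mult_nonneg_nonneg[OF Lb0 abs_ge_zero, of "vel j t" "\<psi> t"]
    by (simp_all add: algebra_simps)
  have int: "integrable M \<psi>"
    by (rule M.integrable_const_bound[where B=B]) (use \<psi>b in \<open>auto intro!: AE_I2\<close>)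
  define h where "h t = integral {0..t} \<psi>" for t
  have h0: "h 0 = 0" by (simp add: h_def)
  have hT: "h T = 0"
    using zero lebesgue_integral_eq_integral[OF int] by (simp add: h_def)
  have h_lip: "B-lipschitz_on {0..T} h"
    unfolding h_def[abs_def] by (rule lipschitz_integral[OF int \<psi>b(1)])
  have "\<psi> integrable_on {0..T}"
    using int by (auto simp: set_integrable_def integrable_restrict_space intro!: set_lebesgue_integral_eq_integral(1))
  then have h_der: "AE t in M. (h has_real_derivative \<psi> t) (at t)"
    unfolding h_def[abs_def] by (rule AE_integral_has_derivative)
  have h_cont: "continuous_on {0..T} h" using h_lip lipschitz_on_continuous_on by blast
  have [measurable]: "h \<in> borel_measurable M" "force j \<in> borel_measurable M"
    "vel j \<in> borel_measurable M" "impulse j \<in> borel_measurable M"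
    using cont_borel_M[OF h_cont] cont_borel_M[OF force_cont] vel_borel[OF j] cont_borel_M[OF impulse_cont] by auto
  have L\<psi>: "integrable M (\<lambda>t. \<psi> t * L' (vel j t))"
  proof (rule M.integrable_const_bound[where B=B])
    show "AE t in M. norm (\<psi> t * L' (vel j t)) \<le> B"
    proof (rule AE_I2)
      fix t assume "t \<in> space M"
      then have t: "t \<in> {0..T}" by simp
      have "\<bar>\<psi> t\<bar> * \<bar>L' (vel j t)\<bar> \<le> \<bar>\<psi> t\<bar> * L'_bound (vel j t)"
        using L'_le_bound[of 0 "vel j t"] by (intro mult_left_mono) auto
      then show "norm (\<psi> t * L' (vel j t)) \<le> B"
        using \<psi>b(2)[OF t] by (simp add: abs_mult mult.commute)
    qed
  qed measurable
  have hF: "integrable M (\<lambda>t. h t * force j t)"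
    by (intro cont_integrable_M continuous_intros h_cont force_cont)
  have "0 \<le> (LINT t|M. \<psi> t * L' (vel j t) + h t * force j t)"
    by (rule first_variation_ineq[OF j h0 hT h_lip h_der \<psi> b])
  moreover have "0 \<le> (LINT t|M. - \<psi> t * L' (vel j t) + - h t * force j t)"
  proof (rule first_variation_ineq[OF j])
    show "B-lipschitz_on {0..T} (\<lambda>t. - h t)"
      using h_lip by (simp add: lipschitz_on_def dist_minus)
    show "AE t in M. ((\<lambda>t. - h t) has_real_derivative - \<psi> t) (at t)"
      using h_der by eventually_elim (rule DERIV_minus)
  qed (use h0 hT b in auto)
  ultimately have EL: "(LINT t|M. \<psi> t * L' (vel j t)) + (LINT t|M. h t * force j t) = 0"
    using L\<psi> hF by simp
  have I\<psi>: "integrable M (\<lambda>t. impulse j t * \<psi> t)"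
  proof -
    have "bounded (impulse j ` {0..T})"
      by (intro compact_imp_bounded compact_continuous_image impulse_cont) auto
    then obtain C where C: "\<And>t. t \<in> {0..T} \<Longrightarrow> \<bar>impulse j t\<bar> \<le> C"
      unfolding bounded_iff by (auto simp del: atLeastAtMost_iff)
    have "\<bar>impulse j t\<bar> * \<bar>\<psi> t\<bar> \<le> C * B" if "t \<in> {0..T}" for t
      using C[OF that] \<psi>b(1)[OF that] by (intro mult_mono) auto
    then show ?thesis
      by (intro M.integrable_const_bound[where B="C * B"]) (auto simp: abs_mult intro!: AE_I2)
  qed
  \<comment> \<open>The integrand is the derivative of \<open>impulse j t * h t\<close>, a Lipschitz
    function that vanishes at 0 and at \<open>T\<close>.\<close>
  have parts: "(LINT t|M. h t * force j t + impulse j t * \<psi> t) = 0"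
  proof -
    obtain C where C: "\<And>t. t \<in> {0..T} \<Longrightarrow> \<bar>force j t\<bar> \<le> C" using force_bounded by blast
    have W_lip: "C-lipschitz_on {0..T} (impulse j)"
      unfolding impulse_def[abs_def] by (rule lipschitz_integral[OF cont_integrable_M[OF force_cont] C])
    have BC: "0 \<le> B" "0 \<le> C" using h_lip W_lip lipschitz_on_nonneg by blast+
    have hb: "\<bar>h t\<bar> \<le> B * T" if "t \<in> {0..T}" for t
    proof -
      have "\<bar>h t\<bar> \<le> B * t" using lipschitz_onD[OF h_lip, of t 0] that h0 by (simp add: dist_real_def)
      also have "\<dots> \<le> B * T" using that BC by (simp add: mult_left_mono)
      finally show ?thesis .
    qed
    have Wb: "\<bar>impulse j t\<bar> \<le> C * T" if "t \<in> {0..T}" for t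
    proof -
      have "\<bar>impulse j t\<bar> \<le> C * t"
        using lipschitz_onD[OF W_lip, of t 0] that by (simp add: dist_real_def impulse_def)
      also have "\<dots> \<le> C * T" using that BC by (simp add: mult_left_mono)
      finally show ?thesis .
    qed
    have "(C * T * B + B * T * C)-lipschitz_on {0..T} (\<lambda>t. impulse j t * h t)"
    proof (rule lipschitz_onI)
      fix s t assume s: "s \<in> {0..T}" and t: "t \<in> {0..T}"
      have "impulse j s * h s - impulse j t * h t = impulse j s * (h s - h t) + h t * (impulse j s - impulse j t)"
        by (simp add: algebra_simps)
      then have "\<bar>impulse j s * h s - impulse j t * h t\<bar> \<le>
          \<bar>impulse j s\<bar> * \<bar>h s - h t\<bar> + \<bar>h t\<bar> * \<bar>impulse j s - impulse j t\<bar>"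
        by (metis abs_mult abs_triangle_ineq)
      also have "\<dots> \<le> (C * T) * (B * \<bar>s - t\<bar>) + (B * T) * (C * \<bar>s - t\<bar>)"
        using Wb[OF s] hb[OF t] lipschitz_onD[OF h_lip s t] lipschitz_onD[OF W_lip s t] BC T_pos
        by (intro add_mono mult_mono) (auto simp: dist_real_def)
      finally show "dist (impulse j s * h s) (impulse j t * h t) \<le> (C * T * B + B * T * C) * dist s t"
        by (simp add: dist_real_def algebra_simps)
    qed (use BC T_pos in simp)
    then have ac: "abs_continuous_on 0 T (\<lambda>t. impulse j t * h t)" by (rule lipschitz_imp_abs_continuous_on)
    have "AE t in M. ((\<lambda>t. impulse j t * h t) has_real_derivative h t * force j t + impulse j t * \<psi> t) (at t)"
      using h_der AE_interior
    proof eventually_elim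
      case (elim t)
      have "(impulse j has_real_derivative force j t) (at t)"
        using impulse_deriv[of t j] elim(2) by (simp add: at_within_Icc_at)
      from DERIV_mult[OF this elim(1)] show ?case by (simp add: add.commute mult.commute)
    qed
    from abs_continuous_on_integral_derivative[OF ac _ this] show ?thesis
      using T_pos h0 hT by simp
  qed
  have "(LINT t|M. (L' (vel j t) - impulse j t) * \<psi> t) =
      (LINT t|M. \<psi> t * L' (vel j t)) - (LINT t|M. impulse j t * \<psi> t)"
  proof -
    have "(L' (vel j t) - impulse j t) * \<psi> t = \<psi> t * L' (vel j t) - impulse j t * \<psi> t" for t
      by (simp add: algebra_simps)
    then show ?thesis using L\<psi> I\<psi> by simp
  qed
  also have "\<dots> = 0"
    using EL parts hF I\<psi> by simp
  finally show ?thesis .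
qed

text \<open>The classical test function, \<open>q\<close> minus its mean, may violate the growth
  bound on admissible \<open>\<psi>\<close>, and \<open>q\<close> need not have a mean. Multiplying
  by a positive weight and using the weighted mean repairs both, and orthogonality then says that a
  weighted variance of \<open>q\<close> is zero.\<close>

lemma euler_lagrange_AE:
  assumes j: "j \<in> {1..N}"
  obtains c where "AE t in M. L' (vel j t) = c + impulse j t"
proof -
  define q where "q t = L' (vel j t) - impulse j t" for t
  \<comment> \<open>The first factor is dictated by the growth bound in
    \<open>weak_euler_lagrange\<close>. The square bounds \<open>\<rho>\<close> times
    \<open>(1 + |q|)^2\<close>, which makes the weighted variance integrable.\<close>
  define \<rho> where "\<rho> t = 1 / ((1 + L'_bound (vel j t)) * (1 + \<bar>q t\<bar>)\<^sup>2)" for t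
  have [measurable]: "vel j \<in> borel_measurable M" "impulse j \<in> borel_measurable M"
    using vel_borel[OF j] cont_borel_M[OF impulse_cont] by auto
  have [measurable]: "q \<in> borel_measurable M" unfolding q_def by measurable
  have [measurable]: "\<rho> \<in> borel_measurable M" unfolding \<rho>_def by measurable
  have Lb0: "0 \<le> L'_bound v" for v unfolding L'_bound_def by simp
  have pos: "0 < 1 + L'_bound (vel j t)" "0 < 1 + \<bar>q t\<bar>" for t
    using Lb0[of "vel j t"] by linarith+
  have \<rho>pos: "0 < \<rho> t" for t unfolding \<rho>_def using pos[of t] by simp
  have \<rho>_eq: "(1 + L'_bound (vel j t)) * \<rho> t * (1 + \<bar>q t\<bar>)\<^sup>2 = 1" for t
    unfolding \<rho>_def using pos[of t] by simp
  have \<rho>q2: "\<rho> t * (1 + \<bar>q t\<bar>)\<^sup>2 \<le> 1" for t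
  proof -
    have "0 \<le> L'_bound (vel j t) * (\<rho> t * (1 + \<bar>q t\<bar>)\<^sup>2)"
      using Lb0 \<rho>pos[of t] by (intro mult_nonneg_nonneg) auto
    then show ?thesis using \<rho>_eq[of t] by (simp add: algebra_simps)
  qed
  have q_le: "1 + \<bar>q t\<bar> \<le> (1 + \<bar>q t\<bar>)\<^sup>2" for t
    by (simp add: power2_eq_square algebra_simps)
  have \<rho>q1: "\<rho> t * (1 + \<bar>q t\<bar>) \<le> 1" for t
    using mult_left_mono[OF q_le[of t], of "\<rho> t"] \<rho>pos[of t] \<rho>q2[of t] by linarith
  have \<rho>1: "\<rho> t \<le> 1" for t
  proof -
    have "0 \<le> \<rho> t * \<bar>q t\<bar>" using \<rho>pos[of t] by simp
    then show ?thesis using \<rho>q1[of t] by (simp add: algebra_simps)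
  qed
  have \<rho>int: "integrable M \<rho>"
    by (rule M.integrable_const_bound[where B=1]) (use \<rho>1 \<rho>pos in \<open>auto intro!: AE_I2 simp: abs_of_pos\<close>)
  have \<rho>q_le: "\<bar>\<rho> t * q t\<bar> \<le> 1" for t
    using \<rho>q1[of t] \<rho>pos[of t] by (simp add: abs_mult algebra_simps)
  have \<rho>qint: "integrable M (\<lambda>t. \<rho> t * q t)"
    by (rule M.integrable_const_bound[where B=1]) (use \<rho>q_le in \<open>auto intro!: AE_I2\<close>)
  have I\<rho>: "(LINT t|M. \<rho> t) \<noteq> 0"
  proof
    assume "(LINT t|M. \<rho> t) = 0"
    then have "AE t in M. \<rho> t = 0"
      using integral_nonneg_eq_0_iff_AE[OF \<rho>int] \<rho>pos by (simp add: less_imp_le)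
    then have "AE t in M. False" using \<rho>pos by (simp add: less_le)
    then have "emeasure M (space M) = 0"
      unfolding ae_filter_eq_bot_iff[symmetric] trivial_limit_def .
    then show False using T_pos by (simp add: emeasure_restrict_space)
  qed
  \<comment> \<open>The weighted mean is exactly the constant for which \<open>\<psi>\<close> has
    mean zero; the denominator is non-zero because \<open>\<rho>\<close> is positive on a set of
    positive measure.\<close>
  define c where "c = (LINT t|M. \<rho> t * q t) / (LINT t|M. \<rho> t)"
  define \<psi> where "\<psi> t = \<rho> t * (q t - c)" for t
  have [measurable]: "\<psi> \<in> borel_measurable M" unfolding \<psi>_def by measurable
  have qc: "\<bar>q t - c\<bar> \<le> (1 + \<bar>c\<bar>) * (1 + \<bar>q t\<bar>)" for t
  proof -
    have "(1 + \<bar>c\<bar>) * (1 + \<bar>q t\<bar>) = 1 + \<bar>c\<bar> + \<bar>q t\<bar> + \<bar>c\<bar> * \<bar>q t\<bar>"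
      by (simp add: algebra_simps)
    moreover have "0 \<le> \<bar>c\<bar> * \<bar>q t\<bar>" by simp
    ultimately show ?thesis by linarith
  qed
  have zero: "(LINT t|M. \<psi> t) = 0"
  proof -
    have "(LINT t|M. \<psi> t) = (LINT t|M. \<rho> t * q t) - c * (LINT t|M. \<rho> t)"
      unfolding \<psi>_def using \<rho>int \<rho>qint by (simp add: right_diff_distrib mult.commute)
    then show ?thesis using I\<rho> by (simp add: c_def)
  qed
  have "(1 + L'_bound (vel j t)) * \<bar>\<psi> t\<bar> \<le> 1 + \<bar>c\<bar>" for t
  proof -
    have "(1 + L'_bound (vel j t)) * \<bar>\<psi> t\<bar> = (1 + L'_bound (vel j t)) * \<rho> t * \<bar>q t - c\<bar>"
      using \<rho>pos[of t] by (simp add: \<psi>_def abs_mult)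
    also have "\<dots> \<le> (1 + L'_bound (vel j t)) * \<rho> t * ((1 + \<bar>c\<bar>) * (1 + \<bar>q t\<bar>)\<^sup>2)"
    proof (rule mult_left_mono)
      show "\<bar>q t - c\<bar> \<le> (1 + \<bar>c\<bar>) * (1 + \<bar>q t\<bar>)\<^sup>2"
        using qc[of t] mult_left_mono[OF q_le[of t], of "1 + \<bar>c\<bar>"] by linarith
      show "0 \<le> (1 + L'_bound (vel j t)) * \<rho> t" using pos(1)[of t] \<rho>pos[of t] by simp
    qed
    also have "\<dots> = (1 + \<bar>c\<bar>) * ((1 + L'_bound (vel j t)) * \<rho> t * (1 + \<bar>q t\<bar>)\<^sup>2)"
      by (simp add: algebra_simps)
    also have "\<dots> = 1 + \<bar>c\<bar>" unfolding \<rho>_eq by simp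
    finally show ?thesis .
  qed
  then have orth: "(LINT t|M. q t * \<psi> t) = 0"
    unfolding q_def by (intro weak_euler_lagrange[OF j _ _ zero]) auto
  have sq_le: "\<rho> t * (q t - c)\<^sup>2 \<le> (1 + \<bar>c\<bar>)\<^sup>2" for t
  proof -
    have "\<bar>q t - c\<bar>\<^sup>2 \<le> ((1 + \<bar>c\<bar>) * (1 + \<bar>q t\<bar>))\<^sup>2" using qc by (intro power_mono) auto
    then have "\<rho> t * (q t - c)\<^sup>2 \<le> \<rho> t * ((1 + \<bar>c\<bar>) * (1 + \<bar>q t\<bar>))\<^sup>2"
      using \<rho>pos[of t] by (intro mult_left_mono) auto
    also have "\<dots> = (1 + \<bar>c\<bar>)\<^sup>2 * (\<rho> t * (1 + \<bar>q t\<bar>)\<^sup>2)" by (simp add: power_mult_distrib)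
    also have "\<dots> \<le> (1 + \<bar>c\<bar>)\<^sup>2 * 1" using \<rho>q2[of t] by (intro mult_left_mono) auto
    finally show ?thesis by simp
  qed
  have sq_int: "integrable M (\<lambda>t. \<rho> t * (q t - c)\<^sup>2)"
    by (rule M.integrable_const_bound[where B="(1 + \<bar>c\<bar>)\<^sup>2"])
       (use sq_le \<rho>pos in \<open>auto intro!: AE_I2 simp: abs_mult abs_of_pos\<close>)
  have \<psi>int: "integrable M \<psi>"
    unfolding \<psi>_def right_diff_distrib using \<rho>int \<rho>qint by (simp add: mult.commute)
  \<comment> \<open>Since \<open>\<psi>\<close> has mean zero, \<open>q\<close> may be replaced by
    \<open>q - c\<close> in the orthogonality relation, and a non-negative integrand with integral
    zero remains.\<close>
  have "(LINT t|M. \<rho> t * (q t - c)\<^sup>2) + c * (LINT t|M. \<psi> t) = (LINT t|M. q t * \<psi> t)"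
  proof -
    have "q t * \<psi> t = \<rho> t * (q t - c)\<^sup>2 + c * \<psi> t" for t
      unfolding \<psi>_def by (simp add: power2_eq_square algebra_simps)
    then show ?thesis using sq_int \<psi>int by simp
  qed
  then have "(LINT t|M. \<rho> t * (q t - c)\<^sup>2) = 0" using orth zero by simp
  then have "AE t in M. \<rho> t * (q t - c)\<^sup>2 = 0"
    using integral_nonneg_eq_0_iff_AE[OF sq_int] \<rho>pos by (simp add: less_imp_le)
  then have "AE t in M. L' (vel j t) = c + impulse j t"
  proof eventually_elim
    case (elim t)
    then have "q t = c" using \<rho>pos[of t] by simp
    then show ?case by (simp add: q_def algebra_simps)
  qed
  then show ?thesis using that by blast
qed

section \<open>Inversion of the momentum map and regularity of the trajectories\<close>

lemma L'_strict: "u < v \<Longrightarrow> L' u < L' v"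
  using L'_mono[of u v] \<theta>_pos mult_pos_pos[of \<theta> "v - u"] by linarith

lemma L'_inj: "L' u = L' v \<longleftrightarrow> u = v"
  using L'_strict by (metis less_irrefl linorder_cases)

lemma L'_surj: "\<exists>u. L' u = p"
proof -
  \<comment> \<open>\<open>L'\<close> grows with slope at least \<open>\<theta>\<close>, so it
    reaches the level \<open>p\<close> within this distance of 0.\<close>
  define R where "R = \<bar>p - L' 0\<bar> / \<theta>"
  have R: "R \<ge> 0" "\<theta> * R = \<bar>p - L' 0\<bar>" using \<theta>_pos by (auto simp: R_def)
  have "p \<le> L' R" using L'_mono[of 0 R] R by simp
  moreover have "L' (- R) \<le> p" using L'_mono[of "- R" 0] R by simp
  ultimately show ?thesis
    using IVT[of L' "- R" p R] R(1) DERIV_isCont[OF L'_deriv] by auto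
qed

text \<open>Strong monotonicity makes \<open>L'\<close> minus a multiple of the identity
  non-decreasing, so in fact \<open>L''\<close> is at least \<open>\<theta>\<close>.\<close>

lemma L''_pos: "0 < L'' u"
proof -
  have d: "((\<lambda>v. L' v - \<theta> * v) has_real_derivative L'' u - \<theta>) (at u)"
    by (auto intro!: derivative_eq_intros L'_deriv)
  have "mono (\<lambda>v. L' v - \<theta> * v)"
    using L'_mono by (intro monoI) (simp add: algebra_simps)
  then have "0 \<le> L'' u - \<theta>"
    using mono_on_imp_deriv_nonneg[of UNIV "\<lambda>v. L' v - \<theta> * v", OF _ d] by simp
  then show ?thesis using \<theta>_pos by simp
qed

text \<open>Applying the inverse \<open>\<Lambda>\<close> of \<open>L'\<close> to the integrated
  equation produces a continuous representative \<open>v\<close> of the velocity. It is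
  differentiable, since \<open>\<Lambda>\<close> is and the impulse is a primitive of a continuous
  function.\<close>

theorem newton_equations:
  assumes j: "j \<in> {1..N}"
  obtains v where "\<And>t. 0 < t \<Longrightarrow> t < T \<Longrightarrow> ((\<lambda>t. x t j) has_real_derivative v t) (at t)"
    "\<And>t. 0 < t \<Longrightarrow> t < T \<Longrightarrow> (v has_real_derivative force j t / L'' (v t)) (at t)"
proof -
  obtain c where c: "AE t in M. L' (vel j t) = c + impulse j t" using euler_lagrange_AE[OF j] by blast
  define \<Lambda> where "\<Lambda> = inv L'"
  have \<Lambda>: "L' (\<Lambda> p) = p" for p unfolding \<Lambda>_def using L'_surj by (metis f_inv_into_f rangeI)
  have \<Lambda>': "\<Lambda> (L' u) = u" for u using \<Lambda>[of "L' u"] L'_inj by blast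
  have \<Lambda>_cont: "isCont \<Lambda> p" for p
    using isCont_inverse_function[of 1 "\<Lambda> p" \<Lambda> L'] \<Lambda> \<Lambda>' DERIV_isCont[OF L'_deriv] by simp
  have \<Lambda>_deriv: "(\<Lambda> has_real_derivative inverse (L'' (\<Lambda> p))) (at p)" for p
    by (rule DERIV_inverse_function[where f=L' and a="p - 1" and b="p + 1"])
       (use L'_deriv L''_pos[of "\<Lambda> p"] \<Lambda> \<Lambda>_cont in auto)
  define v where "v t = \<Lambda> (c + impulse j t)" for t
  have "continuous_on UNIV \<Lambda>" using \<Lambda>_cont continuous_at_imp_continuous_on by blast
  moreover have "continuous_on {0..T} (\<lambda>t. c + impulse j t)"
    by (intro continuous_on_add continuous_on_const impulse_cont)
  ultimately have v_cont: "continuous_on {0..T} v"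
    unfolding v_def[abs_def] by (rule continuous_on_compose2) simp
  have "AE t in M. vel j t = v t"
    using c
  proof eventually_elim
    case (elim t)
    then show ?case using \<Lambda>'[of "vel j t"] by (simp add: v_def)
  qed
  then have "AE t in lebesgue. t \<in> {0..T} \<longrightarrow> vel j t = v t" by (simp add: AE_restrict_space_iff)
  then obtain Z where Z: "Z \<in> null_sets lebesgue" "{t. \<not> (t \<in> {0..T} \<longrightarrow> vel j t = v t)} \<subseteq> Z"
    by (auto simp: eventually_ae_filter)
  then have "negligible Z" by (simp add: negligible_iff_null_sets)
  \<comment> \<open>Changing the velocity on a null set leaves the path unchanged, so the particle
    position is the integral of a continuous function and is differentiable at every interior
    time.\<close>
  then have int_eq: "integral {0..t} (vel j) = integral {0..t} v" if "t \<in> {0..T}" for t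
    by (rule integral_spike) (use Z(2) that in auto)
  have der: "((\<lambda>t. x t j) has_real_derivative v t) (at t)" if t: "0 < t" "t < T" for t
  proof -
    have "((\<lambda>t. integral {0..t} v) has_real_derivative v t) (at t within {0..T})"
      using integral_has_real_derivative[OF v_cont, of t] t by simp
    then have "((\<lambda>t. integral {0..t} v) has_real_derivative v t) (at t)"
      using t by (simp add: at_within_Icc_at)
    then have "((\<lambda>t. x 0 j + integral {0..t} v) has_real_derivative v t) (at t)"
      by (auto intro!: derivative_eq_intros)
    then show ?thesis
    proof (rule has_field_derivative_transform_within_open[where S="{0<..<T}"])
      fix s assume "s \<in> {0<..<T}"
      then have "s \<in> {0..T}" by simp
      then show "x 0 j + integral {0..s} v = x s j"
        using int_eq[of s] x_eq_integral[OF j, of s] by linarith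
    qed (use t in auto)
  qed
  have "(v has_real_derivative force j t / L'' (v t)) (at t)" if t: "0 < t" "t < T" for t
  proof -
    have "(impulse j has_real_derivative force j t) (at t)"
      using impulse_deriv[of t j] t by (simp add: at_within_Icc_at)
    then have "((\<lambda>t. c + impulse j t) has_real_derivative force j t) (at t)"
      by (auto intro!: derivative_eq_intros)
    from DERIV_chain2[OF \<Lambda>_deriv this]
    show ?thesis by (simp add: v_def[abs_def] divide_inverse mult.commute)
  qed
  with der show ?thesis using that by blast
qed

end

section \<open>Convexity along minimizers\<close>

text \<open>Derivatives are at hand in the open interval only, so the ends are reached by continuity
  and the mean value theorem: a value above both ends would produce a positive slope followed by a
  negative one, although \<open>f'\<close> is non-decreasing.\<close>

lemma le_max_endpoints_if_convex:
  fixes f f' f'' :: "real \<Rightarrow> real"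
  assumes cont: "continuous_on {0..T} f"
    and f': "\<And>t. 0 < t \<Longrightarrow> t < T \<Longrightarrow> (f has_real_derivative f' t) (at t)"
    and f'': "\<And>t. 0 < t \<Longrightarrow> t < T \<Longrightarrow> (f' has_real_derivative f'' t) (at t)"
    and nonneg: "\<And>t. 0 < t \<Longrightarrow> t < T \<Longrightarrow> 0 \<le> f'' t"
    and t: "t \<in> {0..T}"
  shows "f t \<le> max (f 0) (f T)"
proof (rule ccontr)
  assume "\<not> ?thesis"
  then have gt: "f 0 < f t" "f T < f t" by auto
  then have t': "0 < t" "t < T" using t by (auto simp: less_le)
  have d: "f differentiable (at s)" if "0 < s" "s < T" for s
    using f'[OF that] real_differentiable_def by blast
  obtain l r where r: "0 < r" "r < t" "(f has_real_derivative l) (at r)" "f t - f 0 = (t - 0) * l"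
    using MVT[of 0 t f] t' d continuous_on_subset[OF cont, of "{0..t}"] by auto
  obtain l2 s where s: "t < s" "s < T" "(f has_real_derivative l2) (at s)" "f T - f t = (T - t) * l2"
    using MVT[of t T f] t' d continuous_on_subset[OF cont, of "{t..T}"] by auto
  have "l = f' r" "l2 = f' s" using r s f' t' by (auto intro: DERIV_unique)
  moreover have "f' r \<le> f' s"
  proof (rule DERIV_nonneg_imp_nondecreasing[of r s f'])
    fix y assume "r \<le> y" "y \<le> s"
    then have "0 < y" "y < T" using r s by auto
    then show "\<exists>z. (f' has_real_derivative z) (at y) \<and> 0 \<le> z" using f'' nonneg by blast
  qed (use r s in simp)
  moreover have "0 < l" using r(4) gt t' by (metis diff_gt_0_iff_gt diff_zero zero_less_mult_pos)
  moreover have "l2 < 0"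
  proof (rule ccontr)
    assume "\<not> l2 < 0"
    then have "0 \<le> (T - t) * l2" using t' by simp
    then show False using s(4) gt by linarith
  qed
  ultimately show False by linarith
qed

section \<open>Time convexity of functionals of the gaps\<close>

context particle_minimizer
begin

text \<open>Particle \<open>j\<close> bounds just two gaps, its own and that of its cyclic successor
  \<open>k\<close>. For a single particle \<open>k = j\<close> and both sides vanish.\<close>

lemma sum_incidence:
  assumes j: "j \<in> {1..N}"
  obtains k where "k \<in> {1..N}" "\<And>f. (\<Sum>i=1..N. incidence j i * f i) = f j - f k"
proof -
  obtain k where k: "k \<in> {1..N}" "prev_index N k = j"
    using bij_prev_index[of N] j unfolding bij_betw_def by (metis imageE)
  have eq: "prev_index N i = j \<longleftrightarrow> i = k" if "i \<in> {1..N}" for i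
    using bij_prev_index[of N] k that unfolding bij_betw_def inj_on_def by blast
  have "(\<Sum>i=1..N. incidence j i * f i) = f j - f k" for f :: "nat \<Rightarrow> real"
  proof -
    have "(\<Sum>i=1..N. incidence j i * f i) = (\<Sum>i=1..N. (if i = j then f i else 0) - (if i = k then f i else 0))"
      using eq by (intro sum.cong) (auto simp: incidence_def)
    also have "\<dots> = f j - f k" using j k(1) by (simp add: sum_subtractf sum.delta)
    finally show ?thesis .
  qed
  then show ?thesis using that k(1) by blast
qed

text \<open>Summation by parts from gaps to particles. Every acceleration carries the factor
  \<open>1 / L''\<close> at its own velocity, so differences of neighbouring accelerations have no
  evident sign; grouped by particle, each acceleration meets the corresponding gradient component,
  and a positive factor is harmless.\<close>

lemma sum_difference_eq_sum_incidence:
  "(\<Sum>i=1..N. f i * (a i - a (prev_index N i))) = (\<Sum>j=1..N. a j * (\<Sum>i=1..N. incidence j i * f i))"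
proof -
  have "(\<Sum>j=1..N. a j * incidence j i) = a i - a (prev_index N i)" if "i \<in> {1..N}" for i
  proof -
    have "(\<Sum>j=1..N. a j * incidence j i) =
        (\<Sum>j=1..N. (if j = i then a j else 0) - (if j = prev_index N i then a j else 0))"
      by (intro sum.cong) (auto simp: incidence_def)
    also have "\<dots> = a i - a (prev_index N i)"
      using that prev_index_in[OF that] by (simp add: sum_subtractf sum.delta)
    finally show ?thesis .
  qed
  then have "(\<Sum>i=1..N. f i * (a i - a (prev_index N i))) = (\<Sum>i=1..N. \<Sum>j=1..N. f i * (a j * incidence j i))"
    by (intro sum.cong) (auto simp: sum_distrib_left[symmetric])
  also have "\<dots> = (\<Sum>j=1..N. \<Sum>i=1..N. f i * (a j * incidence j i))" by (rule sum.swap)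
  also have "\<dots> = (\<Sum>j=1..N. a j * (\<Sum>i=1..N. incidence j i * f i))"
    by (simp add: sum_distrib_left mult_ac)
  finally show ?thesis .
qed

text \<open>The internal forces and the gradient of \<open>\<Sum>\<^sub>i \<phi> (gap\<^sub>i)\<close> are both of the form \<open>f (gap\<^sub>j) - f (gap\<^sub>k)\<close>
  for the two gaps adjacent to the particle \<open>j\<close>, with \<open>f\<close> non-decreasing; hence the acceleration term in
  the second derivative is non-negative.\<close>

theorem sum_gap_le_max_endpoints:
  assumes \<phi>: "\<And>r. r > 0 \<Longrightarrow> (\<phi> has_real_derivative \<phi>' r) (at r)"
    and \<phi>': "\<And>r. r > 0 \<Longrightarrow> (\<phi>' has_real_derivative \<phi>'' r) (at r)"
    and \<phi>'': "\<And>r. r > 0 \<Longrightarrow> 0 \<le> \<phi>'' r"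
    and t: "t \<in> {0..T}"
  shows "(\<Sum>i=1..N. \<phi> (gap N (x t) i)) \<le>
    max (\<Sum>i=1..N. \<phi> (gap N (x 0) i)) (\<Sum>i=1..N. \<phi> (gap N (x T) i))"
proof -
  have "\<exists>v. \<forall>t. 0 < t \<and> t < T \<longrightarrow> ((\<lambda>t. x t j) has_real_derivative v t) (at t) \<and>
      (v has_real_derivative force j t / L'' (v t)) (at t)" if "j \<in> {1..N}" for j
    using newton_equations[OF that] by metis
  then obtain v where v: "\<And>j t. j \<in> {1..N} \<Longrightarrow> 0 < t \<Longrightarrow> t < T \<Longrightarrow> ((\<lambda>t. x t j) has_real_derivative v j t) (at t)"
    "\<And>j t. j \<in> {1..N} \<Longrightarrow> 0 < t \<Longrightarrow> t < T \<Longrightarrow> (v j has_real_derivative force j t / L'' (v j t)) (at t)"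
    by metis
  define g where "g i t = gap N (x t) i" for i t
  define a where "a j t = force j t / L'' (v j t)" for j t
  have g_pos: "g i t > 0" if "i \<in> {1..N}" "t \<in> {0..T}" for i t
    using gap_pos that by (simp add: g_def)
  have g_der: "(g i has_real_derivative v i t - v (prev_index N i) t) (at t)"
    if "i \<in> {1..N}" "0 < t" "t < T" for i t
    unfolding g_def[abs_def] gap_eq[OF that(1)]
    using DERIV_add[OF DERIV_diff[OF v(1)[OF that] v(1)[OF prev_index_in[OF that(1)] that(2,3)]] DERIV_const]
    by simp
  have \<phi>'_mono: "\<phi>' r \<le> \<phi>' s" if "0 < r" "r \<le> s" for r s
  proof (rule DERIV_nonneg_imp_nondecreasing[of r s \<phi>', OF that(2)])
    fix y assume "r \<le> y" "y \<le> s"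
    then have "0 < y" using that by simp
    then show "\<exists>z. (\<phi>' has_real_derivative z) (at y) \<and> 0 \<le> z" using \<phi>' \<phi>'' by blast
  qed
  have "(\<lambda>t. \<Sum>i=1..N. \<phi> (g i t)) t \<le> max (\<Sum>i=1..N. \<phi> (g i 0)) (\<Sum>i=1..N. \<phi> (g i T))"
  proof (rule le_max_endpoints_if_convex[OF _ _ _ _ t])
    show "continuous_on {0..T} (\<lambda>t. \<Sum>i=1..N. \<phi> (g i t))"
      unfolding g_def using \<phi> DERIV_isCont
      by (intro continuous_on_sum cont_gap_comp[OF collision_free_x] continuous_at_imp_continuous_on) blast+
    fix t assume t: "0 < t" "t < T"
    then have tT: "t \<in> {0..T}" by simp
    have gp: "g i t > 0" if "i \<in> {1..N}" for i using g_pos[OF that tT] .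
    show "((\<lambda>t. \<Sum>i=1..N. \<phi> (g i t)) has_real_derivative
        (\<Sum>i=1..N. \<phi>' (g i t) * (v i t - v (prev_index N i) t))) (at t)"
      by (intro DERIV_sum DERIV_chain2[OF \<phi>] gp g_der t)
    show "((\<lambda>t. \<Sum>i=1..N. \<phi>' (g i t) * (v i t - v (prev_index N i) t)) has_real_derivative
        (\<Sum>i=1..N. \<phi>'' (g i t) * (v i t - v (prev_index N i) t) * (v i t - v (prev_index N i) t) +
           (a i t - a (prev_index N i) t) * \<phi>' (g i t))) (at t)"
      unfolding a_def
      by (intro DERIV_sum DERIV_mult DERIV_diff DERIV_chain2[OF \<phi>'] gp g_der v(2) t prev_index_in)
    have "0 \<le> a j t * (\<Sum>i=1..N. incidence j i * \<phi>' (g i t))" if j: "j \<in> {1..N}" for j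
    proof -
      obtain k where k: "k \<in> {1..N}" "\<And>f. (\<Sum>i=1..N. incidence j i * f i) = f j - f k"
        using sum_incidence[OF j] by blast
      have F: "force j t = \<Gamma>' (g j t) - \<Gamma>' (g k t)"
        unfolding force_def g_def by (rule k(2))
      have "0 \<le> (\<Gamma>' (g j t) - \<Gamma>' (g k t)) * (\<phi>' (g j t) - \<phi>' (g k t))"
      proof (cases "g j t \<le> g k t")
        case True
        then show ?thesis
          using \<Gamma>'_mono[OF gp[OF j] True] \<phi>'_mono[OF gp[OF j] True] by (intro mult_nonpos_nonpos) auto
      next
        case False
        then have le: "g k t \<le> g j t" by simp
        then show ?thesis
          using \<Gamma>'_mono[OF gp[OF k(1)] le] \<phi>'_mono[OF gp[OF k(1)] le] by (intro mult_nonneg_nonneg) auto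
      qed
      then have "0 \<le> force j t * (\<Sum>i=1..N. incidence j i * \<phi>' (g i t))" unfolding F k(2) .
      then show ?thesis using L''_pos[of "v j t"] unfolding a_def by (simp add: divide_nonneg_pos)
    qed
    then have "0 \<le> (\<Sum>j=1..N. a j t * (\<Sum>i=1..N. incidence j i * \<phi>' (g i t)))"
      by (rule sum_nonneg)
    then have "0 \<le> (\<Sum>i=1..N. \<phi>' (g i t) * (a i t - a (prev_index N i) t))"
      using sum_difference_eq_sum_incidence[of "\<lambda>i. \<phi>' (g i t)" "\<lambda>i. a i t"] by simp
    moreover have "0 \<le> (\<Sum>i=1..N. \<phi>'' (g i t) * (v i t - v (prev_index N i) t)\<^sup>2)"
      by (intro sum_nonneg mult_nonneg_nonneg \<phi>'' gp) auto
    ultimately show "0 \<le> (\<Sum>i=1..N. \<phi>'' (g i t) * (v i t - v (prev_index N i) t) * (v i t - v (prev_index N i) t) +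
           (a i t - a (prev_index N i) t) * \<phi>' (g i t))"
      by (simp add: sum.distrib power2_eq_square mult_ac)
  qed
  then show ?thesis by (simp add: g_def)
qed

text \<open>On a cell the discrete density is the constant \<open>(1/N) / gap\<close>, so its q-th
  power integrates to \<open>(1/N)^q * gap^(1-q)\<close>; this is where the exponent comes from. The
  second derivative carries the factor \<open>q * (q - 1)\<close>.\<close>

lemma sum_gap_powr_le:
  assumes "q \<ge> 1" "t \<in> {0..T}"
  shows "(\<Sum>i=1..N. gap N (x t) i powr (1 - q)) \<le>
    max (\<Sum>i=1..N. gap N (x 0) i powr (1 - q)) (\<Sum>i=1..N. gap N (x T) i powr (1 - q))"
proof (rule sum_gap_le_max_endpoints[OF _ _ _ assms(2)])
  fix r :: real assume r: "r > 0"
  show "((\<lambda>r. r powr (1 - q)) has_real_derivative (1 - q) * r powr (- q)) (at r)"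
    using has_real_derivative_powr[OF r, of "1 - q"] by simp
  have "((\<lambda>r. r powr (- q)) has_real_derivative (- q) * r powr (- q - 1)) (at r)"
    by (rule has_real_derivative_powr[OF r])
  from DERIV_cmult[OF this, of "1 - q"]
  show "((\<lambda>r. (1 - q) * r powr (- q)) has_real_derivative (1 - q) * (- q * r powr (- q - 1))) (at r)" .
  show "0 \<le> (1 - q) * (- q * r powr (- q - 1))"
    using assms(1) by (intro mult_nonpos_nonpos) auto
qed

end

section \<open>Norms of discrete densities\<close>

lemma nn_integral_lebesgue_shift:
  fixes f :: "real \<Rightarrow> ennreal"
  assumes "f \<in> borel_measurable lebesgue"
  shows "(\<integral>\<^sup>+u. f (c + u) \<partial>lebesgue) = (\<integral>\<^sup>+u. f u \<partial>lebesgue)"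
proof -
  have eq: "lebesgue = density (distr lebesgue lebesgue (\<lambda>u. c + 1 * u)) (\<lambda>_. ennreal \<bar>1\<bar>)"
    by (rule lebesgue_real_affine) simp
  have m: "(\<lambda>u. c + 1 * u) \<in> lebesgue \<rightarrow>\<^sub>M lebesgue"
    using lebesgue_affine_measurable[of "\<lambda>_. 1" c] by simp
  have "(\<integral>\<^sup>+u. f u \<partial>lebesgue) = (\<integral>\<^sup>+u. f u \<partial>distr lebesgue lebesgue (\<lambda>u. c + 1 * u))"
    by (subst eq) (simp add: density_1)
  also have "\<dots> = (\<integral>\<^sup>+u. f (c + 1 * u) \<partial>lebesgue)"
    by (rule nn_integral_distr[OF m]) (simp add: assms)
  finally show ?thesis by simp
qed

text \<open>Moving the window by at most one period trades \<open>{a..<b}\<close> for its translate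
  by 1. Unit steps treat integer positions, and one further step leads from the floor of
  \<open>c\<close> to \<open>c\<close>.\<close>

lemma nn_integral_periodic:
  fixes f :: "real \<Rightarrow> ennreal"
  assumes f [measurable]: "f \<in> borel_measurable lebesgue" and per: "one_periodic f"
  shows "(\<integral>\<^sup>+u\<in>{c..<c + 1}. f u \<partial>lebesgue) = (\<integral>\<^sup>+u\<in>{0..<1}. f u \<partial>lebesgue)"
proof -
  define F where "F c = (\<integral>\<^sup>+u\<in>{c..<c + 1}. f u \<partial>lebesgue)" for c
  have shift: "(\<integral>\<^sup>+u\<in>{a + 1..<b + 1}. f u \<partial>lebesgue) = (\<integral>\<^sup>+u\<in>{a..<b}. f u \<partial>lebesgue)" for a b
  proof -
    have "(\<integral>\<^sup>+u\<in>{a + 1..<b + 1}. f u \<partial>lebesgue) =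
        (\<integral>\<^sup>+u. f (1 + u) * indicator {a + 1..<b + 1} (1 + u) \<partial>lebesgue)"
      by (rule nn_integral_lebesgue_shift[symmetric])
         (intro borel_measurable_times_ennreal borel_measurable_indicator f, simp)
    also have "\<dots> = (\<integral>\<^sup>+u\<in>{a..<b}. f u \<partial>lebesgue)"
      using per by (intro nn_integral_cong) (auto simp: one_periodic_def add.commute split: split_indicator)
    finally show ?thesis .
  qed
  have split: "(\<integral>\<^sup>+u\<in>{a..<b}. f u \<partial>lebesgue) + (\<integral>\<^sup>+u\<in>{b..<d}. f u \<partial>lebesgue) =
      (\<integral>\<^sup>+u\<in>{a..<d}. f u \<partial>lebesgue)" if "a \<le> b" "b \<le> d" for a b d
  proof -
    have "(\<integral>\<^sup>+u\<in>{a..<d}. f u \<partial>lebesgue) =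
        (\<integral>\<^sup>+u. f u * indicator {a..<b} u + f u * indicator {b..<d} u \<partial>lebesgue)"
      using that by (intro nn_integral_cong) (auto split: split_indicator)
    also have "\<dots> = (\<integral>\<^sup>+u\<in>{a..<b}. f u \<partial>lebesgue) + (\<integral>\<^sup>+u\<in>{b..<d}. f u \<partial>lebesgue)"
      by (intro nn_integral_add borel_measurable_times_ennreal borel_measurable_indicator f) auto
    finally show ?thesis by simp
  qed
  have F_eq: "F a = F b" if "a \<le> b" "b \<le> a + 1" for a b
  proof -
    have "F a = (\<integral>\<^sup>+u\<in>{a..<b}. f u \<partial>lebesgue) + (\<integral>\<^sup>+u\<in>{b..<a + 1}. f u \<partial>lebesgue)"
      unfolding F_def using split[of a b "a + 1"] that by simp
    also have "\<dots> = (\<integral>\<^sup>+u\<in>{b..<a + 1}. f u \<partial>lebesgue) + (\<integral>\<^sup>+u\<in>{a + 1..<b + 1}. f u \<partial>lebesgue)"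
      by (subst shift) (rule add.commute)
    also have "\<dots> = F b"
      unfolding F_def using split[of b "a + 1" "b + 1"] that by simp
    finally show ?thesis .
  qed
  have "F (of_int k) = F 0" for k :: int
  proof (induction k rule: int_induct[where k=0])
    case (step1 i)
    then show ?case using F_eq[of "of_int i" "of_int i + 1"] by simp
  next
    case (step2 i)
    then show ?case using F_eq[of "of_int i - 1" "of_int i"] by simp
  qed simp
  moreover have "F (of_int \<lfloor>c\<rfloor>) = F c" by (intro F_eq) linarith+
  ultimately show ?thesis unfolding F_def by simp
qed

lemma nn_integral_circle:
  "f \<in> borel_measurable lebesgue \<Longrightarrow> (\<integral>\<^sup>+u. f u \<partial>circle_measure) = (\<integral>\<^sup>+u\<in>{0..<1}. f u \<partial>lebesgue)"
  unfolding circle_measure_def by (simp add: nn_integral_restrict_space)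

section \<open>Discrete densities of a collision-free configuration\<close>

context
  fixes N :: nat and y :: "nat \<Rightarrow> real"
  assumes N: "N \<ge> 1" and gap: "\<And>i. i \<in> {1..N} \<Longrightarrow> 0 < gap N y i"
begin

lemma pos_mono: "i \<le> k \<Longrightarrow> k \<le> N \<Longrightarrow> pos N y i \<le> pos N y k"
proof (induction k rule: dec_induct)
  case (step n)
  then show ?case using gap[of "Suc n"] by (simp add: gap_def)
qed simp

lemma pos_N: "pos N y N = pos N y 0 + 1"
  using N by (simp add: pos_def)

lemma sum_gap: "(\<Sum>i=1..N. gap N y i) = 1"
proof -
  have "(\<Sum>i=1..k. gap N y i) = pos N y k - pos N y 0" for k
    by (induction k) (auto simp: gap_def)
  then show ?thesis using pos_N by simp
qed

text \<open>The half-open cells tile a period starting at \<open>pos N y 0\<close>, which need not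
  be the fundamental domain \<open>{0..<1}\<close>; periodicity makes up for the difference.\<close>

lemma nn_integral_partition:
  assumes [measurable]: "f \<in> borel_measurable lebesgue" and per: "one_periodic f"
  shows "(\<Sum>i=1..N. \<integral>\<^sup>+u\<in>{pos N y (i - 1)..<pos N y i}. f u \<partial>lebesgue) = (\<integral>\<^sup>+u. f u \<partial>circle_measure)"
proof -
  have "(\<Sum>i=1..k. \<integral>\<^sup>+u\<in>{pos N y (i - 1)..<pos N y i}. f u \<partial>lebesgue) =
      (\<integral>\<^sup>+u\<in>{pos N y 0..<pos N y k}. f u \<partial>lebesgue)" if "k \<le> N" for k
    using that
  proof (induction k)
    case (Suc k)
    have le: "pos N y 0 \<le> pos N y k" "pos N y k \<le> pos N y (Suc k)"
      using pos_mono[of 0 k] pos_mono[of k "Suc k"] Suc.prems by auto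
    have "(\<integral>\<^sup>+u\<in>{pos N y 0..<pos N y (Suc k)}. f u \<partial>lebesgue) =
        (\<integral>\<^sup>+u. f u * indicator {pos N y 0..<pos N y k} u + f u * indicator {pos N y k..<pos N y (Suc k)} u \<partial>lebesgue)"
      using le by (intro nn_integral_cong) (auto split: split_indicator)
    also have "\<dots> = (\<integral>\<^sup>+u\<in>{pos N y 0..<pos N y k}. f u \<partial>lebesgue) +
        (\<integral>\<^sup>+u\<in>{pos N y k..<pos N y (Suc k)}. f u \<partial>lebesgue)"
      by (intro nn_integral_add borel_measurable_times_ennreal borel_measurable_indicator assms(1)) auto
    finally show ?case using Suc by simp
  qed simp
  then have "(\<Sum>i=1..N. \<integral>\<^sup>+u\<in>{pos N y (i - 1)..<pos N y i}. f u \<partial>lebesgue) =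
      (\<integral>\<^sup>+u\<in>{pos N y 0..<pos N y 0 + 1}. f u \<partial>lebesgue)" using pos_N by simp
  then show ?thesis using nn_integral_periodic[OF assms] nn_integral_circle[OF assms(1)] by simp
qed

lemma discrete_density_borel [measurable]: "discrete_density N y \<in> borel_measurable borel"
proof -
  have "(\<lambda>u. of_bool (\<exists>k::int. u + of_int k \<in> {a..<b}) :: real) = indicator (\<Union>k::int. {a - of_int k..<b - of_int k})" for a b :: real
    by (rule ext) (auto simp: indicator_def algebra_simps)
  then show ?thesis unfolding discrete_density_def[abs_def] by simp
qed

lemma discrete_density_periodic: "one_periodic (discrete_density N y)"
proof -
  have "(\<exists>k::int. u + 1 + of_int k \<in> A) \<longleftrightarrow> (\<exists>k::int. u + of_int k \<in> A)" for u :: real and A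
  proof
    assume "\<exists>k::int. u + 1 + of_int k \<in> A"
    then obtain k :: int where "u + 1 + of_int k \<in> A" by blast
    then show "\<exists>k::int. u + of_int k \<in> A" by (intro exI[of _ "k + 1"]) (simp add: algebra_simps)
  next
    assume "\<exists>k::int. u + of_int k \<in> A"
    then obtain k :: int where "u + of_int k \<in> A" by blast
    then show "\<exists>k::int. u + 1 + of_int k \<in> A" by (intro exI[of _ "k - 1"]) simp
  qed
  note eq = this
  show ?thesis unfolding one_periodic_def discrete_density_def eq by simp
qed

text \<open>All cells lie in one half-open period, where two points differing by an integer
  coincide. So only the translate by 0 counts, and half-open cells are disjoint.\<close>

lemma discrete_density_eq:
  assumes i: "i \<in> {1..N}" and u: "u \<in> {pos N y (i - 1)..<pos N y i}"
  shows "discrete_density N y u = (1 / real N) / gap N y i"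
proof -
  have iff: "(\<exists>k::int. u + of_int k \<in> {pos N y (l - 1)..<pos N y l}) \<longleftrightarrow> l = i" if l: "l \<in> {1..N}" for l
  proof
    assume "\<exists>k::int. u + of_int k \<in> {pos N y (l - 1)..<pos N y l}"
    then obtain k :: int where k: "u + of_int k \<in> {pos N y (l - 1)..<pos N y l}" by blast
    have "pos N y 0 \<le> u + of_int k" "u + of_int k < pos N y 0 + 1"
      using k pos_mono[of 0 "l - 1"] pos_mono[of l N] pos_N l by fastforce+
    moreover have "pos N y 0 \<le> u" "u < pos N y 0 + 1"
      using u pos_mono[of 0 "i - 1"] pos_mono[of i N] pos_N i by fastforce+
    ultimately have "\<bar>of_int k :: real\<bar> < 1" by linarith
    then have "k = 0" by linarith
    then have k0: "u \<in> {pos N y (l - 1)..<pos N y l}" using k by simp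
    show "l = i"
    proof (rule linorder_cases[of l i])
      assume "l < i"
      then have "pos N y l \<le> pos N y (i - 1)" using i by (intro pos_mono) auto
      then show ?thesis using k0 u by auto
    next
      assume "i < l"
      then have "pos N y i \<le> pos N y (l - 1)" using l by (intro pos_mono) auto
      then show ?thesis using k0 u by auto
    qed
  next
    assume "l = i"
    then show "\<exists>k::int. u + of_int k \<in> {pos N y (l - 1)..<pos N y l}"
      using u by (intro exI[of _ 0]) simp
  qed
  have "discrete_density N y u = (\<Sum>l=1..N. if l = i then (1 / real N) / gap N y l else 0)"
    unfolding discrete_density_def using iff by (intro sum.cong) auto
  then show ?thesis using i by (simp add: sum.delta)
qed

lemma discrete_density_cases:
  obtains i where "i \<in> {1..N}" "discrete_density N y u = (1 / real N) / gap N y i"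
proof -
  define a where "a = pos N y 0"
  \<comment> \<open>The representative of \<open>u\<close> in the period that the cells
    tile.\<close>
  define w where "w = u - of_int \<lfloor>u - a\<rfloor>"
  have per: "discrete_density N y (w + of_int k) = discrete_density N y w" for k :: int
  proof (induction k rule: int_induct[where k=0])
    case (step1 k)
    then show ?case
      using discrete_density_periodic[unfolded one_periodic_def, rule_format, of "w + of_int k"]
      by (simp add: add.assoc)
  next
    case (step2 k)
    then show ?case
      using discrete_density_periodic[unfolded one_periodic_def, rule_format, of "w + of_int k - 1"]
      by (simp add: algebra_simps)
  qed simp
  have "a \<le> w" "w < a + 1" unfolding w_def by linarith+
  then have "\<exists>i\<in>{1..N}. w \<in> {pos N y (i - 1)..<pos N y i}"
  proof -
    have "w < pos N y k \<Longrightarrow> k \<le> N \<Longrightarrow> \<exists>i\<in>{1..N}. w \<in> {pos N y (i - 1)..<pos N y i}" for k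
    proof (induction k)
      case 0
      then show ?case using \<open>a \<le> w\<close> by (simp add: a_def)
    next
      case (Suc k)
      then show ?case by (cases "w < pos N y k") (auto intro!: bexI[of _ "Suc k"])
    qed
    from this[of N] show ?thesis using \<open>w < a + 1\<close> pos_N by (simp add: a_def)
  qed
  then obtain i where "i \<in> {1..N}" "discrete_density N y w = (1 / real N) / gap N y i"
    using discrete_density_eq by blast
  moreover have "discrete_density N y u = discrete_density N y w"
    using per[of "\<lfloor>u - a\<rfloor>"] by (simp add: w_def)
  ultimately show ?thesis using that by simp
qed

lemma nn_integral_discrete_density_powr:
  "(\<integral>\<^sup>+u. ennreal (\<bar>discrete_density N y u\<bar> powr q) \<partial>circle_measure) =
     ennreal ((1 / real N) powr q * (\<Sum>i=1..N. gap N y i powr (1 - q)))"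
proof -
  have meas: "(\<lambda>u. ennreal (\<bar>discrete_density N y u\<bar> powr q)) \<in> borel_measurable lebesgue"
    by (intro measurable_completion) simp
  have "(\<integral>\<^sup>+u. ennreal (\<bar>discrete_density N y u\<bar> powr q) \<partial>circle_measure) =
      (\<Sum>i=1..N. \<integral>\<^sup>+u\<in>{pos N y (i - 1)..<pos N y i}. ennreal (\<bar>discrete_density N y u\<bar> powr q) \<partial>lebesgue)"
    using discrete_density_periodic
    by (intro nn_integral_partition[symmetric] meas) (simp add: one_periodic_def)
  also have "\<dots> = (\<Sum>i=1..N. ennreal ((1 / real N) powr q * gap N y i powr (1 - q)))"
  proof (rule sum.cong)
    fix i assume i: "i \<in> {1..N}"
    define R where "R = (1 / real N) / gap N y i"
    have g: "gap N y i > 0" using gap i by blast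
    have "(\<integral>\<^sup>+u\<in>{pos N y (i - 1)..<pos N y i}. ennreal (\<bar>discrete_density N y u\<bar> powr q) \<partial>lebesgue) =
        (\<integral>\<^sup>+u. ennreal (R powr q) * indicator {pos N y (i - 1)..<pos N y i} u \<partial>lebesgue)"
      using discrete_density_eq[OF i] g N by (intro nn_integral_cong) (auto simp: R_def split: split_indicator)
    also have "\<dots> = ennreal (R powr q) * ennreal (gap N y i)"
      using g by (subst nn_integral_cmult_indicator) (auto simp: gap_def)
    also have "\<dots> = ennreal ((1 / real N) powr q * gap N y i powr (1 - q))"
      using g N by (simp add: R_def ennreal_mult[symmetric] powr_divide powr_mult powr_diff)
    finally show "(\<integral>\<^sup>+u\<in>{pos N y (i - 1)..<pos N y i}. ennreal (\<bar>discrete_density N y u\<bar> powr q) \<partial>lebesgue) =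
      ennreal ((1 / real N) powr q * gap N y i powr (1 - q))" .
  qed simp
  also have "\<dots> = ennreal (\<Sum>i=1..N. (1 / real N) powr q * gap N y i powr (1 - q))"
    by (simp add: sum_ennreal)
  finally show ?thesis by (simp add: sum_distrib_left)
qed

lemma Lp_norm_discrete_density_le:
  assumes "(1 / real N) powr q * (\<Sum>i=1..N. gap N y i powr (1 - q)) \<le> C" "q \<ge> 1"
  shows "Lp_norm circle_measure (ennreal q) (discrete_density N y) \<le> ennreal (C powr (1 / q))"
proof -
  have "0 \<le> (1 / real N) powr q * (\<Sum>i=1..N. gap N y i powr (1 - q))"
    by (intro mult_nonneg_nonneg sum_nonneg) auto
  then show ?thesis
    using assms by (auto simp: Lp_norm_def Let_def nn_integral_discrete_density_powr intro!: ennreal_leI powr_mono2)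
qed

lemma Linfty_norm_discrete_density_le:
  assumes "\<And>i. i \<in> {1..N} \<Longrightarrow> (1 / real N) / gap N y i \<le> C"
  shows "Lp_norm circle_measure \<infinity> (discrete_density N y) \<le> ennreal C"
proof -
  have b: "\<bar>discrete_density N y u\<bar> \<le> C" for u
  proof -
    obtain i where "i \<in> {1..N}" "discrete_density N y u = (1 / real N) / gap N y i"
      by (rule discrete_density_cases)
    then show ?thesis using assms[of i] gap[of i] by simp
  qed
  have "discrete_density N y \<in> borel_measurable circle_measure"
    unfolding circle_measure_def by (intro measurable_restrict_space1 measurable_completion) simp
  then have "(\<lambda>u. ennreal \<bar>discrete_density N y u\<bar>) \<in> borel_measurable circle_measure" by simp
  then show ?thesis unfolding Lp_norm_def using b by (auto intro!: esssup_I ennreal_leI)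
qed

end

section \<open>Atomizations and Jensen's inequality\<close>

lemma ennreal_integral_le_nn_integral:
  fixes f :: "'a \<Rightarrow> real"
  assumes "integrable M f"
  shows "ennreal (integral\<^sup>L M f) \<le> (\<integral>\<^sup>+u. ennreal (f u) \<partial>M)"
proof -
  have "integral\<^sup>L M f \<le> enn2real (\<integral>\<^sup>+u. ennreal (f u) \<partial>M)"
    using assms by (simp add: real_lebesgue_integral_def)
  then have "ennreal (integral\<^sup>L M f) \<le> ennreal (enn2real (\<integral>\<^sup>+u. ennreal (f u) \<partial>M))"
    by (rule ennreal_leI)
  also have "\<dots> = (\<integral>\<^sup>+u. ennreal (f u) \<partial>M)"
    using assms by (simp add: real_integrable_def less_top)
  finally show ?thesis .
qed

text \<open>The tangent line of the convex power function at \<open>R\<close>. The mean value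
  theorem is applied on positive arguments, so \<open>m = 0\<close> is treated by hand; there the
  left side is \<open>(1 - q) * R powr q\<close>.\<close>

lemma powr_tangent:
  fixes m R q :: real
  assumes "q \<ge> 1" "R > 0" "m \<ge> 0"
  shows "R powr q + q * R powr (q - 1) * (m - R) \<le> m powr q"
proof (cases "m = 0")
  case True
  have "R powr q + q * R powr (q - 1) * (m - R) = (1 - q) * R powr q"
    using True assms powr_mult_base[of R "q - 1"] by (simp add: algebra_simps)
  also have "\<dots> \<le> 0" using assms by (simp add: mult_nonpos_nonneg)
  finally show ?thesis using True by simp
next
  case False
  then have m: "m > 0" using assms by simp
  have der: "((\<lambda>r. r powr q) has_real_derivative q * r powr (q - 1)) (at r)" if "r > 0" for r
    using has_real_derivative_powr[OF that, of q] by simp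
  have mono: "q * r powr (q - 1) \<le> q * s powr (q - 1)" if "0 < r" "r \<le> s" for r s
    using that assms by (intro mult_left_mono powr_mono2) auto
  show ?thesis
  proof (cases R m rule: linorder_cases)
    case less
    obtain z where z: "R < z" "z < m" "m powr q - R powr q = (m - R) * (q * z powr (q - 1))"
      using MVT2[OF less, of "\<lambda>r. r powr q" "\<lambda>r. q * r powr (q - 1)"] der assms by auto
    have "(m - R) * (q * R powr (q - 1)) \<le> (m - R) * (q * z powr (q - 1))"
      using mult_left_mono[OF mono[of R z], of "m - R"] z less assms by simp
    then show ?thesis using z(3) by (simp add: mult.commute)
  next
    case greater
    obtain z where z: "m < z" "z < R" "R powr q - m powr q = (R - m) * (q * z powr (q - 1))"
      using MVT2[OF greater, of "\<lambda>r. r powr q" "\<lambda>r. q * r powr (q - 1)"] der m by auto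
    have "(R - m) * (q * z powr (q - 1)) \<le> (R - m) * (q * R powr (q - 1))"
      using mult_left_mono[OF mono[of z R], of "R - m"] z greater m by simp
    moreover have "(R - m) * (q * R powr (q - 1)) = - (q * R powr (q - 1) * (m - R))"
      by (simp add: algebra_simps)
    ultimately show ?thesis using z(3) by linarith
  qed simp
qed

text \<open>The set where the bound fails is periodic, so the integral of its indicator vanishes
  over every integer translate of the fundamental domain as soon as it vanishes over one.\<close>

lemma AE_lebesgue_periodic:
  assumes m: "m \<in> borel_measurable lebesgue" and per: "one_periodic m"
    and ae: "AE u in circle_measure. (m u :: real) \<le> C"
  shows "AE u in lebesgue. m u \<le> C"
proof -
  define S where "S = {u. \<not> m u \<le> C}"
  have S: "S \<in> sets lebesgue"
    using borel_measurable_le[OF m, of "\<lambda>_. C"] sets.compl_sets[of "{u \<in> space lebesgue. m u \<le> C}" lebesgue]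
    by (simp add: S_def Compl_eq_Diff_UNIV[symmetric] Collect_neg_eq)
  have per': "one_periodic (indicator S :: real \<Rightarrow> ennreal)"
    using per by (auto simp: one_periodic_def S_def indicator_def)
  have "AE u in lebesgue. u \<in> {0..<1} \<longrightarrow> m u \<le> C"
    using ae unfolding circle_measure_def by (subst (asm) AE_restrict_space_iff) auto
  moreover have iff: "(\<integral>\<^sup>+u\<in>{a..<b}. indicator S u \<partial>lebesgue) = 0 \<longleftrightarrow>
      (AE u in lebesgue. u \<in> {a..<b} \<longrightarrow> m u \<le> C)" for a b
  proof -
    have "(\<lambda>u. indicator S u * indicator {a..<b} u :: ennreal) \<in> borel_measurable lebesgue"
      by (intro borel_measurable_times_ennreal borel_measurable_indicator S) auto
    then have "(\<integral>\<^sup>+u\<in>{a..<b}. indicator S u \<partial>lebesgue) = 0 \<longleftrightarrow>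
        (AE u in lebesgue. indicator S u * indicator {a..<b} u = (0 :: ennreal))"
      by (rule nn_integral_0_iff_AE)
    also have "\<dots> \<longleftrightarrow> (AE u in lebesgue. u \<in> {a..<b} \<longrightarrow> m u \<le> C)"
      by (intro arg_cong[where f="\<lambda>P. eventually P (ae_filter lebesgue)"] ext) (auto simp: S_def indicator_def)
    finally show ?thesis .
  qed
  ultimately have "(\<integral>\<^sup>+u\<in>{0..<1}. indicator S u \<partial>lebesgue) = 0" by blast
  then have "(\<integral>\<^sup>+u\<in>{of_int k..<of_int k + 1}. indicator S u \<partial>lebesgue) = 0" for k :: int
    using nn_integral_periodic[OF borel_measurable_indicator[OF S] per', of "of_int k"] by simp
  then have "AE u in lebesgue. u \<in> {of_int k..<of_int k + 1} \<longrightarrow> m u \<le> C" for k :: int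
    unfolding iff .
  then have "AE u in lebesgue. \<forall>k::int. u \<in> {of_int k..<of_int k + 1} \<longrightarrow> m u \<le> C"
    by (simp only: AE_all_countable) blast
  then show ?thesis
  proof eventually_elim
    case (elim u)
    then show ?case using spec[OF elim, of "\<lfloor>u\<rfloor>"] by auto
  qed
qed

text \<open>A non-integrable function has integral 0 by convention, so the non-zero mass
  \<open>1 / real N\<close> of a cell already forces integrability there.\<close>

lemma atomization_integrable:
  assumes "atomization N m y" "N \<ge> 1" "i \<in> {1..N}"
  shows "integrable lebesgue (\<lambda>u. indicator {pos N y (i - 1)..pos N y i} u * m u)"
    and "(LINT u|lebesgue. indicator {pos N y (i - 1)..pos N y i} u * m u) = 1 / real N"
proof -
  show *: "(LINT u|lebesgue. indicator {pos N y (i - 1)..pos N y i} u * m u) = 1 / real N"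
    using assms by (auto simp: atomization_def set_lebesgue_integral_def)
  then show "integrable lebesgue (\<lambda>u. indicator {pos N y (i - 1)..pos N y i} u * m u)"
    using assms(2) not_integrable_integral_eq by fastforce
qed

lemma atomization_Linfty_le:
  assumes at: "atomization N m y" and N: "N \<ge> 1" and gap: "\<And>i. i \<in> {1..N} \<Longrightarrow> 0 < gap N y i"
    and b: "AE u in lebesgue. m u \<le> C" and i: "i \<in> {1..N}"
  shows "(1 / real N) / gap N y i \<le> C"
proof -
  let ?S = "{pos N y (i - 1)..pos N y i}"
  have g: "gap N y i > 0" using gap i by blast
  have "1 / real N = (LINT u|lebesgue. indicator ?S u * m u)"
    using atomization_integrable(2)[OF at N i] by simp
  also have "\<dots> \<le> (LINT u|lebesgue. C * indicator ?S u)"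
  proof (rule integral_mono_AE)
    show "integrable lebesgue (\<lambda>u. indicator ?S u * m u)" by (rule atomization_integrable(1)[OF at N i])
    show "integrable lebesgue (\<lambda>u. C * indicator ?S u)"
      by (intro integrable_mult_right integrable_real_indicator) (auto simp: emeasure_lborel_Icc_eq)
    show "AE u in lebesgue. indicator ?S u * m u \<le> C * indicator ?S u"
      using b by eventually_elim (auto simp: indicator_def)
  qed
  also have "\<dots> = C * gap N y i" using g by (simp add: gap_def)
  finally show ?thesis using g by (subst pos_divide_le_eq)
qed

text \<open>Jensen's inequality on each cell, where the discrete density is the mean of
  \<open>m\<close>. The right side may be infinite, hence the formulation in
  \<open>ennreal\<close>.\<close>

lemma atomization_Lp_le:
  assumes at: "atomization N m y" and N: "N \<ge> 1" and gap: "\<And>i. i \<in> {1..N} \<Longrightarrow> 0 < gap N y i"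
    and m: "m \<in> borel_measurable lebesgue" and per: "one_periodic m"
    and nonneg: "AE u in lebesgue. 0 \<le> m u" and q: "q \<ge> 1"
  shows "ennreal ((1 / real N) powr q * (\<Sum>i=1..N. gap N y i powr (1 - q))) \<le>
    (\<integral>\<^sup>+u. ennreal (\<bar>m u\<bar> powr q) \<partial>circle_measure)"
proof -
  have piece: "ennreal ((1 / real N) powr q * gap N y i powr (1 - q)) \<le>
      (\<integral>\<^sup>+u\<in>{pos N y (i - 1)..<pos N y i}. ennreal (\<bar>m u\<bar> powr q) \<partial>lebesgue)" if i: "i \<in> {1..N}" for i
  proof -
    let ?S = "{pos N y (i - 1)..pos N y i}"
    have g: "gap N y i > 0" using gap i by blast
    define R where "R = (1 / real N) / gap N y i"
    have R: "R > 0" using g N by (simp add: R_def)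
    \<comment> \<open>\<open>A + B * m\<close> is the tangent line of the power at the cell mean
      \<open>R\<close>. Its linear part integrates to 0 over the cell, so its integral is
      \<open>R powr q\<close> times the gap.\<close>
    define A B where "A = R powr q - q * R powr (q - 1) * R" and "B = q * R powr (q - 1)"
    have S_int: "integrable lebesgue (\<lambda>u. indicator ?S u :: real)" "(LINT u|lebesgue. indicator ?S u) = gap N y i"
      using g by (auto simp: gap_def emeasure_lborel_Icc_eq intro!: integrable_real_indicator)
    note m_int = atomization_integrable[OF at N i]
    have f_int: "integrable lebesgue (\<lambda>u. A * indicator ?S u + B * (indicator ?S u * m u))"
      using S_int(1) m_int(1) by (intro Bochner_Integration.integrable_add integrable_mult_right)
    have "(LINT u|lebesgue. A * indicator ?S u + B * (indicator ?S u * m u)) = A * gap N y i + B * (1 / real N)"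
      using S_int m_int by simp
    also have "\<dots> = R powr q * gap N y i"
      using g N by (simp add: A_def B_def R_def algebra_simps)
    also have "\<dots> = (1 / real N) powr q * gap N y i powr (1 - q)"
      using g N by (simp add: R_def powr_divide powr_mult powr_diff)
    finally have "ennreal ((1 / real N) powr q * gap N y i powr (1 - q)) =
        ennreal (LINT u|lebesgue. A * indicator ?S u + B * (indicator ?S u * m u))" by simp
    also have "\<dots> \<le> (\<integral>\<^sup>+u. ennreal (A * indicator ?S u + B * (indicator ?S u * m u)) \<partial>lebesgue)"
      by (rule ennreal_integral_le_nn_integral[OF f_int])
    also have "\<dots> \<le> (\<integral>\<^sup>+u\<in>{pos N y (i - 1)..<pos N y i}. ennreal (\<bar>m u\<bar> powr q) \<partial>lebesgue)"
    proof (rule nn_integral_mono_AE)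
      \<comment> \<open>Atomizations use closed cells and the partition half-open ones; the right
        end point is a null set.\<close>
      have "AE u in lebesgue. u \<noteq> pos N y i"
        using AE_not_in[of "{pos N y i}" lebesgue] by (simp add: negligible_iff_null_sets[symmetric])
      with nonneg show "AE u in lebesgue. ennreal (A * indicator ?S u + B * (indicator ?S u * m u)) \<le>
          ennreal (\<bar>m u\<bar> powr q) * indicator {pos N y (i - 1)..<pos N y i} u"
      proof eventually_elim
        case (elim u)
        show ?case
        proof (cases "u \<in> ?S")
          case True
          then have "u \<in> {pos N y (i - 1)..<pos N y i}" using elim(2) by auto
          moreover have "A + B * m u \<le> \<bar>m u\<bar> powr q"
            using powr_tangent[OF q R elim(1)] elim(1) by (simp add: A_def B_def algebra_simps)
          ultimately show ?thesis using True by (simp add: ennreal_leI)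
        qed simp
      qed
    qed
    finally show ?thesis .
  qed
  have meas: "(\<lambda>u. ennreal (\<bar>m u\<bar> powr q)) \<in> borel_measurable lebesgue" using m by measurable
  have per': "one_periodic (\<lambda>u. ennreal (\<bar>m u\<bar> powr q))" using per by (simp add: one_periodic_def)
  have "ennreal ((1 / real N) powr q * (\<Sum>i=1..N. gap N y i powr (1 - q))) =
      (\<Sum>i=1..N. ennreal ((1 / real N) powr q * gap N y i powr (1 - q)))"
    by (simp add: sum_ennreal sum_distrib_left)
  also have "\<dots> \<le> (\<Sum>i=1..N. \<integral>\<^sup>+u\<in>{pos N y (i - 1)..<pos N y i}. ennreal (\<bar>m u\<bar> powr q) \<partial>lebesgue)"
    by (rule sum_mono[OF piece])
  also have "\<dots> = (\<integral>\<^sup>+u. ennreal (\<bar>m u\<bar> powr q) \<partial>circle_measure)"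
    by (rule nn_integral_partition[OF N gap meas per'])
  finally show ?thesis .
qed

text \<open>If a cell had density \<open>z * C\<close> with \<open>z > 1\<close>, its contribution
  \<open>(z * C)^q * gap\<close> would stay below the end values, hence below \<open>C^q\<close>,
  for every exponent \<open>q\<close>; but \<open>z^q * gap\<close> is unbounded in
  \<open>q\<close>.\<close>

lemma (in particle_minimizer) density_le_of_endpoints:
  assumes C: "C > 0"
    and b0: "\<And>i. i \<in> {1..N} \<Longrightarrow> (1 / real N) / gap N (x 0) i \<le> C"
    and bT: "\<And>i. i \<in> {1..N} \<Longrightarrow> (1 / real N) / gap N (x T) i \<le> C"
    and t: "t \<in> {0..T}" and i: "i \<in> {1..N}"
  shows "(1 / real N) / gap N (x t) i \<le> C"
proof (rule ccontr)
  assume "\<not> ?thesis"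
  then have gt: "C < (1 / real N) / gap N (x t) i" by simp
  define z where "z = (1 / real N) / gap N (x t) i / C"
  have "z > 1" using gt C unfolding z_def by (subst less_divide_eq_1_pos)
  have g: "gap N (x t) i > 0" using gap_pos t i by blast
  \<comment> \<open>This exponent makes \<open>z^n * gap\<close> exceed 1. Passing to
    \<open>n + 1\<close> guarantees \<open>q \<ge> 1\<close> even for \<open>n = 0\<close>.\<close>
  obtain n where n: "1 / gap N (x t) i < z ^ n" using real_arch_pow[OF \<open>z > 1\<close>] by blast
  define q where "q = real (Suc n)"
  have q: "q \<ge> 1" by (simp add: q_def)
  \<comment> \<open>Rewritten as a mean of q-th powers of densities: the gaps are weights that add
    up to 1.\<close>
  have end_le: "(1 / real N) powr q * (\<Sum>i=1..N. gap N (x s) i powr (1 - q)) \<le> C powr q"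
    if s: "s \<in> {0..T}" and b: "\<And>i. i \<in> {1..N} \<Longrightarrow> (1 / real N) / gap N (x s) i \<le> C" for s
  proof -
    have "(1 / real N) powr q * (\<Sum>i=1..N. gap N (x s) i powr (1 - q)) =
        (\<Sum>i=1..N. ((1 / real N) / gap N (x s) i) powr q * gap N (x s) i)"
      unfolding sum_distrib_left
    proof (rule sum.cong)
      fix i assume "i \<in> {1..N}"
      then have "gap N (x s) i > 0" using gap_pos s by blast
      then show "(1 / real N) powr q * gap N (x s) i powr (1 - q) =
          ((1 / real N) / gap N (x s) i) powr q * gap N (x s) i"
        using N_pos by (simp add: powr_divide powr_mult powr_diff)
    qed simp
    also have "\<dots> \<le> (\<Sum>i=1..N. C powr q * gap N (x s) i)"
    proof (rule sum_mono)
      fix i assume i: "i \<in> {1..N}"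
      then have "gap N (x s) i > 0" using gap_pos s by blast
      then show "((1 / real N) / gap N (x s) i) powr q * gap N (x s) i \<le> C powr q * gap N (x s) i"
        using b[OF i] q by (intro mult_right_mono powr_mono2) auto
    qed
    also have "\<dots> = C powr q"
      using sum_gap[OF N_pos gap_pos[OF s]] by (simp add: sum_distrib_left[symmetric])
    finally show ?thesis .
  qed
  have "0 \<in> {0..T}" "T \<in> {0..T}" using T_pos by auto
  then have "(1 / real N) powr q * max (\<Sum>i=1..N. gap N (x 0) i powr (1 - q)) (\<Sum>i=1..N. gap N (x T) i powr (1 - q)) \<le> C powr q"
    using end_le[of 0] end_le[of T] b0 bT by (simp add: max_def)
  moreover have "(1 / real N) powr q * (\<Sum>i=1..N. gap N (x t) i powr (1 - q)) \<le>
      (1 / real N) powr q * max (\<Sum>i=1..N. gap N (x 0) i powr (1 - q)) (\<Sum>i=1..N. gap N (x T) i powr (1 - q))"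
    by (intro mult_left_mono sum_gap_powr_le q t) simp
  moreover have "(1 / real N) powr q * gap N (x t) i powr (1 - q) \<le>
      (1 / real N) powr q * (\<Sum>i=1..N. gap N (x t) i powr (1 - q))"
    using i by (intro mult_left_mono member_le_sum) auto
  moreover have "(1 / real N) powr q * gap N (x t) i powr (1 - q) = (z * C) powr q * gap N (x t) i"
    using g N_pos C by (simp add: z_def powr_divide powr_mult powr_diff)
  ultimately have "(z * C) powr q * gap N (x t) i \<le> C powr q" by linarith
  then have "z powr q * gap N (x t) i \<le> 1"
    using C \<open>z > 1\<close> by (simp add: powr_mult mult.commute mult.left_commute)
  moreover have "z powr q = z * z ^ n"
    using \<open>z > 1\<close> by (simp add: q_def powr_realpow flip: of_nat_Suc)
  ultimately have "z * z ^ n * gap N (x t) i \<le> 1" by simp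
  moreover have "1 < z ^ n * gap N (x t) i" using n g by (simp add: field_simps)
  ultimately show False
    using \<open>z > 1\<close> mult_strict_mono[of 1 z 1 "z ^ n * gap N (x t) i"] by (simp add: mult.assoc)
qed

section \<open>Monotone derivatives from convexity\<close>

lemma uniformly_convex_deriv_mono:
  assumes L: "\<And>u. (L has_real_derivative L' u) (at u)"
    and conv: "\<And>u v l. l \<in> {0..1} \<Longrightarrow>
        L (l * u + (1 - l) * v) \<le> l * L u + (1 - l) * L v - \<theta> * l * (1 - l) * (u - v)\<^sup>2"
    and uv: "u \<le> v"
  shows "2 * \<theta> * (v - u) \<le> L' v - L' u"
proof -
  \<comment> \<open>Uniform convexity with constant \<open>\<theta>\<close> is ordinary convexity
    after subtracting \<open>\<theta> * u^2\<close>, because the quadratic defect is exact. The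
    derivative of that square is the source of the factor 2.\<close>
  define K where "K u = L u - \<theta> * u\<^sup>2" for u
  have "convex_on UNIV K"
  proof (rule convex_onI)
    fix t a b :: real assume t: "0 < t" "t < 1"
    have "L ((1 - t) * a + (1 - (1 - t)) * b) \<le>
        (1 - t) * L a + (1 - (1 - t)) * L b - \<theta> * (1 - t) * (1 - (1 - t)) * (a - b)\<^sup>2"
      by (rule conv) (use t in auto)
    moreover have "\<theta> * ((1 - t) * a + t * b)\<^sup>2 =
        (1 - t) * (\<theta> * a\<^sup>2) + t * (\<theta> * b\<^sup>2) - \<theta> * (1 - t) * t * (a - b)\<^sup>2"
      by (simp add: power2_eq_square algebra_simps)
    ultimately show "K ((1 - t) *\<^sub>R a + t *\<^sub>R b) \<le> (1 - t) * K a + t * K b"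
      by (simp add: K_def algebra_simps)
  qed simp
  moreover have "(K has_real_derivative L' u - 2 * \<theta> * u) (at u)" for u
    unfolding K_def[abs_def] by (auto intro!: derivative_eq_intros L)
  ultimately have t: "(L' a - 2 * \<theta> * a) * (b - a) \<le> K b - K a" for a b
    by (intro convex_on_imp_above_tangent[of UNIV]) auto
  show ?thesis
  proof (cases "u = v")
    case False
    then have "v - u > 0" using uv by simp
    moreover have "0 \<le> (v - u) * ((L' v - 2 * \<theta> * v) - (L' u - 2 * \<theta> * u))"
      using t[of u v] t[of v u] by (simp add: algebra_simps)
    ultimately have "0 \<le> (L' v - 2 * \<theta> * v) - (L' u - 2 * \<theta> * u)"
      by (metis mult_le_cancel_left_pos mult_zero_right)
    then show ?thesis by (simp add: algebra_simps)
  qed simp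
qed

text \<open>Adding the tangent inequalities at the two points, each evaluated at the other point,
  leaves a product with the factor \<open>s - r\<close>.\<close>

lemma convex_on_deriv_mono:
  assumes conv: "convex_on {0<..} G" and G: "\<And>r. r > 0 \<Longrightarrow> (G has_real_derivative G' r) (at r)"
    and r: "0 < r" "r \<le> s"
  shows "G' r \<le> G' s"
proof (cases "r = s")
  case False
  have t: "G' a * (b - a) \<le> G b - G a" if "0 < a" "0 < b" for a b
  proof (rule convex_on_imp_above_tangent[OF conv])
    show "a \<in> interior {0<..}" "b \<in> {0<..}"
      using that interior_open[OF open_greaterThan, of "0 :: real"] by auto
    show "(G has_real_derivative G' a) (at a within {0<..})"
      using G[OF that(1)] by (rule has_field_derivative_at_within)
  qed (rule connected_Ioi)
  have "0 \<le> (s - r) * (G' s - G' r)"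
    using t[of r s] t[of s r] r by (simp add: algebra_simps)
  then show ?thesis using False r by (simp add: zero_le_mult_iff)
qed simp

lemma C1_halfline_mono_deriv_nonneg:
  assumes "C1_halfline g" "mono_on {0..} g" "s > 0"
  shows "0 \<le> deriv g s"
proof -
  obtain g' where "(g has_real_derivative g' s) (at s within {0..})"
    using assms(1,3) unfolding C1_halfline_def by (meson atLeast_iff less_imp_le)
  then have d: "(g has_real_derivative g' s) (at s within {0<..})"
    by (rule has_field_derivative_subset) auto
  then have d: "(g has_real_derivative g' s) (at s)"
    using assms(3) at_within_open[of s "{0<..}"] by simp
  have "mono_on {0<..} g" using assms(2) by (rule mono_on_subset) auto
  moreover have "s \<in> interior {0<..}"
    using assms(3) interior_open[OF open_greaterThan, of "0 :: real"] by simp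
  ultimately have "0 \<le> g' s" by (rule mono_on_imp_deriv_nonneg[OF _ d])
  then show ?thesis using DERIV_imp_deriv[OF d] by simp
qed

section \<open>Verification of the assumptions and the uniform bound\<close>

theorem mainTheorem5:
  fixes g G L :: "real \<Rightarrow> real"
    and V :: "real \<Rightarrow> real \<Rightarrow> real"
    and T :: real
    and p :: ennreal
    and m0 mT :: "real \<Rightarrow> real"
    and x0 xT :: "nat \<Rightarrow> nat \<Rightarrow> real"
    and x :: "nat \<Rightarrow> real \<Rightarrow> nat \<Rightarrow> real"
  assumes g_C1: "C1_halfline g"
    and g_mono: "mono_on {0..} g"
    and g_int: "\<exists>\<epsilon>>0. set_integrable lebesgue {0..\<epsilon>} (\<lambda>r. r * deriv g r)"
    and G_C1: "G C1_differentiable_on {0<..}"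
    and G_deriv: "\<And>r. r > 0 \<Longrightarrow>
          (G has_real_derivative (1 / r\<^sup>2 * (LINT s:{0..r}|lebesgue. s * deriv g s))) (at r)"
    and G_convex: "convex_on {0<..} G"
    and L_C2: "L C1_differentiable_on UNIV" "deriv L C1_differentiable_on UNIV"
    and L_bdd: "\<exists>c. \<forall>u. c \<le> L u"
    and L_convex: "uniformly_convex L"
    and T_pos: "T > 0"
    and V_C1: "C1_circle_strip T V"
    and V_x: "\<And>u t. t \<in> {0..T} \<Longrightarrow> ((\<lambda>v. V v t) has_real_derivative 0) (at u)"
    and p: "1 \<le> p"
    and m0_Lp: "m0 \<in> Lp_circle p"
    and mT_Lp: "mT \<in> Lp_circle p"
    and m0_nonneg: "AE u in lebesgue. 0 \<le> m0 u"
    and mT_nonneg: "AE u in lebesgue. 0 \<le> mT u"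
    and m0_mass: "(LINT u|circle_measure. m0 u) = 1"
    and mT_mass: "(LINT u|circle_measure. mT u) = 1"
    and x0: "\<And>N. N \<ge> 1 \<Longrightarrow> atomization N m0 (x0 N)"
    and xT: "\<And>N. N \<ge> 1 \<Longrightarrow> atomization N mT (xT N)"
    and sol: "\<And>N. N \<ge> 1 \<Longrightarrow> particle_solution L G V T N (x0 N) (xT N) (x N)"
    and ordered: "\<And>N t i. N \<ge> 1 \<Longrightarrow> t \<in> {0..T} \<Longrightarrow> i \<in> {1..N} \<Longrightarrow>
          pos N (x N t) (i - 1) < pos N (x N t) i"
  shows "(SUP N\<in>{1..}. SUP t\<in>{0..T}.
            Lp_norm circle_measure p (discrete_density N (x N t))) < \<infinity>"
proof -
  define Gp where "Gp r = 1 / r\<^sup>2 * (LINT s:{0..r}|lebesgue. s * deriv g s)" for r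
  have Gp_deriv: "(G has_real_derivative Gp r) (at r)" if "r > 0" for r
    using G_deriv[OF that] by (simp add: Gp_def)
  have Gp_nonneg: "0 \<le> Gp r" for r
  proof -
    \<comment> \<open>At \<open>s = 0\<close> the function \<open>g\<close> is only differentiable
      from the right, but there the factor \<open>s\<close> vanishes.\<close>
    have "0 \<le> s * deriv g s" if "s \<in> {0..r}" for s
      using C1_halfline_mono_deriv_nonneg[OF g_C1 g_mono, of s] that by (cases "s = 0") auto
    then have "0 \<le> (LINT s:{0..r}|lebesgue. s * deriv g s)"
      unfolding set_lebesgue_integral_def by (intro Bochner_Integration.integral_nonneg) (auto simp: indicator_def)
    then show ?thesis by (simp add: Gp_def)
  qed
  have Gp_mono: "Gp r \<le> Gp s" if "0 < r" "r \<le> s" for r s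
    using convex_on_deriv_mono[OF G_convex Gp_deriv that] .
  have Gp_cont: "continuous_on {0<..} Gp"
  proof -
    \<comment> \<open>Continuity is taken from the assumption that \<open>G\<close> is continuously
      differentiable, whose derivative is identified with \<open>Gp\<close>.\<close>
    have "continuous_on {0<..} (\<lambda>r. vector_derivative G (at r))"
      using G_C1 by (simp add: C1_differentiable_on_eq)
    then show ?thesis
      by (rule continuous_on_eq)
         (use Gp_deriv in \<open>auto simp: has_real_derivative_iff_has_vector_derivative intro!: vector_derivative_at\<close>)
  qed
  have L_d: "(L has_real_derivative deriv L u) (at u)" for u
    using L_C2(1) by (simp add: C1_differentiable_on_eq DERIV_deriv_iff_real_differentiable)
  have L'_d: "(deriv L has_real_derivative deriv (deriv L) u) (at u)" for u
    using L_C2(2) by (simp add: C1_differentiable_on_eq DERIV_deriv_iff_real_differentiable)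
  obtain \<theta> where \<theta>: "\<theta> > 0" "\<And>u v l. l \<in> {0..1} \<Longrightarrow>
      L (l * u + (1 - l) * v) \<le> l * L u + (1 - l) * L v - \<theta> * l * (1 - l) * (u - v)\<^sup>2"
    using L_convex unfolding uniformly_convex_def by blast
  have V_eq: "V u t = V 0 t" if "t \<in> {0..T}" for u t
    using DERIV_isconst_all[of "\<lambda>v. V v t" u 0] V_x[OF that] by simp
  have V_cont: "continuous_on {0..T} (V 0)"
  proof -
    have "continuous_on (UNIV \<times> {0..T}) (\<lambda>(u, t). V u t)"
    proof -
      obtain Vx Vt where "\<forall>z\<in>UNIV \<times> {0..T}. ((\<lambda>(u, t). V u t) has_derivative (\<lambda>(h, k). Vx z * h + Vt z * k))
          (at z within UNIV \<times> {0..T})"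
        using V_C1 unfolding C1_circle_strip_def by blast
      then show ?thesis by (intro has_derivative_continuous_on[of _ _ "\<lambda>z (h, k). Vx z * h + Vt z * k"]) blast
    qed
    then have "continuous_on {0..T} (\<lambda>t. (\<lambda>(u, t). V u t) (0, t))"
      by (rule continuous_on_compose2) (auto intro!: continuous_intros)
    then show ?thesis by simp
  qed
  define \<Gamma>' where "\<Gamma>' N r = - (Gp ((1 / real N) / r) * ((1 / real N) / r\<^sup>2))" for N r
  have gap_pos: "0 < gap N (x N t) i" if "N \<ge> 1" "t \<in> {0..T}" "i \<in> {1..N}" for N t i
    using ordered[OF that] by (simp add: gap_def)
  have pm: "particle_minimizer L (deriv L) (deriv (deriv L)) G (\<Gamma>' N) (V 0) V (2 * \<theta>) T N (x0 N) (xT N) (x N)"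
    if N: "N \<ge> 1" for N
  proof
    have inv_pos: "0 < (1 / real N) / r" if "r > 0" for r using N that by simp
    show "((\<lambda>r. G ((1 / real N) / r)) has_real_derivative \<Gamma>' N r) (at r)" if r: "r > 0" for r
    proof -
      have "((\<lambda>r. (1 / real N) / r) has_real_derivative - ((1 / real N) / r\<^sup>2)) (at r)"
        using r N by (auto intro!: derivative_eq_intros simp: power2_eq_square)
      from DERIV_chain2[OF Gp_deriv[OF inv_pos[OF r]] this] show ?thesis by (simp add: \<Gamma>'_def)
    qed
    show "continuous_on {0<..} (\<Gamma>' N)"
    proof -
      have "continuous_on {0<..} (\<lambda>r. (1 / real N) / r)" by (intro continuous_intros) auto
      then have "continuous_on {0<..} (\<lambda>r. Gp ((1 / real N) / r))"
        by (rule continuous_on_compose2[OF Gp_cont]) (use inv_pos in auto)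
      moreover have "continuous_on {0<..} (\<lambda>r. (1 / real N) / r\<^sup>2)" by (intro continuous_intros) auto
      ultimately show ?thesis
        unfolding \<Gamma>'_def[abs_def] by (intro continuous_on_minus continuous_on_mult)
    qed
    show "\<Gamma>' N r \<le> \<Gamma>' N s" if r: "0 < r" "r \<le> s" for r s
    proof -
      \<comment> \<open>A larger gap means a smaller density, so convexity of \<open>G\<close> makes
        the first factor non-increasing in the gap, as the second one is. Both are non-negative,
        hence so behaves the product, and the minus sign in \<open>\<Gamma>'\<close> reverses the
        order.\<close>
      have "Gp ((1 / real N) / s) * ((1 / real N) / s\<^sup>2) \<le> Gp ((1 / real N) / r) * ((1 / real N) / r\<^sup>2)"
      proof (rule mult_mono)
        show "Gp ((1 / real N) / s) \<le> Gp ((1 / real N) / r)"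
          using r N by (intro Gp_mono divide_left_mono) auto
        show "(1 / real N) / s\<^sup>2 \<le> (1 / real N) / r\<^sup>2"
          using r N by (intro divide_left_mono power_mono) auto
      qed (auto intro!: Gp_nonneg)
      then show ?thesis by (simp add: \<Gamma>'_def)
    qed
    show "\<Gamma>' N r \<le> 0" for r
      using mult_nonneg_nonneg[OF Gp_nonneg[of "(1 / real N) / r"], of "(1 / real N) / r\<^sup>2"] by (simp add: \<Gamma>'_def)
    show "2 * \<theta> * (v - u) \<le> deriv L v - deriv L u" if "u \<le> v" for u v
      by (rule uniformly_convex_deriv_mono[OF L_d \<theta>(2) that])
    show "V u t = V 0 t" if "t \<in> {0..T}" for u t using that by (rule V_eq)
    show "0 < gap N (x N t) i" if "t \<in> {0..T}" "i \<in> {1..N}" for t i using gap_pos[OF N that] .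
    show "2 * \<theta> > 0" using \<theta>(1) by simp
  qed (fact L_d L'_d L_bdd V_cont T_pos N sol[OF N])+
  \<comment> \<open>The end data are prescribed for the indices \<open>1..N\<close> only; this
    suffices because \<open>gap_eq\<close> expresses the gaps through these indices.\<close>
  have ends: "gap N (x N 0) i = gap N (x0 N) i" "gap N (x N T) i = gap N (xT N) i"
    if "N \<ge> 1" "i \<in> {1..N}" for N i
    using sol[OF that(1)] prev_index_in[OF that(2)] that(2)
    by (auto simp: particle_solution_def admissible_def gap_eq)
  have end_pos: "0 < gap N (x0 N) i" "0 < gap N (xT N) i" if "N \<ge> 1" "i \<in> {1..N}" for N i
    using gap_pos[OF that(1) _ that(2), of 0] gap_pos[OF that(1) _ that(2), of T] ends[OF that] T_pos by auto
  have m0: "m0 \<in> borel_measurable lebesgue" "one_periodic m0" "Lp_norm circle_measure p m0 < \<infinity>"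
    and mT: "mT \<in> borel_measurable lebesgue" "one_periodic mT" "Lp_norm circle_measure p mT < \<infinity>"
    using m0_Lp mT_Lp by (auto simp: Lp_circle_def)
  have "\<exists>B::real. \<forall>N\<ge>1. \<forall>t\<in>{0..T}. Lp_norm circle_measure p (discrete_density N (x N t)) \<le> ennreal B"
  proof (cases p)
    case top
    have bd: "\<exists>C. AE u in lebesgue. m u \<le> C"
      if m: "m \<in> borel_measurable lebesgue" "one_periodic m" "Lp_norm circle_measure p m < \<infinity>" for m
    proof -
      define E where "E = esssup circle_measure (\<lambda>u. ennreal \<bar>m u\<bar>)"
      have E: "E < \<infinity>" using m(3) top by (simp add: Lp_norm_def E_def)
      have "AE u in circle_measure. ennreal \<bar>m u\<bar> \<le> E" unfolding E_def by (rule esssup_AE)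
      then have "AE u in circle_measure. m u \<le> enn2real E"
      proof eventually_elim
        case (elim u)
        have "enn2real (ennreal \<bar>m u\<bar>) \<le> enn2real E" using elim E by (intro enn2real_mono) auto
        then show ?case by simp
      qed
      then show ?thesis using AE_lebesgue_periodic[OF m(1,2)] by blast
    qed
    obtain C0 where C0: "AE u in lebesgue. m0 u \<le> C0" using bd[OF m0] by blast
    obtain CT where CT: "AE u in lebesgue. mT u \<le> CT" using bd[OF mT] by blast
    \<comment> \<open>The entry 1 secures \<open>C > 0\<close>, which
      \<open>density_le_of_endpoints\<close> divides by.\<close>
    define C where "C = max 1 (max C0 CT)"
    have "Lp_norm circle_measure p (discrete_density N (x N t)) \<le> ennreal C"
      if N: "N \<ge> 1" and t: "t \<in> {0..T}" for N t
    proof -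
      interpret particle_minimizer L "deriv L" "deriv (deriv L)" G "\<Gamma>' N" "V 0" V "2 * \<theta>" T N "x0 N" "xT N" "x N"
        by (rule pm[OF N])
      have "(1 / real N) / gap N (x N 0) i \<le> C" if i: "i \<in> {1..N}" for i
        using atomization_Linfty_le[OF x0[OF N] N end_pos(1)[OF N] C0 i] ends(1)[OF N i] by (simp add: C_def)
      moreover have "(1 / real N) / gap N (x N T) i \<le> C" if i: "i \<in> {1..N}" for i
        using atomization_Linfty_le[OF xT[OF N] N end_pos(2)[OF N] CT i] ends(2)[OF N i] by (simp add: C_def)
      moreover have "C > 0" by (simp add: C_def)
      ultimately have "(1 / real N) / gap N (x N t) i \<le> C" if "i \<in> {1..N}" for i
        using density_le_of_endpoints[OF _ _ _ t that] by blast
      then show ?thesis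
        using Linfty_norm_discrete_density_le[OF N gap_pos[OF t]] top by simp
    qed
    then show ?thesis by blast
  next
    case (real q)
    then have q: "q \<ge> 1" using p by (simp add: ennreal_le_iff flip: ennreal_1)
    \<comment> \<open>\<open>Lp_norm\<close> is infinite by definition when the integral is, so a
      finite norm lets \<open>enn2real\<close> in \<open>J\<close> keep the value of the
      integral.\<close>
    have fin: "(\<integral>\<^sup>+ u. ennreal (\<bar>m u\<bar> powr q) \<partial>circle_measure) < \<infinity>"
      if "Lp_norm circle_measure p m < \<infinity>" for m
      using that real by (auto simp: Lp_norm_def Let_def less_top split: if_splits)
    define J where "J m = enn2real (\<integral>\<^sup>+ u. ennreal (\<bar>m u\<bar> powr q) \<partial>circle_measure)" for m
    have end_le: "(1 / real N) powr q * (\<Sum>i=1..N. gap N y i powr (1 - q)) \<le> J m"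
      if "atomization N m y" "N \<ge> 1" "\<And>i. i \<in> {1..N} \<Longrightarrow> 0 < gap N y i"
        "m \<in> borel_measurable lebesgue" "one_periodic m" "AE u in lebesgue. 0 \<le> m u"
        "Lp_norm circle_measure p m < \<infinity>" for N m y
    proof -
      have "0 \<le> (1 / real N) powr q * (\<Sum>i=1..N. gap N y i powr (1 - q))"
        by (intro mult_nonneg_nonneg sum_nonneg) auto
      then show ?thesis
        using enn2real_mono[OF atomization_Lp_le[OF that(1-6) q]] fin[OF that(7)] by (simp add: J_def)
    qed
    define C where "C = max (J m0) (J mT)"
    \<comment> \<open>The constant involves only the two q-th power integrals of \<open>m0\<close>
      and \<open>mT\<close>, hence neither \<open>N\<close> nor \<open>t\<close>.\<close>
    have "Lp_norm circle_measure p (discrete_density N (x N t)) \<le> ennreal (C powr (1 / q))"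
      if N: "N \<ge> 1" and t: "t \<in> {0..T}" for N t
    proof -
      interpret particle_minimizer L "deriv L" "deriv (deriv L)" G "\<Gamma>' N" "V 0" V "2 * \<theta>" T N "x0 N" "xT N" "x N"
        by (rule pm[OF N])
      let ?S = "\<lambda>y. \<Sum>i=1..N. gap N y i powr (1 - q)"
      have "?S (x N 0) = ?S (x0 N)" "?S (x N T) = ?S (xT N)" using ends[OF N] by auto
      then have "(1 / real N) powr q * ?S (x N 0) \<le> C" "(1 / real N) powr q * ?S (x N T) \<le> C"
        using end_le[OF x0[OF N] N end_pos(1)[OF N] m0(1,2) m0_nonneg m0(3)]
          end_le[OF xT[OF N] N end_pos(2)[OF N] mT(1,2) mT_nonneg mT(3)]
        by (auto simp: C_def)
      then have "(1 / real N) powr q * max (?S (x N 0)) (?S (x N T)) \<le> C" by (simp add: max_def)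
      moreover have "(1 / real N) powr q * ?S (x N t) \<le> (1 / real N) powr q * max (?S (x N 0)) (?S (x N T))"
        by (intro mult_left_mono sum_gap_powr_le q t) simp
      ultimately have "(1 / real N) powr q * ?S (x N t) \<le> C" by linarith
      then show ?thesis
        using Lp_norm_discrete_density_le[OF N gap_pos[OF t] _ q, of C] real by simp
    qed
    then show ?thesis by blast
  qed
  then obtain B :: real where B:
    "\<And>N t. N \<ge> 1 \<Longrightarrow> t \<in> {0..T} \<Longrightarrow> Lp_norm circle_measure p (discrete_density N (x N t)) \<le> ennreal B"
    by blast
  have "(SUP N\<in>{1..}. SUP t\<in>{0..T}. Lp_norm circle_measure p (discrete_density N (x N t))) \<le> ennreal B"
    by (intro SUP_least B) auto
  also have "\<dots> < \<infinity>" by simp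
  finally show ?thesis .
qed

end
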